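(* There is an algorithm that, given a well-partitioned chordal graph $G$ with $n=|V(G)|$ together with a partition tree for every connected component of $G$, computes the edge open packing number $\rho_e^o(G)$ in $O(n^4)$ time. A maximum edge open packing of $G$ can be produced within the same time bound.
   Context: All graphs are finite, simple and undirected. Two distinct edges $e_1,e_2\in E(G)$ have a common edge if there is an edge $e\in E(G)\setminus\{e_1,e_2\}$ joining an endpoint of $e_1$ to an endpoint of $e_2$. A set $D\subseteq E(G)$ is an edge open packing if no two edges of $D$ have a common edge. The edge open packing number $\rho_e^o(G)$ is the maximum cardinality of an edge open packing of $G$, and an edge open packing of this cardinality is called maximum. For disjoint $X,Y\subseteq V(G)$, $E_G(X,Y)$ is the set of edges with one endpoint in $X$ and the other in $Y$. A connected graph $G$ is well-partitioned chordal if $V(G)$ admits a partition $\mathcal P$ into cliques (called bags) together with a tree $T$ whose nodes are the bags of $\mathcal P$, such that for every two distinct bags $X,Y$: if $XY\in E(T)$, there are sets $\operatorname{bd}(X,Y)\subseteq X$ and $\operatorname{bd}(Y,X)\subseteq Y$ such that $E_G(X,Y)$ consists of exactly all pairs $uv$ with $u\in\operatorname{bd}(X,Y)$ and $v\in\operatorname{bd}(Y,X)$; and if $XY\notin E(T)$, then $E_G(X,Y)=\emptyset$. Such a tree $T$ (with $\mathcal P$) is a partition tree of $G$. A disconnected graph is well-partitioned chordal if each of its connected components is. *)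

theory Defs
  imports "HOL-Library.Disjoint_Sets" "HOL-Library.Landau_Symbols"
begin

section \<open>Graphs\<close>

text \<open>A graph is given by its vertex set and its edge set, an edge being the two-element set of its
  endpoints.\<close>

definition simple_graph :: "'a set \<Rightarrow> 'a set set \<Rightarrow> bool" where
  "simple_graph V E \<longleftrightarrow> finite V \<and> (\<forall>e\<in>E. e \<subseteq> V \<and> card e = 2)"

definition adj_rel :: "'a set set \<Rightarrow> ('a \<times> 'a) set" where
  "adj_rel E = {(u, v). {u, v} \<in> E}"

definition connected_graph :: "'a set \<Rightarrow> 'a set set \<Rightarrow> bool" where
  "connected_graph V E \<longleftrightarrow>
     simple_graph V E \<and> V \<noteq> {} \<and> (\<forall>u\<in>V. \<forall>v\<in>V. (u, v) \<in> (adj_rel E)\<^sup>*)"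

definition graph_components :: "'a set \<Rightarrow> 'a set set \<Rightarrow> 'a set set" where
  "graph_components V E = (\<lambda>u. {v \<in> V. (u, v) \<in> (adj_rel E)\<^sup>*}) ` V"

definition induced_edges :: "'a set set \<Rightarrow> 'a set \<Rightarrow> 'a set set" where
  "induced_edges E X = {e \<in> E. e \<subseteq> X}"

definition is_clique :: "'a set set \<Rightarrow> 'a set \<Rightarrow> bool" where
  "is_clique E X \<longleftrightarrow> (\<forall>u\<in>X. \<forall>v\<in>X. u \<noteq> v \<longrightarrow> {u, v} \<in> E)"

definition edges_between :: "'a set set \<Rightarrow> 'a set \<Rightarrow> 'a set \<Rightarrow> 'a set set" where
  "edges_between E X Y = {e \<in> E. \<exists>u\<in>X. \<exists>v\<in>Y. e = {u, v}}"

definition is_cycle :: "'a set set \<Rightarrow> 'a list \<Rightarrow> bool" where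
  "is_cycle E xs \<longleftrightarrow> 3 \<le> length xs \<and> distinct xs \<and>
     (\<forall>i<length xs. {xs ! i, xs ! (Suc i mod length xs)} \<in> E)"

definition is_tree :: "'a set \<Rightarrow> 'a set set \<Rightarrow> bool" where
  "is_tree V E \<longleftrightarrow> connected_graph V E \<and> (\<nexists>xs. is_cycle E xs)"


section \<open>Edge open packings\<close>

definition have_common_edge :: "'a set set \<Rightarrow> 'a set \<Rightarrow> 'a set \<Rightarrow> bool" where
  "have_common_edge E e1 e2 \<longleftrightarrow> (\<exists>e \<in> E - {e1, e2}. \<exists>u\<in>e1. \<exists>v\<in>e2. e = {u, v})"

definition edge_open_packing :: "'a set set \<Rightarrow> 'a set set \<Rightarrow> bool" where
  "edge_open_packing E D \<longleftrightarrow> D \<subseteq> E \<and>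
     (\<forall>e1\<in>D. \<forall>e2\<in>D. e1 \<noteq> e2 \<longrightarrow> \<not> have_common_edge E e1 e2)"

definition eop_number :: "'a set set \<Rightarrow> nat" where
  "eop_number E = Max (card ` {D. edge_open_packing E D})"

definition max_edge_open_packing :: "'a set set \<Rightarrow> 'a set set \<Rightarrow> bool" where
  "max_edge_open_packing E D \<longleftrightarrow> edge_open_packing E D \<and> card D = eop_number E"


section \<open>Well-partitioned chordal graphs\<close>

definition partition_tree ::
    "'a set \<Rightarrow> 'a set set \<Rightarrow> 'a set set \<Rightarrow> 'a set set set \<Rightarrow> bool" where
  "partition_tree V E P T \<longleftrightarrow>
     partition_on V P \<and> (\<forall>X\<in>P. is_clique E X) \<and> is_tree P T \<and>
     (\<exists>bd. \<forall>X\<in>P. \<forall>Y\<in>P. X \<noteq> Y \<longrightarrow>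
        (if {X, Y} \<in> T
         then bd X Y \<subseteq> X \<and> bd Y X \<subseteq> Y \<and>
              edges_between E X Y = {{u, v} | u v. u \<in> bd X Y \<and> v \<in> bd Y X}
         else edges_between E X Y = {}))"

definition connected_well_partitioned_chordal :: "'a set \<Rightarrow> 'a set set \<Rightarrow> bool" where
  "connected_well_partitioned_chordal V E \<longleftrightarrow>
     connected_graph V E \<and> (\<exists>P T. partition_tree V E P T)"

definition well_partitioned_chordal :: "'a set \<Rightarrow> 'a set set \<Rightarrow> bool" where
  "well_partitioned_chordal V E \<longleftrightarrow> simple_graph V E \<and>
     (\<forall>C \<in> graph_components V E. connected_well_partitioned_chordal C (induced_edges E C))"


section \<open>Algorithms: a word RAM with structured control\<close>

text \<open>
  Programs work on registers and arrays holding natural numbers. All cells initially hold 0,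
  except for the input. Every operation has unit cost. A program is run for a fixed bound \<open>W\<close>, and
  every number that occurs in the run, array indices included, has to be below \<open>W\<close>: otherwise
  the run gets stuck and has no result. With \<open>W\<close> polynomial in the input size this is the usual
  word RAM with words of logarithmic length; the bound is what makes unit costs adequate in the
  presence of multiplication.
\<close>

datatype aexp =
    Const nat
  | Reg string
  | Arr string aexp
  | Add aexp aexp
  | Sub aexp aexp
  | Mul aexp aexp
  | Div aexp aexp

datatype bexp =
    Less aexp aexp
  | Equal aexp aexp
  | Neg bexp
  | Conj bexp bexp

datatype com =
    Skip
  | Assign string aexp
  | Store string aexp aexp
  | Seq com com
  | Cond bexp com com
  | While bexp com

record state =
  regs :: "string \<Rightarrow> nat"
  arrs :: "string \<Rightarrow> nat \<Rightarrow> nat"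

text \<open>Subtraction is truncated at 0, and division by 0 yields 0.\<close>

fun aval :: "aexp \<Rightarrow> state \<Rightarrow> nat" where
  "aval (Const k) s = k"
| "aval (Reg x) s = regs s x"
| "aval (Arr a e) s = arrs s a (aval e s)"
| "aval (Add e f) s = aval e s + aval f s"
| "aval (Sub e f) s = aval e s - aval f s"
| "aval (Mul e f) s = aval e s * aval f s"
| "aval (Div e f) s = aval e s div aval f s"

fun afits :: "nat \<Rightarrow> aexp \<Rightarrow> state \<Rightarrow> bool" where
  "afits W (Const k) s \<longleftrightarrow> k < W"
| "afits W (Reg x) s \<longleftrightarrow> regs s x < W"
| "afits W (Arr a e) s \<longleftrightarrow> afits W e s \<and> aval (Arr a e) s < W"
| "afits W (Add e f) s \<longleftrightarrow> afits W e s \<and> afits W f s \<and> aval (Add e f) s < W"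
| "afits W (Sub e f) s \<longleftrightarrow> afits W e s \<and> afits W f s"
| "afits W (Mul e f) s \<longleftrightarrow> afits W e s \<and> afits W f s \<and> aval (Mul e f) s < W"
| "afits W (Div e f) s \<longleftrightarrow> afits W e s \<and> afits W f s"

fun acost :: "aexp \<Rightarrow> nat" where
  "acost (Const k) = 1"
| "acost (Reg x) = 1"
| "acost (Arr a e) = 1 + acost e"
| "acost (Add e f) = 1 + acost e + acost f"
| "acost (Sub e f) = 1 + acost e + acost f"
| "acost (Mul e f) = 1 + acost e + acost f"
| "acost (Div e f) = 1 + acost e + acost f"

fun bval :: "bexp \<Rightarrow> state \<Rightarrow> bool" where
  "bval (Less e f) s \<longleftrightarrow> aval e s < aval f s"
| "bval (Equal e f) s \<longleftrightarrow> aval e s = aval f s"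
| "bval (Neg b) s \<longleftrightarrow> \<not> bval b s"
| "bval (Conj b c) s \<longleftrightarrow> bval b s \<and> bval c s"

text \<open>Both conjuncts are always evaluated.\<close>

fun bfits :: "nat \<Rightarrow> bexp \<Rightarrow> state \<Rightarrow> bool" where
  "bfits W (Less e f) s \<longleftrightarrow> afits W e s \<and> afits W f s"
| "bfits W (Equal e f) s \<longleftrightarrow> afits W e s \<and> afits W f s"
| "bfits W (Neg b) s \<longleftrightarrow> bfits W b s"
| "bfits W (Conj b c) s \<longleftrightarrow> bfits W b s \<and> bfits W c s"

fun bcost :: "bexp \<Rightarrow> nat" where
  "bcost (Less e f) = 1 + acost e + acost f"
| "bcost (Equal e f) = 1 + acost e + acost f"
| "bcost (Neg b) = 1 + bcost b"
| "bcost (Conj b c) = 1 + bcost b + bcost c"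

text \<open>\<open>exec W c s t s'\<close>: with word bound \<open>W\<close>, program \<open>c\<close> started in \<open>s\<close> halts in \<open>s'\<close> after
  time \<open>t\<close>.\<close>

inductive exec :: "nat \<Rightarrow> com \<Rightarrow> state \<Rightarrow> nat \<Rightarrow> state \<Rightarrow> bool" for W :: nat where
  Skip: "exec W Skip s 1 s"
| Assign: "afits W e s \<Longrightarrow>
    exec W (Assign x e) s (1 + acost e) (s\<lparr>regs := (regs s)(x := aval e s)\<rparr>)"
| Store: "afits W i s \<Longrightarrow> afits W e s \<Longrightarrow>
    exec W (Store a i e) s (1 + acost i + acost e)
      (s\<lparr>arrs := (arrs s)(a := (arrs s a)(aval i s := aval e s))\<rparr>)"
| Seq: "exec W c1 s t1 s1 \<Longrightarrow> exec W c2 s1 t2 s2 \<Longrightarrow> exec W (Seq c1 c2) s (t1 + t2) s2"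
| CondTrue: "bfits W b s \<Longrightarrow> bval b s \<Longrightarrow> exec W c1 s t s' \<Longrightarrow>
    exec W (Cond b c1 c2) s (1 + bcost b + t) s'"
| CondFalse: "bfits W b s \<Longrightarrow> \<not> bval b s \<Longrightarrow> exec W c2 s t s' \<Longrightarrow>
    exec W (Cond b c1 c2) s (1 + bcost b + t) s'"
| WhileFalse: "bfits W b s \<Longrightarrow> \<not> bval b s \<Longrightarrow> exec W (While b c) s (1 + bcost b) s"
| WhileTrue: "bfits W b s \<Longrightarrow> bval b s \<Longrightarrow> exec W c s t1 s1 \<Longrightarrow> exec W (While b c) s1 t2 s2 \<Longrightarrow>
    exec W (While b c) s (1 + bcost b + t1 + t2) s2"

inductive_cases exec_SkipE: "exec W Skip s t s'"
inductive_cases exec_AssignE: "exec W (Assign x e) s t s'"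
inductive_cases exec_StoreE: "exec W (Store a i e) s t s'"
inductive_cases exec_SeqE: "exec W (Seq c1 c2) s t s'"
inductive_cases exec_CondE: "exec W (Cond b c1 c2) s t s'"
inductive_cases exec_WhileE: "exec W (While b c) s t s'"

lemma exec_deterministic:
  "exec W c s t s' \<Longrightarrow> exec W c s u s'' \<Longrightarrow> u = t \<and> s'' = s'"
proof (induction arbitrary: u s'' rule: exec.induct)
  case (Skip s)
  from Skip.prems show ?case by (rule exec_SkipE) simp
next
  case (Assign e s x)
  from Assign.prems show ?case by (rule exec_AssignE) simp
next
  case (Store i s e a)
  from Store.prems show ?case by (rule exec_StoreE) simp
next
  case (Seq c1 s t1 s1 c2 t2 s2)
  from Seq.prems show ?case by (rule exec_SeqE) (metis Seq.IH)
next
  case (CondTrue b s c1 t s' c2)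
  from CondTrue.prems show ?case by (rule exec_CondE) (metis CondTrue.hyps CondTrue.IH plus_1_eq_Suc add_Suc)+
next
  case (CondFalse b s c2 t s' c1)
  from CondFalse.prems show ?case by (rule exec_CondE) (metis CondFalse.hyps CondFalse.IH plus_1_eq_Suc add_Suc)+
next
  case (WhileFalse b s c)
  from WhileFalse.prems show ?case by (rule exec_WhileE) (metis WhileFalse.hyps plus_1_eq_Suc add_Suc)+
next
  case (WhileTrue b s c t1 s1 t2 s2)
  from WhileTrue.prems show ?case by (rule exec_WhileE) (metis WhileTrue.hyps WhileTrue.IH plus_1_eq_Suc add_Suc)+
qed

definition halts_within :: "nat \<Rightarrow> com \<Rightarrow> state \<Rightarrow> nat \<Rightarrow> (state \<Rightarrow> bool) \<Rightarrow> bool" where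
  "halts_within W c s T Q \<longleftrightarrow> (\<exists>t s'. exec W c s t s' \<and> t \<le> T \<and> Q s')"


section \<open>Encoding of the input and of the output\<close>

text \<open>The vertices of an input graph are \<open>0, \<dots>, n - 1\<close>. Sets of edges on numbered vertices are passed
  as adjacency matrices, stored row by row.\<close>

definition edge_matrix :: "nat \<Rightarrow> nat set set \<Rightarrow> nat \<Rightarrow> nat" where
  "edge_matrix n E i = (if i < n * n \<and> {i div n, i mod n} \<in> E then 1 else 0)"

text \<open>The bags of the partition trees of all components are numbered jointly, by their position in
  a list \<open>bs\<close>, and \<open>F\<close> is the union of the edge sets of these trees. The input consists of the
  number of vertices, the adjacency matrix of the graph, the number of bags, the number of
  the bag of every vertex, and the adjacency matrix of the forest formed by the partition trees. The
  sets \<open>bd\<close> are not part of the input.\<close>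

definition input_state :: "nat \<Rightarrow> nat set set \<Rightarrow> nat set list \<Rightarrow> nat set set set \<Rightarrow> state" where
  "input_state n E bs F = \<lparr>
     regs = (\<lambda>_. 0)(''n'' := n, ''k'' := length bs),
     arrs = (\<lambda>_ _. 0)(
       ''graph'' := edge_matrix n E,
       ''bag'' := (\<lambda>v. if v < n then (THE i. i < length bs \<and> v \<in> bs ! i) else 0),
       ''forest'' := edge_matrix (length bs)
          {{i, j} | i j. i < length bs \<and> j < length bs \<and> {bs ! i, bs ! j} \<in> F})\<rparr>"

definition outputs_number :: "nat \<Rightarrow> state \<Rightarrow> bool" where
  "outputs_number m s \<longleftrightarrow> regs s ''result'' = m"

definition outputs_edge_set :: "nat \<Rightarrow> nat set set \<Rightarrow> state \<Rightarrow> bool" where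
  "outputs_edge_set n D s \<longleftrightarrow> (\<forall>i < n * n. arrs s ''result'' i = edge_matrix n D i)"

text \<open>\<open>P\<close> and \<open>T\<close> give, for every component, the bags and the edges of its partition tree.\<close>

definition partition_tree_family :: "nat \<Rightarrow> nat set set \<Rightarrow>
    (nat set \<Rightarrow> nat set set) \<Rightarrow> (nat set \<Rightarrow> nat set set set) \<Rightarrow> bool" where
  "partition_tree_family n E P T \<longleftrightarrow>
     (\<forall>C \<in> graph_components {..<n} E. partition_tree C (induced_edges E C) (P C) (T C))"

definition numbering_of :: "'b list \<Rightarrow> 'b set \<Rightarrow> bool" where
  "numbering_of bs B \<longleftrightarrow> distinct bs \<and> set bs = B"

end

theory Submission
  imports Defs
begin

text \<open>
  An edge open packing is the edge set of an induced star forest: choosing one leaf end for every edge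
  turns it into a pair \<open>(C, L)\<close> of disjoint independent sets such that every vertex of \<open>L\<close> has exactly one
  neighbour in \<open>C\<close>, and the number of edges is the number of leaves. A clique contains at most one centre
  and at most one leaf, so a bag \<open>X\<close> has only \<open>O(|X|\<^sup>2)\<close> states, and a dynamic program that repeatedly
  merges a leaf of the partition forest into its neighbour computes the optimum. Along a tree edge
  two states interact only through membership in the boundary sets, which leaves eight messages per merge;
  each merge takes time \<open>O(n\<^sup>2)\<close>, and one run takes \<open>O(n\<^sup>3)\<close>.

  A packing is found by self-reduction: the dynamic program is run for every vertex to test whether the
  vertex can be forbidden as a leaf, and then likewise as a centre, without lowering the optimum. When no
  vertex can be dropped any more, the remaining leaves and centres form an optimal pair. These \<open>2n + 1\<close>
  runs take time \<open>O(n\<^sup>4)\<close>.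
\<close>

section \<open>A program logic with implicit time bounds\<close>

text \<open>The leaf chosen in a bag may get its centre from a neighbouring bag that is merged
  later. A table entry therefore also carries the number \<open>b\<close> of centres this leaf has
  seen so far; only 0 and 1 matter, since the count can only grow. Once \<open>y\<close> is merged
  into \<open>x\<close>, the leaf of \<open>y\<close> gets no further chance: it must then have
  exactly one centre, the one in \<open>x\<close> included, which explains the demand
  \<open>1 - a * mark x y l\<close> in \<open>messages\<close>. The eight messages are the values of
  three bits: the marks \<open>a\<close>, \<open>b\<close> of the two choices in \<open>x\<close>,
  and the contribution \<open>z\<close> to the leaf in \<open>x\<close>.

  Choosing no vertex is choosing a dummy, whose mark is 0. Compatibility across a tree edge thus
  becomes a set of equations between products of marks, without cases for absent vertices.

  Time is not tracked along runs. As every loop is charged the same linear number of rounds, the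
  degree of the bound is the nesting depth of loops: two in a merge, three in the dynamic program,
  four with the pruning loop around it. Likewise, all stored numbers obey one linear bound, and the
  size of the fixed program gives the exponent of the word bound.\<close>

text \<open>If all cells are at most \<open>B\<close>, the value of \<open>e\<close> is at most \<open>B ^ asz e\<close>; this makes the word bound a
  syntactic condition on programs.\<close>

fun asz :: "aexp \<Rightarrow> nat" where
  "asz (Const k) = Suc k"
| "asz (Reg x) = 1"
| "asz (Arr a e) = Suc (asz e)"
| "asz (Add e f) = asz e + asz f"
| "asz (Sub e f) = asz e + asz f"
| "asz (Mul e f) = asz e + asz f"
| "asz (Div e f) = asz e + asz f"

fun bsz :: "bexp \<Rightarrow> nat" where
  "bsz (Less e f) = asz e + asz f"
| "bsz (Equal e f) = asz e + asz f"
| "bsz (Neg b) = bsz b"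
| "bsz (Conj b c) = bsz b + bsz c"

text \<open>Summing over all subprograms makes one inequality \<open>B ^ csz c < W\<close> cover
  every expression in \<open>c\<close>. The sum is a constant of the program, so the word bound
  stays polynomial when \<open>B\<close> is linear in \<open>n\<close>.\<close>

fun csz :: "com \<Rightarrow> nat" where
  "csz Skip = 0"
| "csz (Assign x e) = asz e"
| "csz (Store a i e) = asz i + asz e"
| "csz (Seq c1 c2) = csz c1 + csz c2"
| "csz (Cond b c1 c2) = bsz b + csz c1 + csz c2"
| "csz (While b c) = bsz b + csz c"

text \<open>Every loop is charged \<open>P\<close> iterations.\<close>

fun tm :: "nat \<Rightarrow> com \<Rightarrow> nat" where
  "tm P Skip = 1"
| "tm P (Assign x e) = 1 + acost e"
| "tm P (Store a i e) = 1 + acost i + acost e"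
| "tm P (Seq c1 c2) = tm P c1 + tm P c2"
| "tm P (Cond b c1 c2) = 1 + bcost b + tm P c1 + tm P c2"
| "tm P (While b c) = (P + 1) * (1 + bcost b) + P * tm P c"

fun mr :: "com \<Rightarrow> string list" where
  "mr Skip = []"
| "mr (Assign x e) = [x]"
| "mr (Store a i e) = []"
| "mr (Seq c1 c2) = mr c1 @ mr c2"
| "mr (Cond b c1 c2) = mr c1 @ mr c2"
| "mr (While b c) = mr c"

fun ma :: "com \<Rightarrow> string list" where
  "ma Skip = []"
| "ma (Assign x e) = []"
| "ma (Store a i e) = [a]"
| "ma (Seq c1 c2) = ma c1 @ ma c2"
| "ma (Cond b c1 c2) = ma c1 @ ma c2"
| "ma (While b c) = ma c"

definition frame :: "com \<Rightarrow> state \<Rightarrow> state \<Rightarrow> bool" where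
  "frame c s s' \<longleftrightarrow> (\<forall>x. x \<notin> set (mr c) \<longrightarrow> regs s' x = regs s x) \<and>
     (\<forall>a. a \<notin> set (ma c) \<longrightarrow> arrs s' a = arrs s a)"

lemma frame_regs: "frame c s s' \<Longrightarrow> x \<notin> set (mr c) \<Longrightarrow> regs s' x = regs s x"
  by (simp add: frame_def)

lemma frame_arrs: "frame c s s' \<Longrightarrow> a \<notin> set (ma c) \<Longrightarrow> arrs s' a = arrs s a"
  by (simp add: frame_def)

lemma exec_frame: "exec W c s t s' \<Longrightarrow> frame c s s'"
  unfolding frame_def by (induction rule: exec.induct) auto

definition small :: "nat \<Rightarrow> state \<Rightarrow> bool" where
  "small B s \<longleftrightarrow> (\<forall>x. regs s x \<le> B) \<and> (\<forall>a i. arrs s a i \<le> B)"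

definition setr :: "string \<Rightarrow> nat \<Rightarrow> state \<Rightarrow> state" where
  "setr x v s = s\<lparr>regs := (regs s)(x := v)\<rparr>"

definition seta :: "string \<Rightarrow> nat \<Rightarrow> nat \<Rightarrow> state \<Rightarrow> state" where
  "seta a i v s = s\<lparr>arrs := (arrs s)(a := (arrs s a)(i := v))\<rparr>"

lemma set_simps [simp]:
  "regs (setr x v s) y = (if y = x then v else regs s y)"
  "arrs (setr x v s) = arrs s"
  "regs (seta a i v s) = regs s"
  "arrs (seta a i v s) b = (if b = a then (arrs s a)(i := v) else arrs s b)"
  by (auto simp: setr_def seta_def)

lemma asz_pos: "0 < asz e"
  by (induction e) auto

text \<open>Two numbers that are at least 2 have a sum of at most their product. This is why sizes
  of expressions can be added even for \<open>Add\<close>.\<close>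

lemma add_le_mult_power:
  fixes B :: nat
  assumes "2 \<le> B" "0 < a" "0 < b"
  shows "B ^ a + B ^ b \<le> B ^ (a + b)"
proof -
  have "2 \<le> B ^ a" "2 \<le> B ^ b"
    using assms self_le_power[of B a] self_le_power[of B b] by simp_all
  then obtain p q where "B ^ a = p + 2" "B ^ b = q + 2"
    by (metis le_add_diff_inverse2)
  then show ?thesis by (simp add: power_add algebra_simps)
qed

lemma aval_le:
  assumes "2 \<le> B" "small B s"
  shows "aval e s \<le> B ^ asz e"
proof (induction e)
  case (Const k)
  have "k < 2 ^ k" by simp
  also have "(2::nat) ^ k \<le> B ^ k" using assms by (intro power_mono) auto
  also have "\<dots> \<le> B ^ Suc k" using assms by (intro power_increasing) auto
  finally show ?case by simp
next
  case (Reg x)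
  then show ?case using assms by (simp add: small_def)
next
  case (Arr a e)
  have "arrs s a (aval e s) \<le> B" using assms by (simp add: small_def)
  also have "B \<le> B ^ asz (Arr a e)" using assms by (simp add: self_le_power)
  finally show ?case by simp
next
  case (Add e f)
  then have "aval e s + aval f s \<le> B ^ asz e + B ^ asz f" by (rule add_mono)
  also have "\<dots> \<le> B ^ (asz e + asz f)" using assms asz_pos by (intro add_le_mult_power)
  finally show ?case by simp
next
  case (Sub e f)
  have "aval e s - aval f s \<le> B ^ asz e" using Sub(1) by simp
  also have "\<dots> \<le> B ^ (asz e + asz f)" using assms by (intro power_increasing) auto
  finally show ?case by simp
next
  case (Mul e f)
  then show ?case by (simp add: power_add mult_mono)
next
  case (Div e f)
  have "aval e s div aval f s \<le> B ^ asz e" using Div(1) by (meson div_le_dividend le_trans)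
  also have "\<dots> \<le> B ^ (asz e + asz f)" using assms by (intro power_increasing) auto
  finally show ?case by simp
qed

lemma power_less_mono:
  fixes B :: nat
  assumes "B ^ b < W" "2 \<le> B" "a \<le> b"
  shows "B ^ a < W"
  by (rule le_less_trans[OF power_increasing assms(1)]) (use assms in auto)

lemma afits_if_small:
  assumes "2 \<le> B" "small B s" "B ^ asz e < W"
  shows "afits W e s"
  using assms(3)
proof (induction e)
  case (Const k) then show ?case using aval_le[OF assms(1,2), of "Const k"] by simp
next
  case (Reg x) then show ?case using aval_le[OF assms(1,2), of "Reg x"] by simp
next
  case (Arr a e) then show ?case
    using aval_le[OF assms(1,2), of "Arr a e"] power_less_mono[OF Arr(2) assms(1), of "asz e"] by simp
next
  case (Add e f) then show ?case
    using aval_le[OF assms(1,2), of "Add e f"] power_less_mono[OF Add(3) assms(1), of "asz e"]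
      power_less_mono[OF Add(3) assms(1), of "asz f"] by simp
next
  case (Sub e f) then show ?case
    using power_less_mono[OF Sub(3) assms(1), of "asz e"]
      power_less_mono[OF Sub(3) assms(1), of "asz f"] by simp
next
  case (Mul e f) then show ?case
    using aval_le[OF assms(1,2), of "Mul e f"] power_less_mono[OF Mul(3) assms(1), of "asz e"]
      power_less_mono[OF Mul(3) assms(1), of "asz f"] by simp
next
  case (Div e f) then show ?case
    using power_less_mono[OF Div(3) assms(1), of "asz e"]
      power_less_mono[OF Div(3) assms(1), of "asz f"] by simp
qed

lemma bfits_if_small:
  assumes "2 \<le> B" "small B s" "B ^ bsz b < W"
  shows "bfits W b s"
  using assms(3)
proof (induction b)
  case (Less e f) then show ?case
    using afits_if_small[OF assms(1,2)] power_less_mono[OF Less assms(1), of "asz e"]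
      power_less_mono[OF Less assms(1), of "asz f"] by simp
next
  case (Equal e f) then show ?case
    using afits_if_small[OF assms(1,2)] power_less_mono[OF Equal assms(1), of "asz e"]
      power_less_mono[OF Equal assms(1), of "asz f"] by simp
next
  case (Neg b) then show ?case by simp
next
  case (Conj b c) then show ?case
    using power_less_mono[OF Conj(3) assms(1), of "bsz b"]
      power_less_mono[OF Conj(3) assms(1), of "bsz c"] by simp
qed

definition For :: "string \<Rightarrow> aexp \<Rightarrow> com \<Rightarrow> com" where
  "For x e c = Seq (Assign x (Const 0))
     (While (Less (Reg x) e) (Seq c (Assign x (Add (Reg x) (Const 1)))))"

definition For2 :: "string \<Rightarrow> string \<Rightarrow> aexp \<Rightarrow> com \<Rightarrow> com" where
  "For2 x y e c = For x e (For y e c)"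

lemma mr_For [simp]: "set (mr (For x e c)) = insert x (set (mr c))"
  by (auto simp: For_def)

lemma ma_For [simp]: "set (ma (For x e c)) = set (ma c)"
  by (auto simp: For_def)

lemma mr_For2 [simp]: "set (mr (For2 x y e c)) = insert x (insert y (set (mr c)))"
  by (auto simp: For2_def)

lemma ma_For2 [simp]: "set (ma (For2 x y e c)) = set (ma c)"
  by (auto simp: For2_def)

section \<open>Total correctness with built-in bounds on values, time and modified cells\<close>

locale ram =
  fixes W P B :: nat
  assumes B_ge_2: "2 \<le> B"
begin

text \<open>The size conditions are premises inside the definition and smallness is returned with
  the result, so the rules below need not thread them through. The frame is part of the guarantee:
  it carries facts about unmodified cells past a subprogram.\<close>

definition wp :: "com \<Rightarrow> state \<Rightarrow> (state \<Rightarrow> bool) \<Rightarrow> bool" where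
  "wp c s Q \<longleftrightarrow> (small B s \<longrightarrow> B ^ csz c < W \<longrightarrow>
     (\<exists>t s'. exec W c s t s' \<and> t \<le> tm P c \<and> small B s' \<and> frame c s s' \<and> Q s'))"

lemma wpD:
  assumes "wp c s Q" "small B s" "B ^ csz c < W"
  obtains t s' where "exec W c s t s'" "t \<le> tm P c" "small B s'" "frame c s s'" "Q s'"
  using assms by (auto simp: wp_def)

lemma wp_halts_within:
  "wp c s Q \<Longrightarrow> small B s \<Longrightarrow> B ^ csz c < W \<Longrightarrow> halts_within W c s (tm P c) Q"
  by (auto simp: wp_def halts_within_def)

lemma wp_mono:
  assumes "wp c s Q" "\<And>s'. frame c s s' \<Longrightarrow> Q s' \<Longrightarrow> R s'"
  shows "wp c s R"
  using assms unfolding wp_def by blast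

lemma wp_Skip: "Q s \<Longrightarrow> wp Skip s Q"
  unfolding wp_def by (auto intro!: exI exec.Skip simp: frame_def)

text \<open>Besides \<open>wp_Store\<close>, this is the only source of size obligations for values:
  only the stored value must stay below \<open>B\<close>, while intermediate values are covered by
  \<open>csz\<close>.\<close>

lemma wp_Assign:
  assumes "aval e s \<le> B" "Q (setr x (aval e s) s)"
  shows "wp (Assign x e) s Q"
  unfolding wp_def
proof (intro impI)
  assume a: "small B s" "B ^ csz (Assign x e) < W"
  have "exec W (Assign x e) s (1 + acost e) (setr x (aval e s) s)"
    unfolding setr_def using a B_ge_2 by (intro exec.Assign afits_if_small) auto
  then show "\<exists>t s'. exec W (Assign x e) s t s' \<and> t \<le> tm P (Assign x e) \<and> small B s' \<and>
      frame (Assign x e) s s' \<and> Q s'"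
    using assms a by (intro exI conjI) (auto simp: small_def frame_def)
qed

lemma wp_Store:
  assumes "aval e s \<le> B" "Q (seta a (aval i s) (aval e s) s)"
  shows "wp (Store a i e) s Q"
  unfolding wp_def
proof (intro impI)
  assume a: "small B s" "B ^ csz (Store a i e) < W"
  have w: "B ^ asz i < W" "B ^ asz e < W"
    using a(2) by (auto intro: power_less_mono[OF _ B_ge_2])
  have "exec W (Store a i e) s (1 + acost i + acost e) (seta a (aval i s) (aval e s) s)"
    unfolding seta_def using a w B_ge_2 by (intro exec.Store afits_if_small) auto
  then show "\<exists>t s'. exec W (Store a i e) s t s' \<and> t \<le> tm P (Store a i e) \<and> small B s' \<and>
      frame (Store a i e) s s' \<and> Q s'"
    using assms a by (intro exI conjI) (auto simp: small_def frame_def seta_def)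
qed

lemma wp_Seq:
  assumes "wp c1 s (\<lambda>s1. wp c2 s1 Q)"
  shows "wp (Seq c1 c2) s Q"
  unfolding wp_def
proof (intro impI)
  assume a: "small B s" "B ^ csz (Seq c1 c2) < W"
  have w: "B ^ csz c1 < W" "B ^ csz c2 < W"
    using a(2) by (auto intro: power_less_mono[OF _ B_ge_2])
  from wpD[OF assms a(1) w(1)] obtain t1 s1 where
    1: "exec W c1 s t1 s1" "t1 \<le> tm P c1" "small B s1" "wp c2 s1 Q" by blast
  from wpD[OF 1(4,3) w(2)] obtain t2 s2 where
    2: "exec W c2 s1 t2 s2" "t2 \<le> tm P c2" "small B s2" "Q s2" by blast
  have e: "exec W (Seq c1 c2) s (t1 + t2) s2" using 1(1) 2(1) by (rule exec.Seq)
  show "\<exists>t s'. exec W (Seq c1 c2) s t s' \<and> t \<le> tm P (Seq c1 c2) \<and> small B s' \<and>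
      frame (Seq c1 c2) s s' \<and> Q s'"
    using e 1 2 exec_frame[OF e] by (intro exI conjI) auto
qed

lemma wp_Cond:
  assumes "bval b s \<Longrightarrow> wp c1 s Q" "\<not> bval b s \<Longrightarrow> wp c2 s Q"
  shows "wp (Cond b c1 c2) s Q"
  unfolding wp_def
proof (intro impI)
  assume a: "small B s" "B ^ csz (Cond b c1 c2) < W"
  have w: "B ^ csz c1 < W" "B ^ csz c2 < W" "B ^ bsz b < W"
    using a(2) by (auto intro: power_less_mono[OF _ B_ge_2])
  have bf: "bfits W b s" using B_ge_2 a(1) w(3) by (rule bfits_if_small)
  have "\<exists>t s'. exec W (Cond b c1 c2) s t s' \<and> t \<le> tm P (Cond b c1 c2) \<and> small B s' \<and> Q s'"
  proof (cases "bval b s")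
    case True
    from wpD[OF assms(1)[OF True] a(1) w(1)] obtain t1 s1 where
      1: "exec W c1 s t1 s1" "t1 \<le> tm P c1" "small B s1" "Q s1" by blast
    show ?thesis using exec.CondTrue[OF bf True 1(1), of c2] 1
      by (intro exI conjI) auto
  next
    case False
    from wpD[OF assms(2)[OF False] a(1) w(2)] obtain t1 s1 where
      1: "exec W c2 s t1 s1" "t1 \<le> tm P c2" "small B s1" "Q s1" by blast
    show ?thesis using exec.CondFalse[OF bf False 1(1), of c1] 1
      by (intro exI conjI) auto
  qed
  then show "\<exists>t s'. exec W (Cond b c1 c2) s t s' \<and> t \<le> tm P (Cond b c1 c2) \<and> small B s' \<and>
      frame (Cond b c1 c2) s s' \<and> Q s'"
    using exec_frame by blast
qed

text \<open>The invariant cannot see the counter (\<open>Ix\<close>) and the body cannot change it,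
  so initialisation and increment preserve the invariant. \<open>m \<le> P\<close> pays for the
  rounds and \<open>m \<le> B\<close> keeps the counter small. The bound expression is evaluated
  before every round, hence \<open>e\<close> asks for the same value in all states the loop can
  reach.\<close>

lemma wp_For:
  assumes m: "m \<le> P" "m \<le> B"
    and x: "x \<notin> set (mr c)"
    and Ix: "\<And>i v s'. I i (setr x v s') = I i s'"
    and e: "\<And>s'. frame (For x e c) s s' \<Longrightarrow> aval e s' = m"
    and init: "I 0 s"
    and step: "\<And>i s'. i < m \<Longrightarrow> regs s' x = i \<Longrightarrow> frame (For x e c) s s' \<Longrightarrow> I i s' \<Longrightarrow>
      wp c s' (I (Suc i))"
    and fin: "\<And>s'. I m s' \<Longrightarrow> frame (For x e c) s s' \<Longrightarrow> Q s'"
  shows "wp (For x e c) s Q"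
  unfolding wp_def
proof (intro impI)
  assume small: "small B s" and W: "B ^ csz (For x e c) < W"
  let ?inc = "Assign x (Add (Reg x) (Const 1))"
  let ?b = "Less (Reg x) e"
  let ?body = "Seq c ?inc"
  have w: "B ^ csz ?body < W" "B ^ bsz ?b < W" "B ^ csz (Assign x (Const 0)) < W"
    by (rule power_less_mono[OF W B_ge_2], simp add: For_def)+
  \<comment> \<open>From counter value \<open>i\<close> there remain \<open>m - i\<close> rounds and
    one test more, because the failing test is also paid for.\<close>
  have loop: "\<exists>t s''. exec W (While ?b ?body) s' t s'' \<and>
      t \<le> (m - i + 1) * (1 + bcost ?b) + (m - i) * tm P ?body \<and> small B s'' \<and> I m s'' \<and>
      frame (For x e c) s s''"
    if "i \<le> m" "regs s' x = i" "I i s'" "small B s'" "frame (For x e c) s s'" for i s'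
    using that
  proof (induction "m - i" arbitrary: i s')
    case 0
    then have "i = m" by simp
    have "bfits W ?b s'" using B_ge_2 0 w(2) by (intro bfits_if_small)
    moreover have "\<not> bval ?b s'" using 0 \<open>i = m\<close> e[of s'] by simp
    ultimately have "exec W (While ?b ?body) s' (1 + bcost ?b) s'" by (rule exec.WhileFalse)
    then show ?case using 0 \<open>i = m\<close> by (intro exI conjI) auto
  next
    case (Suc d)
    then have "i < m" by simp
    have f: "bfits W ?b s'" using B_ge_2 Suc.prems w(2) by (intro bfits_if_small)
    have b: "bval ?b s'" using Suc.prems \<open>i < m\<close> e[of s'] by simp
    have "wp ?body s' (\<lambda>s1. regs s1 x = Suc i \<and> I (Suc i) s1)"
    proof (rule wp_Seq, rule wp_mono[OF step])
      fix s1 assume "frame c s' s1" "I (Suc i) s1"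
      moreover from this x have "regs s1 x = i" using Suc.prems by (simp add: frame_def)
      ultimately show "wp ?inc s1 (\<lambda>s1. regs s1 x = Suc i \<and> I (Suc i) s1)"
        using \<open>i < m\<close> m by (intro wp_Assign) (simp_all add: Ix)
    qed (use Suc.prems \<open>i < m\<close> in auto)
    from wpD[OF this \<open>small B s'\<close> w(1)] obtain t1 s1 where
      1: "exec W ?body s' t1 s1" "t1 \<le> tm P ?body" "small B s1" "regs s1 x = Suc i" "I (Suc i) s1"
      "frame ?body s' s1" by blast
    have fr: "frame (For x e c) s s1" using Suc.prems(5) 1(6) by (auto simp: frame_def For_def)
    have "d = m - Suc i" "Suc i \<le> m" using Suc.hyps(2) \<open>i < m\<close> by simp_all
    from Suc.hyps(1)[OF this 1(4,5,3) fr] obtain t2 s2 where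
      2: "exec W (While ?b ?body) s1 t2 s2"
      "t2 \<le> (m - Suc i + 1) * (1 + bcost ?b) + (m - Suc i) * tm P ?body"
      "small B s2" "I m s2" "frame (For x e c) s s2" by blast
    have "exec W (While ?b ?body) s' (1 + bcost ?b + t1 + t2) s2"
      using f b 1(1) 2(1) by (rule exec.WhileTrue)
    moreover have "1 + bcost ?b + t1 + t2 \<le> (m - i + 1) * (1 + bcost ?b) + (m - i) * tm P ?body"
    proof -
      obtain r where r: "m - i = Suc r" "m - Suc i = r" using \<open>i < m\<close>
        by (metis Suc_diff_Suc)
      show ?thesis using 1(2) 2(2) unfolding r by (simp add: algebra_simps)
    qed
    ultimately show ?case using 2 by blast
  qed
  have a: "exec W (Assign x (Const 0)) s 2 (setr x 0 s)"
    using exec.Assign[OF afits_if_small[OF B_ge_2 small], of "Const 0" W x] w(3)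
    by (simp add: setr_def numeral_2_eq_2)
  have "\<exists>t s''. exec W (While ?b ?body) (setr x 0 s) t s'' \<and>
      t \<le> (m - 0 + 1) * (1 + bcost ?b) + (m - 0) * tm P ?body \<and> small B s'' \<and> I m s'' \<and>
      frame (For x e c) s s''"
    by (rule loop) (use init small in \<open>auto simp: Ix small_def frame_def\<close>)
  then obtain t s' where t: "exec W (While ?b ?body) (setr x 0 s) t s'"
    "t \<le> (m + 1) * (1 + bcost ?b) + m * tm P ?body" "small B s'" "I m s'" "frame (For x e c) s s'"
    by auto
  have "t \<le> (P + 1) * (1 + bcost ?b) + P * tm P ?body"
    using m(1) by (intro le_trans[OF t(2)] add_mono mult_mono) auto
  then have "2 + t \<le> tm P (For x e c)" by (simp add: For_def)
  moreover have "exec W (For x e c) s (2 + t) s'"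
    unfolding For_def using a t(1) by (rule exec.Seq)
  ultimately show "\<exists>t s'. exec W (For x e c) s t s' \<and> t \<le> tm P (For x e c) \<and> small B s' \<and>
      frame (For x e c) s s' \<and> Q s'"
    using t fin by blast
qed

text \<open>The invariant speaks about the set of pairs of loop indices that have been dealt with.\<close>

lemma wp_For2:
  assumes m: "m \<le> P" "m \<le> B"
    and x: "x \<notin> set (mr c)" "y \<notin> set (mr c)" "x \<noteq> y"
    and Ix: "\<And>S v s'. I S (setr x v s') = I S s'" "\<And>S v s'. I S (setr y v s') = I S s'"
    and e: "\<And>s'. frame (For2 x y e c) s s' \<Longrightarrow> aval e s' = m"
    and init: "I {} s"
    and step: "\<And>i j S s'. i < m \<Longrightarrow> j < m \<Longrightarrow> (i, j) \<notin> S \<Longrightarrow> finite S \<Longrightarrow> S \<subseteq> {..<m} \<times> {..<m} \<Longrightarrow>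
      regs s' x = i \<Longrightarrow> regs s' y = j \<Longrightarrow>
      frame (For2 x y e c) s s' \<Longrightarrow> I S s' \<Longrightarrow> wp c s' (I (insert (i, j) S))"
    and fin: "\<And>s'. I ({..<m} \<times> {..<m}) s' \<Longrightarrow> frame (For2 x y e c) s s' \<Longrightarrow> Q s'"
  shows "wp (For2 x y e c) s Q"
  unfolding For2_def
proof (rule wp_For[where m = m and I = "\<lambda>i. I ({..<i} \<times> {..<m})"])
  show "x \<notin> set (mr (For y e c))" using x by simp
next
  fix i s' assume i: "i < m" "regs s' x = i" "frame (For x e (For y e c)) s s'"
    "I ({..<i} \<times> {..<m}) s'"
  show "wp (For y e c) s' (I ({..<Suc i} \<times> {..<m}))"
  proof (rule wp_For[where m = m and I = "\<lambda>j. I ({..<i} \<times> {..<m} \<union> {i} \<times> {..<j})"])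
    fix s'' assume "frame (For y e c) s' s''"
    then show "aval e s'' = m" using i(3) by (intro e) (auto simp: frame_def For2_def)
  next
    fix j s'' assume j: "j < m" "regs s'' y = j" "frame (For y e c) s' s''"
      "I ({..<i} \<times> {..<m} \<union> {i} \<times> {..<j}) s''"
    have eq: "insert (i, j) ({..<i} \<times> {..<m} \<union> {i} \<times> {..<j}) = {..<i} \<times> {..<m} \<union> {i} \<times> {..<Suc j}"
      by auto
    show "wp c s'' (I ({..<i} \<times> {..<m} \<union> {i} \<times> {..<Suc j}))"
      unfolding eq[symmetric]
      using i j x by (intro step) (auto simp: frame_def For2_def)
  next
    fix s'' assume "I ({..<i} \<times> {..<m} \<union> {i} \<times> {..<m}) s''"
    moreover have "{..<i} \<times> {..<m} \<union> {i} \<times> {..<m} = {..<Suc i} \<times> {..<m}" by auto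
    ultimately show "I ({..<Suc i} \<times> {..<m}) s''" by simp
  qed (use m x Ix i in simp_all)
qed (use m x Ix init e fin in \<open>simp_all add: For2_def\<close>)

end

section \<open>Polynomial degree of the syntactic time bound\<close>

definition poly_time :: "nat \<Rightarrow> com \<Rightarrow> bool" where
  "poly_time d c \<longleftrightarrow> (\<exists>K. \<forall>P. tm P c \<le> K * (P + 1) ^ d)"

lemma poly_timeI: "(\<And>P. tm P c \<le> K * (P + 1) ^ d) \<Longrightarrow> poly_time d c"
  by (auto simp: poly_time_def)

lemma poly_time_const:
  assumes "\<And>P. tm P c = t"
  shows "poly_time d c"
  by (rule poly_timeI[of _ t]) (simp add: assms)

lemma poly_time_Seq:
  assumes "poly_time d c1" "poly_time d c2"
  shows "poly_time d (Seq c1 c2)"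
proof -
  obtain K1 K2 where "\<And>P. tm P c1 \<le> K1 * (P + 1) ^ d" "\<And>P. tm P c2 \<le> K2 * (P + 1) ^ d"
    using assms by (auto simp: poly_time_def)
  then have "tm P (Seq c1 c2) \<le> (K1 + K2) * (P + 1) ^ d" for P
    unfolding tm.simps distrib_right by (rule add_mono)
  then show ?thesis by (rule poly_timeI)
qed

lemma poly_time_Cond:
  assumes "poly_time d c1" "poly_time d c2"
  shows "poly_time d (Cond b c1 c2)"
proof -
  obtain K1 K2 where K: "\<And>P. tm P c1 \<le> K1 * (P + 1) ^ d" "\<And>P. tm P c2 \<le> K2 * (P + 1) ^ d"
    using assms by (auto simp: poly_time_def)
  have "tm P (Cond b c1 c2) \<le> ((1 + bcost b) + K1 + K2) * (P + 1) ^ d" for P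
    unfolding tm.simps distrib_right by (intro add_mono K) simp_all
  then show ?thesis by (rule poly_timeI)
qed

lemma poly_time_While:
  assumes "poly_time d c"
  shows "poly_time (Suc d) (While b c)"
proof -
  obtain K where K: "\<And>P. tm P c \<le> K * (P + 1) ^ d"
    using assms by (auto simp: poly_time_def)
  have "tm P (While b c) \<le> ((1 + bcost b) + K) * (P + 1) ^ Suc d" for P
  proof -
    have "P + 1 \<le> (P + 1) ^ Suc d" by (rule self_le_power) simp_all
    then have "(P + 1) * (1 + bcost b) \<le> (P + 1) ^ Suc d * (1 + bcost b)" by (rule mult_right_mono) simp
    moreover have "P * tm P c \<le> (P + 1) * (K * (P + 1) ^ d)" by (intro mult_mono K) simp_all
    ultimately show ?thesis by (simp add: algebra_simps)
  qed
  then show ?thesis by (rule poly_timeI)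
qed

text \<open>Basic commands have every degree, since \<open>(P + 1) ^ d\<close> is at least 1. Pieces
  of different loop depth can thus be given the same degree by unification alone.\<close>

lemma poly_time_basic: "poly_time d Skip" "poly_time d (Assign x e)" "poly_time d (Store a i e)"
  by (rule poly_time_const, simp)+

lemma poly_time_For: "poly_time d c \<Longrightarrow> poly_time (Suc d) (For x e c)"
  unfolding For_def by (intro poly_time_Seq poly_time_While poly_time_basic)

lemma poly_time_For2: "poly_time d c \<Longrightarrow> poly_time (Suc (Suc d)) (For2 x y e c)"
  unfolding For2_def by (intro poly_time_For)

lemmas poly_time_intros = poly_time_basic poly_time_Seq poly_time_Cond poly_time_For2 poly_time_For

lemma poly_time_bigo:
  assumes "poly_time d c"
  shows "(\<lambda>n. real (tm (a * n + b) c)) \<in> O(\<lambda>n. real n ^ d)"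
proof -
  obtain K where K: "\<And>P. tm P c \<le> K * (P + 1) ^ d" using assms by (auto simp: poly_time_def)
  show ?thesis
  proof (rule bigoI[of _ "real (K * (a + b + 1) ^ d)"])
    show "\<forall>\<^sub>F n in sequentially. norm (real (tm (a * n + b) c)) \<le> real (K * (a + b + 1) ^ d) * norm (real n ^ d)"
      using eventually_ge_at_top[of 1]
    proof eventually_elim
      case (elim n)
      \<comment> \<open>For \<open>n \<ge> 1\<close> the additive constants are absorbed into the
        factor of \<open>n\<close>.\<close>
      have "a * n + b + 1 \<le> (a + b + 1) * n" using elim by (cases n) (simp_all add: algebra_simps)
      then have "K * (a * n + b + 1) ^ d \<le> K * ((a + b + 1) * n) ^ d"
        by (intro mult_left_mono power_mono) simp_all
      also have "\<dots> = K * (a + b + 1) ^ d * n ^ d"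
        by (simp only: power_mult_distrib mult.assoc)
      finally have "tm (a * n + b) c \<le> K * (a + b + 1) ^ d * n ^ d"
        by (rule order_trans[OF K])
      then have "real (tm (a * n + b) c) \<le> real (K * (a + b + 1) ^ d * n ^ d)" by (rule of_nat_mono)
      then show ?case by simp
    qed
  qed
qed

section \<open>Edge open packings as star systems\<close>

definition star_system :: "'a set set \<Rightarrow> 'a set \<Rightarrow> 'a set \<Rightarrow> bool" where
  "star_system E C L \<longleftrightarrow> C \<inter> L = {} \<and> (\<forall>u\<in>C. \<forall>v\<in>C. {u, v} \<notin> E) \<and>
     (\<forall>u\<in>L. \<forall>v\<in>L. {u, v} \<notin> E) \<and> (\<forall>v\<in>L. card {u \<in> C. {u, v} \<in> E} = 1)"

definition star_edges :: "'a set set \<Rightarrow> 'a set \<Rightarrow> 'a set \<Rightarrow> 'a set set" where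
  "star_edges E C L = {{u, v} | u v. u \<in> C \<and> v \<in> L \<and> {u, v} \<in> E}"

lemma simple_graph_edgeD:
  assumes "simple_graph V E" "{u, v} \<in> E"
  shows "u \<noteq> v" "u \<in> V" "v \<in> V"
  using assms unfolding simple_graph_def by (auto simp: card_insert_if)

lemma simple_graph_finite:
  assumes "simple_graph V E"
  shows "finite V" "finite E"
proof -
  show "finite V" using assms by (simp add: simple_graph_def)
  moreover have "E \<subseteq> Pow V" using assms by (auto simp: simple_graph_def)
  ultimately show "finite E" by (meson finite_Pow_iff finite_subset)
qed

lemma simple_graph_edgeE:
  assumes "simple_graph V E" "e \<in> E" "u \<in> e"
  obtains v where "e = {u, v}" "u \<noteq> v"
proof -
  have "card e = 2" using assms by (auto simp: simple_graph_def)
  then obtain a b where "e = {a, b}" "a \<noteq> b" by (auto simp: card_2_iff)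
  with assms(3) that show ?thesis by (metis doubleton_eq_iff insert_iff singletonD)
qed

lemma star_system_unique_centre:
  assumes "star_system E C L" "v \<in> L"
  obtains c where "c \<in> C" "{c, v} \<in> E" "\<And>u. u \<in> C \<Longrightarrow> {u, v} \<in> E \<Longrightarrow> u = c"
proof -
  have "card {u \<in> C. {u, v} \<in> E} = 1" using assms by (auto simp: star_system_def)
  then obtain c where "{u \<in> C. {u, v} \<in> E} = {c}" by (meson card_1_singletonE)
  then have "c \<in> C" "{c, v} \<in> E" "\<And>u. u \<in> C \<Longrightarrow> {u, v} \<in> E \<Longrightarrow> u = c" by blast+
  then show ?thesis by (rule that)
qed

text \<open>An edge between two star edges cannot join two centres or two leaves by independence. If
  it joins the centre of one to the leaf of the other, uniqueness of the centre makes it the second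
  star edge itself.\<close>

lemma star_edges_packing:
  assumes "simple_graph V E" "star_system E C L"
  shows "edge_open_packing E (star_edges E C L)"
  unfolding edge_open_packing_def
proof (intro conjI ballI impI)
  show "star_edges E C L \<subseteq> E" by (auto simp: star_edges_def)
next
  fix e1 e2 assume "e1 \<in> star_edges E C L" "e2 \<in> star_edges E C L" "e1 \<noteq> e2"
  then obtain c1 l1 c2 l2 where
    e: "e1 = {c1, l1}" "c1 \<in> C" "l1 \<in> L" "{c1, l1} \<in> E"
       "e2 = {c2, l2}" "c2 \<in> C" "l2 \<in> L" "{c2, l2} \<in> E"
    by (auto simp: star_edges_def)
  have C: "\<And>u v. u \<in> C \<Longrightarrow> v \<in> C \<Longrightarrow> {u, v} \<notin> E" and L: "\<And>u v. u \<in> L \<Longrightarrow> v \<in> L \<Longrightarrow> {u, v} \<notin> E"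
    using assms(2) by (auto simp: star_system_def)
  have 1: "u = c1" if "u \<in> C" "{u, l1} \<in> E" for u
    using star_system_unique_centre[OF assms(2) e(3)] e that by metis
  have 2: "u = c2" if "u \<in> C" "{u, l2} \<in> E" for u
    using star_system_unique_centre[OF assms(2) e(7)] e that by metis
  show "\<not> have_common_edge E e1 e2"
  proof
    assume "have_common_edge E e1 e2"
    then obtain u v where uv: "{u, v} \<in> E" "{u, v} \<noteq> e1" "{u, v} \<noteq> e2" "u \<in> e1" "v \<in> e2"
      by (auto simp: have_common_edge_def)
    then consider "u = c1" "v = c2" | "u = l1" "v = l2" | "u = c1" "v = l2" | "u = l1" "v = c2"
      using e by auto
    then show False
    proof cases
      case 1 then show False using uv C e by auto
    next
      case 2 then show False using uv L e by auto
    next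
      case 3 then show False using uv 2[of c1] e by auto
    next
      case 4 then show False using uv 1[of c2] e by (auto simp: insert_commute)
    qed
  qed
qed

text \<open>A leaf determines its edge through its unique centre, and an edge contains only one leaf
  because \<open>C\<close> and \<open>L\<close> are disjoint.\<close>

lemma card_star_edges:
  assumes "star_system E C L"
  shows "card (star_edges E C L) = card L"
proof -
  have "\<forall>v\<in>L. \<exists>c. c \<in> C \<and> {c, v} \<in> E \<and> (\<forall>u\<in>C. {u, v} \<in> E \<longrightarrow> u = c)"
    using star_system_unique_centre[OF assms] by metis
  then obtain f where f: "\<And>v. v \<in> L \<Longrightarrow> f v \<in> C" "\<And>v. v \<in> L \<Longrightarrow> {f v, v} \<in> E"
    "\<And>v u. v \<in> L \<Longrightarrow> u \<in> C \<Longrightarrow> {u, v} \<in> E \<Longrightarrow> u = f v" by metis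
  have CL: "C \<inter> L = {}" using assms by (simp add: star_system_def)
  have "star_edges E C L = (\<lambda>v. {f v, v}) ` L"
  proof (intro equalityI subsetI)
    fix e assume "e \<in> star_edges E C L"
    then obtain u v where "e = {u, v}" "u \<in> C" "v \<in> L" "{u, v} \<in> E" by (auto simp: star_edges_def)
    then show "e \<in> (\<lambda>v. {f v, v}) ` L" using f(3)[of v u] by auto
  next
    fix e assume "e \<in> (\<lambda>v. {f v, v}) ` L"
    then show "e \<in> star_edges E C L" using f(1,2) by (auto simp: star_edges_def)
  qed
  moreover have "inj_on (\<lambda>v. {f v, v}) L"
    using f(1) CL by (intro inj_onI) (metis disjoint_iff doubleton_eq_iff)
  ultimately show ?thesis by (simp add: card_image)
qed

text \<open>In a packing no path has three edges, so every edge has an end that lies on no other edge of the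
  packing; this end becomes a leaf.\<close>

lemma packing_imp_star_system:
  assumes "simple_graph V E" "edge_open_packing E D"
  obtains C L where "C \<subseteq> V" "L \<subseteq> V" "star_system E C L" "card L = card D"
proof -
  have DE: "D \<subseteq> E" and nc: "\<And>e1 e2. e1 \<in> D \<Longrightarrow> e2 \<in> D \<Longrightarrow> e1 \<noteq> e2 \<Longrightarrow> \<not> have_common_edge E e1 e2"
    using assms(2) by (auto simp: edge_open_packing_def)
  have ce: False if "e1 \<in> D" "e2 \<in> D" "e1 \<noteq> e2" "{u, v} \<in> E" "{u, v} \<noteq> e1" "{u, v} \<noteq> e2"
    "u \<in> e1" "v \<in> e2" for e1 e2 u v
    using nc[OF that(1-3)] that(4-) unfolding have_common_edge_def by blast
  have "\<exists>l c. e = {l, c} \<and> l \<noteq> c \<and> (\<forall>e'\<in>D. l \<in> e' \<longrightarrow> e' = e)" if "e \<in> D" for e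
  proof -
    obtain u v where uv: "e = {u, v}" "u \<noteq> v"
      using assms(1) DE \<open>e \<in> D\<close> unfolding simple_graph_def by (metis card_2_iff subsetD)
    \<comment> \<open>Otherwise \<open>e\<close> would be a common edge of two further edges of the
      packing, one at each end; these are distinct, since an edge through both ends is
      \<open>e\<close> itself.\<close>
    have "(\<forall>e'\<in>D. u \<in> e' \<longrightarrow> e' = e) \<or> (\<forall>e'\<in>D. v \<in> e' \<longrightarrow> e' = e)"
    proof (rule ccontr)
      assume "\<not> ?thesis"
      then obtain e1 e2 where e12: "e1 \<in> D" "u \<in> e1" "e1 \<noteq> e" "e2 \<in> D" "v \<in> e2" "e2 \<noteq> e" by blast
      have "e1 \<noteq> e2"
      proof
        assume "e1 = e2"
        moreover obtain w where "e1 = {u, w}"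
          using simple_graph_edgeE[OF assms(1), of e1 u] e12 DE by blast
        ultimately show False using e12 uv by auto
      qed
      then show False using ce[of e1 e2 u v] e12 uv \<open>e \<in> D\<close> DE by auto
    qed
    then show ?thesis using uv by (metis doubleton_eq_iff)
  qed
  then obtain l c where lc: "\<And>e. e \<in> D \<Longrightarrow> e = {l e, c e}" "\<And>e. e \<in> D \<Longrightarrow> l e \<noteq> c e"
    "\<And>e e'. e \<in> D \<Longrightarrow> e' \<in> D \<Longrightarrow> l e \<in> e' \<Longrightarrow> e' = e" by metis
  have mem: "l e \<in> e" "c e \<in> e" if "e \<in> D" for e using lc(1)[OF that] by auto
  have edge: "{l e, c e} \<in> E" if "e \<in> D" for e using lc(1)[OF that] that DE by auto
  have "star_system E (c ` D) (l ` D)"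
    unfolding star_system_def
  proof (intro conjI ballI)
    \<comment> \<open>If \<open>c e = l e'\<close>, then \<open>l e'\<close> lies on
      \<open>e\<close>, which forces \<open>e = e'\<close> and makes the two ends of
      \<open>e\<close> coincide.\<close>
    show dis: "c ` D \<inter> l ` D = {}"
    proof (rule ccontr)
      assume "c ` D \<inter> l ` D \<noteq> {}"
      then obtain e e' where "e \<in> D" "e' \<in> D" "c e = l e'" by auto
      then show False using lc(2,3) mem by metis
    qed
    show "{u, v} \<notin> E" if "u \<in> c ` D" "v \<in> c ` D" for u v
    proof
      assume uv: "{u, v} \<in> E"
      obtain e e' where e: "e \<in> D" "e' \<in> D" "u = c e" "v = c e'" using \<open>u \<in> c ` D\<close> \<open>v \<in> c ` D\<close> by auto
      have "u \<noteq> v" using uv simple_graph_edgeD[OF assms(1)] by blast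
      then have "e \<noteq> e'" using e by auto
      moreover have "{u, v} \<noteq> e" using e lc(1)[of e] dis \<open>u \<noteq> v\<close>
        by (metis doubleton_eq_iff IntI emptyE imageI)
      moreover have "{u, v} \<noteq> e'" using e lc(1)[of e'] dis \<open>u \<noteq> v\<close>
        by (metis doubleton_eq_iff IntI emptyE imageI)
      ultimately show False using ce[of e e' u v] e uv mem by auto
    qed
    show "{u, v} \<notin> E" if "u \<in> l ` D" "v \<in> l ` D" for u v
    proof
      assume uv: "{u, v} \<in> E"
      obtain e e' where e: "e \<in> D" "e' \<in> D" "u = l e" "v = l e'" using \<open>u \<in> l ` D\<close> \<open>v \<in> l ` D\<close> by auto
      have "u \<noteq> v" using uv simple_graph_edgeD[OF assms(1)] by blast
      then have "e \<noteq> e'" using e by auto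
      moreover have "{u, v} \<noteq> e" using e lc(1)[of e] dis \<open>u \<noteq> v\<close>
        by (metis doubleton_eq_iff IntI emptyE imageI)
      moreover have "{u, v} \<noteq> e'" using e lc(1)[of e'] dis \<open>u \<noteq> v\<close>
        by (metis doubleton_eq_iff IntI emptyE imageI)
      ultimately show False using ce[of e e' u v] e uv mem by auto
    qed
    show "card {u \<in> c ` D. {u, v} \<in> E} = 1" if "v \<in> l ` D" for v
    proof -
      obtain e where e: "e \<in> D" "v = l e" using \<open>v \<in> l ` D\<close> by auto
      \<comment> \<open>A second centre \<open>c e'\<close> adjacent to \<open>v\<close> would make
        \<open>{c e', v}\<close> a common edge of \<open>e'\<close> and \<open>e\<close>.\<close>
      have "u = c e" if u: "u \<in> c ` D" "{u, v} \<in> E" for u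
      proof (rule ccontr)
        assume "u \<noteq> c e"
        obtain e' where e': "e' \<in> D" "u = c e'" using u by auto
        have "e' \<noteq> e" using \<open>u \<noteq> c e\<close> e' by auto
        moreover have "{u, v} \<noteq> e" using e lc(1)[of e] \<open>u \<noteq> c e\<close> lc(2)[of e]
          by (metis doubleton_eq_iff)
        moreover have "{u, v} \<noteq> e'" using \<open>e' \<noteq> e\<close> e e' lc(3)[of e e'] by auto
        ultimately show False using ce[of e' e u v] e e' u mem by auto
      qed
      then have "{u \<in> c ` D. {u, v} \<in> E} = {c e}"
        using e edge[of e] by (auto simp: insert_commute)
      then show ?thesis by simp
    qed
  qed
  moreover have "inj_on l D" using lc(3) mem by (intro inj_onI) metis
  then have "card (l ` D) = card D" by (rule card_image)
  moreover have "e \<subseteq> V" if "e \<in> D" for e using that DE assms(1) by (auto simp: simple_graph_def)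
  then have "c ` D \<subseteq> V" "l ` D \<subseteq> V" using mem by blast+
  ultimately show ?thesis using that by blast
qed

lemma finite_packings:
  assumes "simple_graph V E"
  shows "finite {D. edge_open_packing E D}"
  by (rule finite_subset[of _ "Pow E"])
    (use simple_graph_finite[OF assms] in \<open>auto simp: edge_open_packing_def\<close>)

lemma eop_number_eqI:
  assumes "simple_graph V E"
    and "\<And>C L. C \<subseteq> V \<Longrightarrow> L \<subseteq> V \<Longrightarrow> star_system E C L \<Longrightarrow> card L \<le> m"
    and "star_system E C0 L0" "card L0 = m"
  shows "eop_number E = m"
  unfolding eop_number_def
proof (rule Max_eqI)
  show "finite (card ` {D. edge_open_packing E D})" using finite_packings[OF assms(1)] by simp
  show "y \<le> m" if "y \<in> card ` {D. edge_open_packing E D}" for y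
    using that packing_imp_star_system[OF assms(1)] assms(2) by (metis imageE mem_Collect_eq)
  show "m \<in> card ` {D. edge_open_packing E D}"
    using star_edges_packing[OF assms(1,3)] card_star_edges[OF assms(3)] assms(4)
    by (intro image_eqI[of _ _ "star_edges E C0 L0"]) auto
qed

text \<open>In a longest path inside \<open>R\<close>, every neighbour in \<open>R\<close> of the
  first vertex lies on the path, and two such neighbours would close a cycle. \<open>R\<close> need
  not be connected, which is what deleting merged bags one by one calls for; an isolated element
  also counts as a leaf.\<close>

lemma acyclic_has_leaf:
  assumes P: "simple_graph P T" "\<nexists>xs. is_cycle T xs" and R: "R \<subseteq> P" "R \<noteq> {}"
  shows "\<exists>y\<in>R. \<forall>z1\<in>R. \<forall>z2\<in>R. {y, z1} \<in> T \<longrightarrow> {y, z2} \<in> T \<longrightarrow> z1 = z2"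
proof (rule ccontr)
  assume "\<not> ?thesis"
  then have two: "\<exists>z1\<in>R. \<exists>z2\<in>R. {y, z1} \<in> T \<and> {y, z2} \<in> T \<and> z1 \<noteq> z2" if "y \<in> R" for y
    using that by blast
  define path where "path xs \<longleftrightarrow> xs \<noteq> [] \<and> distinct xs \<and> set xs \<subseteq> R \<and>
    (\<forall>i. Suc i < length xs \<longrightarrow> {xs ! i, xs ! Suc i} \<in> T)" for xs
  have finR: "finite R" using P(1) R(1) by (auto simp: simple_graph_def intro: finite_subset)
  obtain r where "r \<in> R" using R by auto
  then have "path [r]" by (simp add: path_def)
  moreover have "length xs < Suc (card R)" if "path xs" for xs
    using that finR by (metis card_mono distinct_card le_imp_less_Suc path_def)
  ultimately obtain xs where xs: "path xs" and max: "\<And>ys. path ys \<Longrightarrow> length ys \<le> length xs"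
    using ex_has_greatest_nat[of path "[r]" length "Suc (card R)"] by auto
  have ne: "xs \<noteq> []" and dist: "distinct xs" and sub: "set xs \<subseteq> R"
    and edges: "\<And>i. Suc i < length xs \<Longrightarrow> {xs ! i, xs ! Suc i} \<in> T"
    using xs by (auto simp: path_def)
  have "xs ! 0 \<in> R" using ne sub by auto
  from two[OF this] obtain z1 z2 where z: "z1 \<in> R" "z2 \<in> R" "{xs ! 0, z1} \<in> T" "{xs ! 0, z2} \<in> T" "z1 \<noteq> z2"
    by blast
  have pos: "\<exists>i<length xs. 0 < i \<and> z = xs ! i" if "z \<in> R" "{xs ! 0, z} \<in> T" for z
  proof -
    have "z \<in> set xs"
    proof (rule ccontr)
      assume "z \<notin> set xs"
      then have "path (z # xs)"
        using that ne dist sub edges unfolding path_def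
        by (auto simp: nth_Cons insert_commute split: nat.split)
      then show False using max[of "z # xs"] by simp
    qed
    then obtain i where "i < length xs" "z = xs ! i" by (auto simp: in_set_conv_nth)
    moreover have "z \<noteq> xs ! 0" using simple_graph_edgeD(1)[OF P(1) that(2)] by simp
    ultimately show ?thesis by (metis gr0I)
  qed
  obtain i1 i2 where i: "i1 < length xs" "0 < i1" "z1 = xs ! i1" "i2 < length xs" "0 < i2" "z2 = xs ! i2"
    using pos[OF z(1,3)] pos[OF z(2,4)] by blast
  then have "i1 \<noteq> i2" using z by auto
  \<comment> \<open>The larger of two distinct positive positions is at least 2, so the closed walk
    has at least three vertices.\<close>
  then have "\<exists>j. 2 \<le> j \<and> j < length xs \<and> {xs ! 0, xs ! j} \<in> T"
    using i z by (intro exI[of _ "max i1 i2"]) (auto simp: max_def)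
  then obtain j where j: "2 \<le> j" "j < length xs" "{xs ! 0, xs ! j} \<in> T" by blast
  have "is_cycle T (take (Suc j) xs)"
    unfolding is_cycle_def
  proof (intro conjI allI impI)
    show "3 \<le> length (take (Suc j) xs)" using j by simp
    show "distinct (take (Suc j) xs)" using dist by simp
    fix i assume "i < length (take (Suc j) xs)"
    then have "i \<le> j" using j by simp
    then show "{take (Suc j) xs ! i, take (Suc j) xs ! (Suc i mod length (take (Suc j) xs))} \<in> T"
      using j edges[of i] by (cases "i = j") (auto simp: insert_commute min_absorb2)
  qed
  then show False using P(2) by blast
qed

text \<open>An optimal value \<open>v\<close> is represented by \<open>Suc v\<close>, so that 0 stands for infeasibility.\<close>

definition val :: "('a set \<times> 'a set) set \<Rightarrow> nat" where
  "val S = Max (insert 0 ((\<lambda>(C, L). Suc (card L)) ` S))"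

text \<open>Addition of optimal values under the shift by one, with infeasibility absorbing.\<close>

definition comb :: "nat \<Rightarrow> nat \<Rightarrow> nat" where
  "comb a b = (if a = 0 \<or> b = 0 then 0 else a + b - 1)"

definition join :: "('a set \<times> 'a set) set \<Rightarrow> ('a set \<times> 'a set) set \<Rightarrow> ('a set \<times> 'a set) set" where
  "join S T = {(C1 \<union> C2, L1 \<union> L2) | C1 L1 C2 L2. (C1, L1) \<in> S \<and> (C2, L2) \<in> T}"

lemma val_empty [simp]: "val {} = 0"
  by (simp add: val_def)

lemma val_ge: "finite S \<Longrightarrow> (C, L) \<in> S \<Longrightarrow> Suc (card L) \<le> val S"
  unfolding val_def by (rule Max_ge) force+

lemma val_attained:
  assumes "finite S" "S \<noteq> {}"
  obtains C L where "(C, L) \<in> S" "val S = Suc (card L)"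
proof -
  have "val S \<in> insert 0 ((\<lambda>(C, L). Suc (card L)) ` S)"
    unfolding val_def using assms by (intro Max_in) auto
  moreover have "val S \<noteq> 0" using assms val_ge[OF assms(1)] by force
  ultimately show ?thesis using that by force
qed

lemma val_Un: "finite S \<Longrightarrow> finite T \<Longrightarrow> val (S \<union> T) = max (val S) (val T)"
proof -
  assume "finite S" "finite T"
  moreover have "insert 0 ((\<lambda>(C, L). Suc (card L)) ` (S \<union> T)) =
      insert 0 ((\<lambda>(C, L). Suc (card L)) ` S) \<union> insert 0 ((\<lambda>(C, L). Suc (card L)) ` T)" by auto
  ultimately show ?thesis unfolding val_def by (simp only: Max_Un finite_insert finite_imageI insert_not_empty simp_thms)
qed

text \<open>The two leaf sets lie in disjoint ground sets, so their sizes add and the two optima can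
  be chosen independently.\<close>

lemma val_join:
  assumes fin: "finite S" "finite T" "finite U1" "finite U2" and disj: "U1 \<inter> U2 = {}"
    and S: "\<And>C L. (C, L) \<in> S \<Longrightarrow> L \<subseteq> U1" and T: "\<And>C L. (C, L) \<in> T \<Longrightarrow> L \<subseteq> U2"
  shows "val (join S T) = comb (val S) (val T)"
proof (cases "S = {} \<or> T = {}")
  case True
  then have "join S T = {}" by (auto simp: join_def)
  then show ?thesis using True by (auto simp: comb_def)
next
  case False
  have card: "card (L1 \<union> L2) = card L1 + card L2" if "(C1, L1) \<in> S" "(C2, L2) \<in> T" for C1 L1 C2 L2
    using S[OF that(1)] T[OF that(2)] disj fin
    by (intro card_Un_disjoint) (auto intro: finite_subset)
  have finJ: "finite (join S T)"
  proof -
    have "join S T \<subseteq> (\<lambda>(p, q). (fst p \<union> fst q, snd p \<union> snd q)) ` (S \<times> T)"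
    proof
      fix r assume "r \<in> join S T"
      then obtain C1 L1 C2 L2 where "r = (C1 \<union> C2, L1 \<union> L2)" "(C1, L1) \<in> S" "(C2, L2) \<in> T"
        by (auto simp: join_def)
      then show "r \<in> (\<lambda>(p, q). (fst p \<union> fst q, snd p \<union> snd q)) ` (S \<times> T)"
        by (intro image_eqI[of _ _ "((C1, L1), (C2, L2))"]) auto
    qed
    then show ?thesis using fin by (meson finite_SigmaI finite_imageI finite_subset)
  qed
  obtain C1 L1 where 1: "(C1, L1) \<in> S" "val S = Suc (card L1)" using val_attained[of S] fin False by metis
  obtain C2 L2 where 2: "(C2, L2) \<in> T" "val T = Suc (card L2)" using val_attained[of T] fin False by metis
  have in12: "(C1 \<union> C2, L1 \<union> L2) \<in> join S T" using 1 2 by (auto simp: join_def)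
  then obtain C L where 3: "(C, L) \<in> join S T" "val (join S T) = Suc (card L)"
    using val_attained[of "join S T"] finJ by blast
  then obtain D1 M1 D2 M2 where 4: "L = M1 \<union> M2" "(D1, M1) \<in> S" "(D2, M2) \<in> T" by (auto simp: join_def)
  have "val (join S T) \<ge> Suc (card L1 + card L2)" using val_ge[OF finJ in12] card[OF 1(1) 2(1)] by simp
  moreover have "Suc (card M1) \<le> val S" "Suc (card M2) \<le> val T" using val_ge fin 4 by metis+
  ultimately show ?thesis using 1 2 3 4 card[OF 4(2,3)] by (simp add: comb_def)
qed

section \<open>Dynamic programming over the bags\<close>

text \<open>Vertices are \<open>0, \<dots>, n - 1\<close>, bags are \<open>0, \<dots>, k - 1\<close>. The number \<open>n + i\<close> is a dummy vertex of bag \<open>i\<close>,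
  which stands for the choice of no vertex; bag \<open>k\<close> contains nothing but its dummy and serves as the
  common root of the forest.\<close>

locale bag_graph =
  fixes n k :: nat and E :: "nat set set" and bag :: "nat \<Rightarrow> nat" and fadj :: "nat \<Rightarrow> nat \<Rightarrow> bool"
  assumes simple: "simple_graph {..<n} E"
    and k_le: "k \<le> n"
    and bag_less: "v < n \<Longrightarrow> bag v < k"
    and bag_dummy: "i \<le> k \<Longrightarrow> bag (n + i) = i"
    and clique: "u < n \<Longrightarrow> v < n \<Longrightarrow> u \<noteq> v \<Longrightarrow> bag u = bag v \<Longrightarrow> {u, v} \<in> E"
    and edge_fadj: "{u, v} \<in> E \<Longrightarrow> bag u \<noteq> bag v \<Longrightarrow> fadj (bag u) (bag v)"
    and complete: "{u, v} \<in> E \<Longrightarrow> {u', v'} \<in> E \<Longrightarrow> bag u = bag u' \<Longrightarrow> bag v = bag v' \<Longrightarrow>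
      bag u \<noteq> bag v \<Longrightarrow> {u, v'} \<in> E"
    and fadj_sym: "fadj i j \<Longrightarrow> fadj j i"
    and fadj_irrefl: "\<not> fadj i i"
    and leaf_exists: "R \<subseteq> {..<k} \<Longrightarrow> R \<noteq> {} \<Longrightarrow>
      \<exists>y\<in>R. \<forall>z1\<in>R. \<forall>z2\<in>R. fadj y z1 \<longrightarrow> fadj y z2 \<longrightarrow> z1 = z2"
begin

abbreviation V :: "nat set" where "V \<equiv> {..<n}"

definition N :: nat where "N = n + k + 1"

definition verts :: "nat \<Rightarrow> nat set" where
  "verts x = {v. v < n \<and> bag v = x}"

definition nbs :: "nat set \<Rightarrow> nat \<Rightarrow> nat set" where
  "nbs C v = {u \<in> C. {u, v} \<in> E}"

text \<open>\<open>b\<close> counts the centres adjacent to the leaf \<open>l\<close> of bag \<open>x\<close>; by convention it is 1 if \<open>l\<close> is a dummy.\<close>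

definition configs :: "nat set \<Rightarrow> nat set \<Rightarrow> nat set \<Rightarrow> nat \<Rightarrow> nat \<Rightarrow> nat \<Rightarrow> nat \<Rightarrow> (nat set \<times> nat set) set" where
  "configs AC AL U x c l b = {(C, L). C \<subseteq> U \<inter> AC \<and> L \<subseteq> U \<inter> AL \<and> C \<inter> L = {} \<and>
     (\<forall>u\<in>C. \<forall>v\<in>C. {u, v} \<notin> E) \<and> (\<forall>u\<in>L. \<forall>v\<in>L. {u, v} \<notin> E) \<and>
     C \<inter> verts x = {c} \<inter> V \<and> L \<inter> verts x = {l} \<inter> V \<and>
     (\<forall>v\<in>L - {l}. card (nbs C v) = 1) \<and> (if l < n then card (nbs C l) = b else b = 1)}"

text \<open>The marked vertices are those of the two boundary sets, provided that these are nonempty.\<close>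

definition mark :: "nat \<Rightarrow> nat \<Rightarrow> nat \<Rightarrow> nat" where
  "mark x y v = of_bool (\<exists>w. {v, w} \<in> E \<and> (bag v = x \<and> bag w = y \<or> bag v = y \<and> bag w = x))"

text \<open>What bag \<open>y\<close> offers to its neighbour \<open>x\<close>: \<open>a\<close> and \<open>b\<close> are the marks of the centre and of the leaf in \<open>x\<close>,
  and \<open>z\<close> is the number of centres that \<open>y\<close> contributes to the leaf in \<open>x\<close>.\<close>

definition messages :: "nat set \<Rightarrow> nat set \<Rightarrow> nat set \<Rightarrow> nat \<Rightarrow> nat \<Rightarrow> (nat \<times> nat) set \<Rightarrow>
    nat \<Rightarrow> nat \<Rightarrow> nat \<Rightarrow> (nat set \<times> nat set) set" where
  "messages AC AL U x y S a b z = (\<Union>(c, l) \<in> {(c, l) \<in> S. bag c = y \<and> bag l = y \<and>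
     a * mark x y c = 0 \<and> b * mark x y l = 0 \<and> z = b * mark x y c}.
     configs AC AL U y c l (1 - a * mark x y l))"

definition opt :: "nat set \<Rightarrow> nat set \<Rightarrow> nat" where
  "opt AC AL = val (configs AC AL V k (n + k) (n + k) 1) - 1"

section \<open>Marks, choices in a bag, and interaction across a tree edge\<close>

lemma edgeD: "{u, v} \<in> E \<Longrightarrow> u < n" "{u, v} \<in> E \<Longrightarrow> v < n" "{u, v} \<in> E \<Longrightarrow> u \<noteq> v"
  using simple_graph_edgeD[OF simple] by auto

lemma finite_configs:
  assumes "finite U"
  shows "finite (configs AC AL U x c l b)"
proof (rule finite_subset)
  show "configs AC AL U x c l b \<subseteq> Pow U \<times> Pow U" by (auto simp: configs_def)
qed (use assms in simp)

lemma finite_messages: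
  assumes "finite U" "finite S"
  shows "finite (messages AC AL U x y S a b z)"
  unfolding messages_def
proof (rule finite_UN_I)
  show "finite {(c, l) \<in> S. bag c = y \<and> bag l = y \<and>
     a * mark x y c = 0 \<and> b * mark x y l = 0 \<and> z = b * mark x y c}"
    by (rule finite_subset[OF _ assms(2)]) auto
qed (use finite_configs[OF assms(1)] in auto)

lemma messages_subset: "(C, L) \<in> messages AC AL U x y S a b z \<Longrightarrow> C \<subseteq> U \<and> L \<subseteq> U"
  by (auto simp: messages_def configs_def)

lemma configs_subset: "(C, L) \<in> configs AC AL U x c l b \<Longrightarrow> C \<subseteq> U \<and> L \<subseteq> U"
  by (auto simp: configs_def)

lemma verts_disjoint: "x \<noteq> y \<Longrightarrow> verts x \<inter> verts y = {}"
  by (auto simp: verts_def)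

lemma mark_01: "mark x y v = 0 \<or> mark x y v = 1"
  by (simp add: mark_def)

lemma mark_eq_1_iff: "mark x y v = 1 \<longleftrightarrow>
    (\<exists>w. {v, w} \<in> E \<and> (bag v = x \<and> bag w = y \<or> bag v = y \<and> bag w = x))"
  unfolding mark_def of_bool_eq_1_iff ..

lemma mark_commute: "mark x y = mark y x"
  unfolding mark_def by (intro ext arg_cong[where f = of_bool]) auto

lemma mark_less: "mark x y v = 1 \<Longrightarrow> v < n"
  unfolding mark_eq_1_iff by (auto dest: edgeD)

text \<open>This lets products of marks express compatibility conditions uniformly, whether or not a
  vertex was chosen.\<close>

lemma mark_dummy: "n \<le> v \<Longrightarrow> mark x y v = 0"
  using mark_less[of x y v] mark_01[of x y v] by auto

lemma independent_bag_unique: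
  assumes "u \<in> verts x" "v \<in> verts x" "\<forall>u\<in>C. \<forall>v\<in>C. {u, v} \<notin> E" "u \<in> C" "v \<in> C"
  shows "u = v"
proof (rule ccontr)
  assume "u \<noteq> v"
  then have "{u, v} \<in> E" using assms(1,2) by (intro clique) (auto simp: verts_def)
  then show False using assms(3-5) by blast
qed

text \<open>An independent set meets a clique in at most one vertex; if it misses the bag, the dummy
  \<open>n + x\<close> is the witness. So a choice is always one number below
  \<open>N\<close>.\<close>

lemma independent_bag:
  assumes "\<forall>u\<in>C. \<forall>v\<in>C. {u, v} \<notin> E" "x \<le> k"
  obtains c where "c < N" "bag c = x" "C \<inter> verts x = {c} \<inter> V"
proof (cases "C \<inter> verts x = {}")
  case True
  show ?thesis by (rule that[of "n + x"]) (use True assms bag_dummy in \<open>auto simp: N_def\<close>)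
next
  case False
  then obtain c where "c \<in> C" "c \<in> verts x" by auto
  moreover from this have "C \<inter> verts x = {c}" using independent_bag_unique[OF _ _ assms(1)] by blast
  ultimately show ?thesis using that[of c] by (auto simp: verts_def N_def)
qed

text \<open>\<open>U1\<close> and \<open>U2\<close> stand for the vertex sets of the parts that have
  been merged into the bags \<open>x\<close> and \<open>y\<close>; all edges between the parts run
  directly between these two bags.\<close>

definition separated :: "nat set \<Rightarrow> nat \<Rightarrow> nat set \<Rightarrow> nat \<Rightarrow> bool" where
  "separated U1 x U2 y \<longleftrightarrow> U1 \<subseteq> V \<and> U2 \<subseteq> V \<and> verts x \<subseteq> U1 \<and> verts y \<subseteq> U2 \<and> U1 \<inter> U2 = {} \<and>
     (\<forall>u\<in>U1. \<forall>v\<in>U2. {u, v} \<in> E \<longrightarrow> bag u = x \<and> bag v = y)"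

lemma separated_commute: "separated U1 x U2 y \<longleftrightarrow> separated U2 y U1 x"
  unfolding separated_def by (auto simp: insert_commute)

lemma mark_in_bag:
  assumes "separated U1 x U2 y" "u \<in> U1" "mark x y u = 1"
  shows "u \<in> verts x"
proof -
  have u: "u < n" using mark_less[OF assms(3)] .
  moreover have "u \<notin> verts y" using assms(1,2) by (auto simp: separated_def)
  ultimately show ?thesis using assms(3) unfolding mark_eq_1_iff verts_def by blast
qed

text \<open>A marked vertex on either side has some neighbour in the other bag. By
  \<open>complete\<close>, the edges between the two bags form a full rectangle, so any two marked
  vertices on opposite sides are adjacent.\<close>

lemma cross_edge_iff:
  assumes "separated U1 x U2 y" "x \<noteq> y" "u \<in> U1" "v \<in> U2"
  shows "{u, v} \<in> E \<longleftrightarrow> mark x y u = 1 \<and> mark x y v = 1"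
proof
  assume e: "{u, v} \<in> E"
  then have b: "bag u = x" "bag v = y" using assms by (auto simp: separated_def)
  moreover have "{v, u} \<in> E" using e by (simp add: insert_commute)
  ultimately show "mark x y u = 1 \<and> mark x y v = 1" using e unfolding mark_eq_1_iff by blast
next
  assume m: "mark x y u = 1 \<and> mark x y v = 1"
  then have b: "bag u = x" "bag v = y"
    using mark_in_bag[OF assms(1,3)] mark_in_bag[of U2 y U1 x v] assms
    by (auto simp: verts_def separated_commute mark_commute[of x y])
  obtain w where w: "{u, w} \<in> E" "bag w = y" using m b assms(2) unfolding mark_eq_1_iff by auto
  obtain w' where w': "{v, w'} \<in> E" "bag w' = x" using m b assms(2) unfolding mark_eq_1_iff by auto
  show "{u, v} \<in> E"
    by (rule complete[of u w w' v]) (use w w' b assms(2) in \<open>auto simp: insert_commute\<close>)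
qed

lemma marked_choice:
  assumes "separated U1 x U2 y" "Z \<subseteq> U1" "Z \<inter> verts x = {z} \<inter> V"
  shows "{u \<in> Z. mark x y u = 1} = (if mark x y z = 1 then {z} else {})"
proof -
  have "u = z" if "u \<in> Z" "mark x y u = 1" for u
    using mark_in_bag[OF assms(1) _ that(2)] that(1) assms(2,3) by blast
  moreover have "z \<in> Z" if "mark x y z = 1"
    using mark_less[OF that] assms(3) by blast
  ultimately show ?thesis by auto
qed

lemma nbs_cross:
  assumes "separated U1 x U2 y" "x \<noteq> y" "Z \<subseteq> U2" "Z \<inter> verts y = {z} \<inter> V" "v \<in> U1"
  shows "nbs Z v = (if mark x y v = 1 \<and> mark x y z = 1 then {z} else {})"
proof -
  have "nbs Z v = {u \<in> Z. mark x y u = 1 \<and> mark x y v = 1}"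
    unfolding nbs_def using cross_edge_iff[OF assms(1,2,5)] assms(3)
    by (auto simp: insert_commute)
  then show ?thesis
    using marked_choice[of U2 y U1 x Z z] assms
    by (auto simp: separated_commute mark_commute[of x y])
qed

text \<open>The other part holds at most one marked centre, namely the one chosen in its bag, so a
  vertex gains at most one adjacent centre.\<close>

lemma card_nbs_Un:
  assumes "separated U1 x U2 y" "x \<noteq> y" "Z1 \<subseteq> U1" "Z2 \<subseteq> U2" "Z2 \<inter> verts y = {z} \<inter> V" "v \<in> U1"
  shows "card (nbs (Z1 \<union> Z2) v) = card (nbs Z1 v) + mark x y v * mark x y z"
proof -
  have "nbs (Z1 \<union> Z2) v = nbs Z1 v \<union> nbs Z2 v" by (auto simp: nbs_def)
  moreover have "finite (nbs Z1 v)" "finite (nbs Z2 v)" "nbs Z1 v \<inter> nbs Z2 v = {}"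
  proof -
    have "Z1 \<subseteq> V" "Z2 \<subseteq> V" "Z1 \<inter> Z2 = {}" using assms(1,3,4) by (auto simp: separated_def)
    then show "finite (nbs Z1 v)" "finite (nbs Z2 v)" "nbs Z1 v \<inter> nbs Z2 v = {}"
      by (auto simp: nbs_def intro: finite_subset[of _ V])
  qed
  ultimately have "card (nbs (Z1 \<union> Z2) v) = card (nbs Z1 v) + card (nbs Z2 v)"
    by (simp add: card_Un_disjoint)
  moreover have "card (nbs Z2 v) = mark x y v * mark x y z"
    using nbs_cross[OF assms(1,2,4,5,6)] mark_01[of x y v] mark_01[of x y z] by auto
  ultimately show ?thesis by simp
qed

text \<open>All marked vertices of \<open>Z1\<close> and \<open>Z2\<close> are the two bag choices,
  so these are the only pair that can be adjacent across the parts.\<close>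

lemma independent_Un:
  assumes "separated U1 x U2 y" "x \<noteq> y" "Z1 \<subseteq> U1" "Z2 \<subseteq> U2"
    "Z1 \<inter> verts x = {z1} \<inter> V" "Z2 \<inter> verts y = {z2} \<inter> V"
  shows "(\<forall>u\<in>Z1 \<union> Z2. \<forall>v\<in>Z1 \<union> Z2. {u, v} \<notin> E) \<longleftrightarrow>
    (\<forall>u\<in>Z1. \<forall>v\<in>Z1. {u, v} \<notin> E) \<and> (\<forall>u\<in>Z2. \<forall>v\<in>Z2. {u, v} \<notin> E) \<and> mark x y z1 * mark x y z2 = 0"
proof -
  have c: "{u, v} \<in> E \<longleftrightarrow> mark x y u = 1 \<and> mark x y v = 1" if "u \<in> Z1" "v \<in> Z2" for u v
    using cross_edge_iff[OF assms(1,2)] that assms by blast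
  have m1: "{u \<in> Z1. mark x y u = 1} = (if mark x y z1 = 1 then {z1} else {})"
    using marked_choice[OF assms(1,3,5)] .
  have m2: "{u \<in> Z2. mark x y u = 1} = (if mark x y z2 = 1 then {z2} else {})"
    using marked_choice[of U2 y U1 x Z2 z2] assms
    by (auto simp: separated_commute mark_commute[of x y])
  have "(\<forall>u\<in>Z1. \<forall>v\<in>Z2. {u, v} \<notin> E) \<longleftrightarrow> {u \<in> Z1. mark x y u = 1} = {} \<or> {u \<in> Z2. mark x y u = 1} = {}"
    using c by blast
  also have "\<dots> \<longleftrightarrow> mark x y z1 * mark x y z2 = 0"
    unfolding m1 m2 using mark_01[of x y z1] mark_01[of x y z2] by auto
  finally have X: "(\<forall>u\<in>Z1. \<forall>v\<in>Z2. {u, v} \<notin> E) \<longleftrightarrow> mark x y z1 * mark x y z2 = 0" .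
  have "(\<forall>u\<in>Z2. \<forall>v\<in>Z1. {u, v} \<notin> E) \<longleftrightarrow> (\<forall>u\<in>Z1. \<forall>v\<in>Z2. {u, v} \<notin> E)"
    by (subst insert_commute) blast
  then show ?thesis unfolding ball_Un ball_conj_distrib X[symmetric] by argo
qed

text \<open>Every condition on the union splits into one per part plus a product of marks of the
  four chosen vertices. The leaf \<open>l'\<close> becomes final and needs from its own part what
  the centre \<open>c\<close> does not supply; the leaf \<open>l\<close> stays open, and its count
  grows by what \<open>c'\<close> supplies.\<close>

lemma configs_Un_iff:
  assumes sep: "separated U1 x U2 y" "x \<noteq> y"
    and C1: "C1 \<subseteq> U1" "C1 \<inter> verts x = {c} \<inter> V" and L1: "L1 \<subseteq> U1" "L1 \<inter> verts x = {l} \<inter> V"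
    and C2: "C2 \<subseteq> U2" "C2 \<inter> verts y = {c'} \<inter> V" and L2: "L2 \<subseteq> U2" "L2 \<inter> verts y = {l'} \<inter> V"
    and b: "b \<le> 1"
  shows "(C1 \<union> C2, L1 \<union> L2) \<in> configs AC AL (U1 \<union> U2) x c l b \<longleftrightarrow>
    (\<exists>b1. (C1, L1) \<in> configs AC AL U1 x c l b1 \<and>
      (C2, L2) \<in> configs AC AL U2 y c' l' (1 - mark x y c * mark x y l') \<and>
      mark x y c * mark x y c' = 0 \<and> mark x y l * mark x y l' = 0 \<and>
      b = b1 + mark x y l * mark x y c')"
proof -
  have sep': "separated U2 y U1 x" "y \<noteq> x" using sep separated_commute by auto
  have sd: "U1 \<inter> U2 = {}" "verts x \<subseteq> U1" "verts y \<subseteq> U2" and sdV: "U1 \<subseteq> V" "U2 \<subseteq> V"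
    using sep(1) by (auto simp: separated_def)
  have nb1: "card (nbs (C1 \<union> C2) v) = card (nbs C1 v) + mark x y v * mark x y c'" if "v \<in> U1" for v
    using card_nbs_Un[OF sep C1(1) C2 that] .
  have nb2: "card (nbs (C1 \<union> C2) v) = card (nbs C2 v) + mark x y v * mark x y c" if "v \<in> U2" for v
    using card_nbs_Un[OF sep' C2(1) C1 that] by (simp add: Un_commute mark_commute[of x y])
  \<comment> \<open>Leaves outside the two bags are unmarked, so the merge does not change their
    number of centres.\<close>
  have m1: "mark x y v = 0" if "v \<in> L1 - {l}" for v
  proof (rule ccontr)
    assume "mark x y v \<noteq> 0"
    then have "mark x y v = 1" using mark_01[of x y v] by simp
    then have "v \<in> verts x" using mark_in_bag[OF sep(1)] that L1 by auto
    then show False using that L1 by auto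
  qed
  have m2: "mark x y v = 0" if "v \<in> L2 - {l'}" for v
  proof (rule ccontr)
    assume "mark x y v \<noteq> 0"
    then have "mark x y v = 1" using mark_01[of x y v] by simp
    then have "v \<in> verts y" using mark_in_bag[OF sep'(1)] that L2 by (auto simp: mark_commute[of x y])
    then show False using that L2 by auto
  qed
  have indC: "(\<forall>u\<in>C1 \<union> C2. \<forall>v\<in>C1 \<union> C2. {u, v} \<notin> E) \<longleftrightarrow>
    (\<forall>u\<in>C1. \<forall>v\<in>C1. {u, v} \<notin> E) \<and> (\<forall>u\<in>C2. \<forall>v\<in>C2. {u, v} \<notin> E) \<and> mark x y c * mark x y c' = 0"
    by (rule independent_Un[OF sep C1(1) C2(1) C1(2) C2(2)])
  have indL: "(\<forall>u\<in>L1 \<union> L2. \<forall>v\<in>L1 \<union> L2. {u, v} \<notin> E) \<longleftrightarrow>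
    (\<forall>u\<in>L1. \<forall>v\<in>L1. {u, v} \<notin> E) \<and> (\<forall>u\<in>L2. \<forall>v\<in>L2. {u, v} \<notin> E) \<and> mark x y l * mark x y l' = 0"
    by (rule independent_Un[OF sep L1(1) L2(1) L1(2) L2(2)])
  have bags: "(C1 \<union> C2) \<inter> verts x = {c} \<inter> V" "(L1 \<union> L2) \<inter> verts x = {l} \<inter> V"
  proof -
    have "C2 \<inter> verts x = {}" "L2 \<inter> verts x = {}" using C2(1) L2(1) sd by blast+
    then show "(C1 \<union> C2) \<inter> verts x = {c} \<inter> V" "(L1 \<union> L2) \<inter> verts x = {l} \<inter> V"
      using C1(2) L1(2) by (simp_all add: Int_Un_distrib2)
  qed
  have dis: "C1 \<inter> L2 = {}" "C2 \<inter> L1 = {}" "C1 \<inter> U2 = {}" "C2 \<inter> U1 = {}" "L1 \<inter> U2 = {}" "L2 \<inter> U1 = {}"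
    using C1(1) C2(1) L1(1) L2(1) sd by blast+
  have sub: "C1 \<union> C2 \<subseteq> (U1 \<union> U2) \<inter> AC \<longleftrightarrow> C1 \<subseteq> U1 \<inter> AC \<and> C2 \<subseteq> U2 \<inter> AC"
    "L1 \<union> L2 \<subseteq> (U1 \<union> U2) \<inter> AL \<longleftrightarrow> L1 \<subseteq> U1 \<inter> AL \<and> L2 \<subseteq> U2 \<inter> AL"
    "(C1 \<union> C2) \<inter> (L1 \<union> L2) = {} \<longleftrightarrow> C1 \<inter> L1 = {} \<and> C2 \<inter> L2 = {}"
    using C1(1) C2(1) L1(1) L2(1) dis by blast+
  have lU: "l \<in> U1" if "l < n" using that L1 by blast
  \<comment> \<open>The exemption of \<open>l\<close> from the exact count therefore never exempts a
    leaf of the second part.\<close>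
  have lnot: "l \<notin> L2" using lU L2(1) dis(6) sdV(2) by blast
  have l'in: "l' \<in> L2" "l' \<in> U2" if "l' < n" using that L2 by blast+
  have l'if: "l' < n" if "l' \<in> L2" using that L2(1) sdV by blast
  have leaves1: "(\<forall>v\<in>L1 - {l}. card (nbs (C1 \<union> C2) v) = 1) \<longleftrightarrow> (\<forall>v\<in>L1 - {l}. card (nbs C1 v) = 1)"
    using nb1 m1 L1(1) by (intro ball_cong) auto
  have "(\<forall>v\<in>L2. card (nbs (C1 \<union> C2) v) = 1) \<longleftrightarrow>
    (\<forall>v\<in>L2 - {l'}. card (nbs (C1 \<union> C2) v) = 1) \<and> (l' < n \<longrightarrow> card (nbs (C1 \<union> C2) l') = 1)"
    using l'in l'if by blast
  also have "\<dots> \<longleftrightarrow> (\<forall>v\<in>L2 - {l'}. card (nbs C2 v) = 1) \<and>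
      (if l' < n then card (nbs C2 l') = 1 - mark x y c * mark x y l'
       else 1 - mark x y c * mark x y l' = 1)"
  proof -
    have "(\<forall>v\<in>L2 - {l'}. card (nbs (C1 \<union> C2) v) = 1) \<longleftrightarrow> (\<forall>v\<in>L2 - {l'}. card (nbs C2 v) = 1)"
      using nb2 m2 L2(1) by (intro ball_cong) auto
    moreover have "card (nbs (C1 \<union> C2) l') = 1 \<longleftrightarrow> card (nbs C2 l') = 1 - mark x y c * mark x y l'" if "l' < n"
      using nb2[OF l'in(2)[OF that]] mark_01[of x y c] mark_01[of x y l'] by auto
    \<comment> \<open>For a dummy \<open>l'\<close> the else branch is automatic, because its mark
      is 0.\<close>
    ultimately show ?thesis using mark_dummy[of l' x y] by auto
  qed
  finally have leaves2: "(\<forall>v\<in>L2. card (nbs (C1 \<union> C2) v) = 1) \<longleftrightarrow>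
      (\<forall>v\<in>L2 - {l'}. card (nbs C2 v) = 1) \<and>
      (if l' < n then card (nbs C2 l') = 1 - mark x y c * mark x y l'
       else 1 - mark x y c * mark x y l' = 1)" .
  have "(\<forall>v\<in>(L1 \<union> L2) - {l}. card (nbs (C1 \<union> C2) v) = 1) \<longleftrightarrow>
      (\<forall>v\<in>L1 - {l}. card (nbs (C1 \<union> C2) v) = 1) \<and> (\<forall>v\<in>L2. card (nbs (C1 \<union> C2) v) = 1)"
    using lnot by blast
  note leaves = this[unfolded leaves1 leaves2]
  \<comment> \<open>For a dummy \<open>l\<close> the mark is 0, and both sides reduce to the
    convention \<open>b = 1\<close>.\<close>
  have bq: "(if l < n then card (nbs (C1 \<union> C2) l) = b else b = 1) \<longleftrightarrow>
    (\<exists>b1. (if l < n then card (nbs C1 l) = b1 else b1 = 1) \<and> b = b1 + mark x y l * mark x y c')"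
    using nb1[OF lU] mark_dummy[of l x y] by auto
  define K1 where "K1 \<longleftrightarrow> C1 \<subseteq> U1 \<inter> AC \<and> L1 \<subseteq> U1 \<inter> AL \<and> C1 \<inter> L1 = {} \<and>
    (\<forall>u\<in>C1. \<forall>v\<in>C1. {u, v} \<notin> E) \<and> (\<forall>u\<in>L1. \<forall>v\<in>L1. {u, v} \<notin> E) \<and>
    (\<forall>v\<in>L1 - {l}. card (nbs C1 v) = 1)"
  define K2 where "K2 \<longleftrightarrow> C2 \<subseteq> U2 \<inter> AC \<and> L2 \<subseteq> U2 \<inter> AL \<and> C2 \<inter> L2 = {} \<and>
    (\<forall>u\<in>C2. \<forall>v\<in>C2. {u, v} \<notin> E) \<and> (\<forall>u\<in>L2. \<forall>v\<in>L2. {u, v} \<notin> E) \<and>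
    (\<forall>v\<in>L2 - {l'}. card (nbs C2 v) = 1) \<and>
    (if l' < n then card (nbs C2 l') = 1 - mark x y c * mark x y l'
     else 1 - mark x y c * mark x y l' = 1)"
  have 1: "(C1, L1) \<in> configs AC AL U1 x c l b1 \<longleftrightarrow>
      K1 \<and> (if l < n then card (nbs C1 l) = b1 else b1 = 1)" for b1
    unfolding configs_def mem_Collect_eq prod.case K1_def C1(2) L1(2) by (simp only: simp_thms conj_assoc)
  have 2: "(C2, L2) \<in> configs AC AL U2 y c' l' (1 - mark x y c * mark x y l') \<longleftrightarrow> K2"
    unfolding configs_def mem_Collect_eq prod.case K2_def C2(2) L2(2) by (simp only: simp_thms conj_assoc)
  have "(C1 \<union> C2, L1 \<union> L2) \<in> configs AC AL (U1 \<union> U2) x c l b \<longleftrightarrow> K1 \<and> K2 \<and>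
      mark x y c * mark x y c' = 0 \<and> mark x y l * mark x y l' = 0 \<and>
      (\<exists>b1. (if l < n then card (nbs C1 l) = b1 else b1 = 1) \<and> b = b1 + mark x y l * mark x y c')"
    unfolding configs_def mem_Collect_eq prod.case sub indC indL leaves bags bq K1_def K2_def
    by (simp only: simp_thms conj_ac)
  then show ?thesis unfolding 1 2 by blast
qed

text \<open>The choices \<open>c'\<close> and \<open>l'\<close> in the absorbed bag affect the other
  part only through the marks of \<open>c\<close> and \<open>l\<close> and the contribution
  \<open>z\<close>, so they can be quantified away inside \<open>messages\<close>.\<close>

lemma configs_Un:
  assumes sep: "separated U1 x U2 y" "x \<noteq> y" and "y \<le> k" "b \<le> 1"
  shows "configs AC AL (U1 \<union> U2) x c l b = (\<Union>(b1, z) \<in> {(b1, z). b1 + z = b}.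
    join (configs AC AL U1 x c l b1)
      (messages AC AL U2 x y ({..<N} \<times> {..<N}) (mark x y c) (mark x y l) z))" (is "?l = ?r")
proof (rule set_eqI, rule iffI)
  have sd: "U1 \<inter> U2 = {}" "verts x \<subseteq> U1" "verts y \<subseteq> U2"
    using sep(1) by (auto simp: separated_def)
  fix p assume p: "p \<in> ?l"
  obtain C L where CL: "p = (C, L)" by force
  define C1 L1 C2 L2 where d: "C1 = C \<inter> U1" "L1 = L \<inter> U1" "C2 = C \<inter> U2" "L2 = L \<inter> U2"
  have props: "C \<subseteq> U1 \<union> U2" "L \<subseteq> U1 \<union> U2" "\<forall>u\<in>C. \<forall>v\<in>C. {u, v} \<notin> E" "\<forall>u\<in>L. \<forall>v\<in>L. {u, v} \<notin> E"
    "C \<inter> verts x = {c} \<inter> V" "L \<inter> verts x = {l} \<inter> V"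
    using p by (auto simp: CL configs_def)
  have CLd: "C = C1 \<union> C2" "L = L1 \<union> L2" using props d by auto
  obtain c' where c': "c' < N" "bag c' = y" "C \<inter> verts y = {c'} \<inter> V"
    using independent_bag[OF props(3) \<open>y \<le> k\<close>] by blast
  obtain l' where l': "l' < N" "bag l' = y" "L \<inter> verts y = {l'} \<inter> V"
    using independent_bag[OF props(4) \<open>y \<le> k\<close>] by blast
  have int: "C1 \<inter> verts x = {c} \<inter> V" "L1 \<inter> verts x = {l} \<inter> V"
    "C2 \<inter> verts y = {c'} \<inter> V" "L2 \<inter> verts y = {l'} \<inter> V"
  proof -
    have "verts x \<subseteq> U1" "verts y \<subseteq> U2" using sd by blast+
    then show "C1 \<inter> verts x = {c} \<inter> V" "L1 \<inter> verts x = {l} \<inter> V"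
      "C2 \<inter> verts y = {c'} \<inter> V" "L2 \<inter> verts y = {l'} \<inter> V"
      unfolding d props(5,6)[symmetric] c'(3)[symmetric] l'(3)[symmetric] by auto
  qed
  have "\<exists>b1. (C1, L1) \<in> configs AC AL U1 x c l b1 \<and>
      (C2, L2) \<in> configs AC AL U2 y c' l' (1 - mark x y c * mark x y l') \<and>
      mark x y c * mark x y c' = 0 \<and> mark x y l * mark x y l' = 0 \<and>
      b = b1 + mark x y l * mark x y c'"
    using p configs_Un_iff[OF sep _ int(1) _ int(2) _ int(3) _ int(4) \<open>b \<le> 1\<close>, of AC AL]
    unfolding CL CLd using d by auto
  then obtain b1 where b1: "(C1, L1) \<in> configs AC AL U1 x c l b1"
      "(C2, L2) \<in> configs AC AL U2 y c' l' (1 - mark x y c * mark x y l')"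
      "mark x y c * mark x y c' = 0" "mark x y l * mark x y l' = 0"
      "b1 + mark x y l * mark x y c' = b" by auto
  have "(C2, L2) \<in> messages AC AL U2 x y ({..<N} \<times> {..<N}) (mark x y c) (mark x y l) (mark x y l * mark x y c')"
    unfolding messages_def using b1 c' l' by (intro UN_I[of "(c', l')"]) auto
  then have "p \<in> join (configs AC AL U1 x c l b1)
      (messages AC AL U2 x y ({..<N} \<times> {..<N}) (mark x y c) (mark x y l) (mark x y l * mark x y c'))"
    unfolding join_def CL CLd using b1(1) by blast
  then show "p \<in> ?r" using b1(5) by blast
next
  fix p assume "p \<in> ?r"
  then obtain b1 z where z: "b1 + z = b" "p \<in> join (configs AC AL U1 x c l b1)
      (messages AC AL U2 x y ({..<N} \<times> {..<N}) (mark x y c) (mark x y l) z)" by blast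
  then obtain C1 L1 C2 L2 where p: "p = (C1 \<union> C2, L1 \<union> L2)" "(C1, L1) \<in> configs AC AL U1 x c l b1"
    "(C2, L2) \<in> messages AC AL U2 x y ({..<N} \<times> {..<N}) (mark x y c) (mark x y l) z"
    unfolding join_def by blast
  then obtain c' l' where cl': "mark x y c * mark x y c' = 0" "mark x y l * mark x y l' = 0"
    "z = mark x y l * mark x y c'" "(C2, L2) \<in> configs AC AL U2 y c' l' (1 - mark x y c * mark x y l')"
    unfolding messages_def by blast
  show "p \<in> ?l" unfolding p
    by (rule iffD2[OF configs_Un_iff[OF sep, where c' = c' and l' = l']])
      (use p cl' z \<open>b \<le> 1\<close> in \<open>auto simp: configs_def\<close>)
qed

section \<open>Recurrences and bounds for the optimal values\<close>

abbreviation F :: "nat set \<Rightarrow> nat set \<Rightarrow> nat set \<Rightarrow> nat \<Rightarrow> nat \<Rightarrow> nat \<Rightarrow> nat \<Rightarrow> nat" where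
  "F AC AL U x c l b \<equiv> val (configs AC AL U x c l b)"

text \<open>A count of 0 splits only as 0 + 0, and a count of 1 as 1 + 0 or 0 + 1; the latter gives
  the maximum of two terms.\<close>

lemma F_Un:
  fixes AC AL :: "nat set" and c l :: nat
  assumes sep: "separated U1 x U2 y" "x \<noteq> y" and "y \<le> k"
  defines "m \<equiv> \<lambda>z. val (messages AC AL U2 x y ({..<N} \<times> {..<N}) (mark x y c) (mark x y l) z)"
  shows "F AC AL (U1 \<union> U2) x c l 0 = comb (F AC AL U1 x c l 0) (m 0)"
    and "F AC AL (U1 \<union> U2) x c l 1 =
      max (comb (F AC AL U1 x c l 1) (m 0)) (comb (F AC AL U1 x c l 0) (m 1))"
proof -
  let ?M = "messages AC AL U2 x y ({..<N} \<times> {..<N}) (mark x y c) (mark x y l)"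
  have fin: "finite U1" "finite U2" "U1 \<inter> U2 = {}"
    using sep by (auto simp: separated_def intro: finite_subset[of _ V])
  have j: "val (join (configs AC AL U1 x c l b) (?M z)) = comb (F AC AL U1 x c l b) (m z)" for b z
    unfolding m_def
    by (rule val_join[of _ _ U1 U2])
      (use fin messages_subset in \<open>auto simp: finite_configs finite_messages dest: configs_subset\<close>)
  have finj: "finite (join (configs AC AL U1 x c l b) (?M z))" for b z
  proof (rule finite_subset)
    show "join (configs AC AL U1 x c l b) (?M z) \<subseteq> Pow (U1 \<union> U2) \<times> Pow (U1 \<union> U2)"
    proof
      fix p assume "p \<in> join (configs AC AL U1 x c l b) (?M z)"
      then obtain C1 L1 C2 L2 where p: "p = (C1 \<union> C2, L1 \<union> L2)"
        "(C1, L1) \<in> configs AC AL U1 x c l b" "(C2, L2) \<in> ?M z" unfolding join_def by blast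
      then show "p \<in> Pow (U1 \<union> U2) \<times> Pow (U1 \<union> U2)"
        using configs_subset[OF p(2)] messages_subset[OF p(3)] by auto
    qed
  qed (use fin in simp)
  have s: "{(b1, z). b1 + z = 0} = {(0::nat, 0::nat)}" "{(b1, z). b1 + z = 1} = {(1::nat, 0::nat), (0, 1)}"
    by auto
  show "F AC AL (U1 \<union> U2) x c l 0 = comb (F AC AL U1 x c l 0) (m 0)"
    unfolding configs_Un[OF sep \<open>y \<le> k\<close>, of 0, simplified] s using j by simp
  have "configs AC AL (U1 \<union> U2) x c l 1 = join (configs AC AL U1 x c l 1) (?M 0) \<union>
      join (configs AC AL U1 x c l 0) (?M 1)"
    unfolding configs_Un[OF sep \<open>y \<le> k\<close> le_refl] s by simp
  then show "F AC AL (U1 \<union> U2) x c l 1 =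
      max (comb (F AC AL U1 x c l 1) (m 0)) (comb (F AC AL U1 x c l 0) (m 1))"
    using j finj by (simp add: val_Un)
qed

text \<open>Within one bag a real centre is adjacent to a real leaf because the bag is a clique.
  Hence \<open>b\<close> is determined by the choices, and the shifted value is 2 with a leaf and 1
  without.\<close>

definition base_val :: "nat set \<Rightarrow> nat set \<Rightarrow> nat \<Rightarrow> nat \<Rightarrow> nat \<Rightarrow> nat" where
  "base_val AC AL c l b =
    (if (c < n \<longrightarrow> c \<in> AC) \<and> (l < n \<longrightarrow> l \<in> AL) \<and> (c = l \<longrightarrow> n \<le> c) \<and> b = of_bool (n \<le> l \<or> c < n)
     then 1 + of_bool (l < n) else 0)"

lemma F_verts:
  assumes "bag c = x" "bag l = x"
  shows "F AC AL (verts x) x c l b = base_val AC AL c l b"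
proof -
  let ?C = "{c} \<inter> V" and ?L = "{l} \<inter> V"
  have in_verts: "?C \<subseteq> verts x" "?L \<subseteq> verts x" using assms by (auto simp: verts_def)
  have nb: "nbs ?C l = (if l < n \<and> c < n \<and> c \<noteq> l then {c} else {})"
  proof -
    have "{c, l} \<in> E \<longleftrightarrow> l < n \<and> c < n \<and> c \<noteq> l"
    proof
      assume "{c, l} \<in> E"
      then show "l < n \<and> c < n \<and> c \<noteq> l" using edgeD[of c l] by simp
    qed (use clique[of c l] assms in simp)
    then show ?thesis by (auto simp: nbs_def)
  qed
  have noloop: "{v} \<notin> E" for v using edgeD(3)[of v v] by auto
  let ?ok = "(c < n \<longrightarrow> c \<in> AC) \<and> (l < n \<longrightarrow> l \<in> AL) \<and> (c = l \<longrightarrow> n \<le> c) \<and> b = of_bool (n \<le> l \<or> c < n)"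
  have iff: "(C, L) \<in> configs AC AL (verts x) x c l b \<longleftrightarrow> C = ?C \<and> L = ?L \<and> ?ok" for C L
  proof
    assume "(C, L) \<in> configs AC AL (verts x) x c l b"
    then have f: "C \<subseteq> verts x \<inter> AC" "L \<subseteq> verts x \<inter> AL" "C \<inter> L = {}"
      "C \<inter> verts x = ?C" "L \<inter> verts x = ?L" "if l < n then card (nbs C l) = b else b = 1"
      unfolding configs_def mem_Collect_eq prod.case by - (elim conjE, assumption)+
    have eq: "C = ?C" "L = ?L" using f(1,2,4,5) by blast+
    have sub: "?C \<subseteq> AC" "?L \<subseteq> AL" "?C \<inter> ?L = {}"
    proof -
      show "?C \<subseteq> AC" unfolding eq(1)[symmetric] using f(1) by blast
      show "?L \<subseteq> AL" unfolding eq(2)[symmetric] using f(2) by blast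
      show "?C \<inter> ?L = {}" unfolding eq[symmetric] by (fact f(3))
    qed
    have "if l < n then card (nbs ?C l) = b else b = 1" using f(6) unfolding eq(1)[symmetric] .
    then have ?ok using sub unfolding nb by (cases "c < n"; cases "l < n") auto
    with eq show "C = ?C \<and> L = ?L \<and> ?ok" by blast
  next
    assume ok: "C = ?C \<and> L = ?L \<and> ?ok"
    have b: "if l < n then card (nbs ?C l) = b else b = 1"
      using ok unfolding nb by (cases "c < n"; cases "l < n") auto
    have "(?C, ?L) \<in> configs AC AL (verts x) x c l b"
      unfolding configs_def mem_Collect_eq prod.case
      using ok in_verts noloop b by (cases "c < n"; cases "l < n") simp_all
    moreover have "C = ?C" "L = ?L" using ok by simp_all
    ultimately show "(C, L) \<in> configs AC AL (verts x) x c l b" by (simp only:)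
  qed
  have "(C, L) \<in> configs AC AL (verts x) x c l b \<longleftrightarrow> (C, L) \<in> (if ?ok then {(?C, ?L)} else {})" for C L
  proof -
    have "p \<in> (if Q then {r} else {}) \<longleftrightarrow> p = r \<and> Q" for p r :: "nat set \<times> nat set" and Q by simp
    then show ?thesis unfolding iff by (simp only: prod.inject conj_assoc)
  qed
  then have "configs AC AL (verts x) x c l b = (if ?ok then {(?C, ?L)} else {})"
    by (intro set_eqI) (simp only: split_paired_all)
  moreover have "val {(?C, ?L)} = 1 + of_bool (l < n)"
    by (cases "l < n") (simp_all add: val_def)
  ultimately show ?thesis unfolding base_val_def by (simp only: if_distrib[of val] val_empty)
qed

lemma val_configs_le:
  assumes "U \<subseteq> V"
  shows "F AC AL U x c l b \<le> n + 1"
proof -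
  have fin: "finite (configs AC AL U x c l b)" using assms by (intro finite_configs finite_subset[of U V]) auto
  show ?thesis
  proof (cases "configs AC AL U x c l b = {}")
    case False
    then obtain C L where "(C, L) \<in> configs AC AL U x c l b" "F AC AL U x c l b = Suc (card L)"
      using val_attained[OF fin] by blast
    moreover from this assms have "L \<subseteq> V" by (auto simp: configs_def)
    then have "card L \<le> n" using card_mono[of V L] by simp
    ultimately show ?thesis by simp
  qed simp
qed

lemma val_messages_le:
  assumes "U \<subseteq> V" "finite S"
  shows "val (messages AC AL U x y S a b z) \<le> n + 1"
proof -
  have fin: "finite (messages AC AL U x y S a b z)"
    using assms by (intro finite_messages finite_subset[of U V]) auto
  show ?thesis
  proof (cases "messages AC AL U x y S a b z = {}")
    case False
    then obtain C L where "(C, L) \<in> messages AC AL U x y S a b z"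
      "val (messages AC AL U x y S a b z) = Suc (card L)"
      using val_attained[OF fin] by blast
    moreover from this assms have "L \<subseteq> V" using messages_subset by blast
    then have "card L \<le> n" using card_mono[of V L] by simp
    ultimately show ?thesis by simp
  qed simp
qed

lemma val_messages_empty: "val (messages AC AL U x y {} a b z) = 0"
  by (simp add: messages_def)

text \<open>The recurrence that lets the program compute each message as a running maximum over
  pairs of choices.\<close>

lemma val_messages_insert:
  assumes "U \<subseteq> V" "finite S"
  shows "val (messages AC AL U x y (insert (c, l) S) a b z) =
    (if bag c = y \<and> bag l = y \<and> a * mark x y c = 0 \<and> b * mark x y l = 0 \<and> z = b * mark x y c
     then max (val (messages AC AL U x y S a b z)) (F AC AL U y c l (1 - a * mark x y l))
     else val (messages AC AL U x y S a b z))"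
proof -
  let ?P = "bag c = y \<and> bag l = y \<and> a * mark x y c = 0 \<and> b * mark x y l = 0 \<and> z = b * mark x y c"
  have "messages AC AL U x y (insert (c, l) S) a b z =
    (if ?P then configs AC AL U y c l (1 - a * mark x y l) else {}) \<union> messages AC AL U x y S a b z"
    unfolding messages_def by auto
  moreover have "finite U" by (rule finite_subset[OF assms(1)]) simp
  ultimately show ?thesis
    using assms finite_configs finite_messages by (auto simp: val_Un)
qed

text \<open>\<open>R\<close> collects the bags not yet merged, and \<open>U x\<close> the vertices
  merged into \<open>x\<close> so far. The root \<open>k\<close> is always present.\<close>

definition elimination :: "nat set \<Rightarrow> (nat \<Rightarrow> nat set) \<Rightarrow> bool" where
  "elimination R U \<longleftrightarrow> R \<subseteq> {..<k} \<and> (\<Union>x\<in>insert k R. U x) = V \<and>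
     (\<forall>x\<in>insert k R. verts x \<subseteq> U x) \<and>
     (\<forall>x\<in>insert k R. \<forall>y\<in>insert k R. x \<noteq> y \<longrightarrow> separated (U x) x (U y) y)"

lemma verts_root: "verts k = {}"
  using bag_less by (auto simp: verts_def)

lemma elimination_init: "elimination {..<k} verts"
proof -
  have "verts k = {}" by (rule verts_root)
  moreover have "(\<Union>x<k. verts x) = V" using bag_less by (auto simp: verts_def)
  moreover have "separated (verts x) x (verts y) y" if "x \<noteq> y" for x y
    unfolding separated_def using verts_disjoint[OF that] by (auto simp: verts_def)
  ultimately show ?thesis unfolding elimination_def by simp
qed

text \<open>An edge from a third part to \<open>U y\<close> would give \<open>y\<close> a second
  neighbour among the remaining bags. If \<open>y\<close> has no neighbour left, it is merged into
  the root, across which there are no edges.\<close>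

lemma elimination_step:
  assumes el: "elimination R U" and y: "y \<in> R" and x: "x \<in> insert k R" "x \<noteq> y"
    and only: "\<And>z. z \<in> R \<Longrightarrow> fadj y z \<Longrightarrow> z = x"
  shows "elimination (R - {y}) (U(x := U x \<union> U y))"
proof -
  have R: "R \<subseteq> {..<k}" and yk: "y \<noteq> k" using el y by (auto simp: elimination_def)
  have U: "(\<Union>x\<in>insert k R. U x) = V" and verts: "\<And>z. z \<in> insert k R \<Longrightarrow> verts z \<subseteq> U z"
    and sep: "\<And>z w. z \<in> insert k R \<Longrightarrow> w \<in> insert k R \<Longrightarrow> z \<noteq> w \<Longrightarrow> separated (U z) z (U w) w"
    using el by (auto simp: elimination_def)
  have sepx: "separated (U z) z (U x \<union> U y) x" if z: "z \<in> insert k R" "z \<noteq> x" "z \<noteq> y" for z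
  proof -
    \<comment> \<open>Such an edge makes \<open>z\<close> a neighbour of \<open>y\<close> that is a
      genuine bag, so \<open>only\<close> would identify it with \<open>x\<close>.\<close>
    have noedge: "{u, v} \<notin> E" if "u \<in> U z" "v \<in> U y" for u v
    proof
      assume e: "{u, v} \<in> E"
      then have b: "bag u = z" "bag v = y" using sep[of z y] z y that by (auto simp: separated_def)
      then have "fadj z y" using edge_fadj[OF e] z by simp
      then have "fadj y z" by (rule fadj_sym)
      moreover have "z < k" using bag_less[of u] edgeD(1)[OF e] b by simp
      then have "z \<in> R" using z by auto
      ultimately show False using only z by blast
    qed
    show ?thesis using sep[of z x] sep[of z y] z x y noedge
      unfolding separated_def by blast
  qed
  show ?thesis
    unfolding elimination_def
  proof (intro conjI ballI impI)
    show "R - {y} \<subseteq> {..<k}" using R by auto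
    show "(\<Union>z\<in>insert k (R - {y}). (U(x := U x \<union> U y)) z) = V"
    proof
      show "(\<Union>z\<in>insert k (R - {y}). (U(x := U x \<union> U y)) z) \<subseteq> V"
        using U x y by (auto split: if_splits)
      show "V \<subseteq> (\<Union>z\<in>insert k (R - {y}). (U(x := U x \<union> U y)) z)"
      proof
        fix v assume "v \<in> V"
        then obtain z where z: "z \<in> insert k R" "v \<in> U z" using U by blast
        show "v \<in> (\<Union>z\<in>insert k (R - {y}). (U(x := U x \<union> U y)) z)"
          using z x yk by (intro UN_I[of "if z = y then x else z"]) auto
      qed
    qed
    fix z assume z: "z \<in> insert k (R - {y})"
    show "verts z \<subseteq> (U(x := U x \<union> U y)) z" using verts[of z] z by auto
    fix w assume w: "w \<in> insert k (R - {y})" "z \<noteq> w"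
    have zy: "z \<noteq> y" "w \<noteq> y" "z \<in> insert k R" "w \<in> insert k R" using z w yk by auto
    consider "z = x" | "w = x" | "z \<noteq> x" "w \<noteq> x" by blast
    then show "separated ((U(x := U x \<union> U y)) z) z ((U(x := U x \<union> U y)) w) w"
    proof cases
      case 1
      then show ?thesis using sepx[of w] zy w separated_commute by auto
    next
      case 2
      then show ?thesis using sepx[of z] zy w by auto
    next
      case 3
      then show ?thesis using sep[of z w] zy w by auto
    qed
  qed
qed

lemma elimination_final: "elimination {} U \<Longrightarrow> U k = V"
  by (simp add: elimination_def)

text \<open>Bag \<open>k\<close> has no vertices and its two choices are dummies, so the exemption
  of the open leaf is void and every leaf needs exactly one centre.\<close>

lemma configs_root:
  "(C, L) \<in> configs AC AL V k (n + k) (n + k) 1 \<longleftrightarrow> C \<subseteq> V \<inter> AC \<and> L \<subseteq> V \<inter> AL \<and> star_system E C L"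
proof -
  have L: "L - {n + k} = L" if "L \<subseteq> V \<inter> AL" using that by auto
  have D: "{n + k} \<inter> V = {}" "(n + k < n) = False" by simp_all
  show ?thesis
    unfolding configs_def star_system_def verts_root nbs_def mem_Collect_eq prod.case
    by (cases "L \<subseteq> V \<inter> AL") (simp_all only: L D Int_empty_right if_False simp_thms)
qed

section \<open>The optimum under restrictions on centres and leaves\<close>

lemma opt_ge:
  assumes "star_system E C L" "C \<subseteq> V \<inter> AC" "L \<subseteq> V \<inter> AL"
  shows "card L \<le> opt AC AL"
proof -
  have "(C, L) \<in> configs AC AL V k (n + k) (n + k) 1" using assms configs_root by blast
  then have "Suc (card L) \<le> val (configs AC AL V k (n + k) (n + k) 1)"
    by (intro val_ge finite_configs) simp_all
  then show ?thesis by (simp add: opt_def)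
qed

lemma opt_attained:
  obtains C L where "star_system E C L" "C \<subseteq> V \<inter> AC" "L \<subseteq> V \<inter> AL" "card L = opt AC AL"
proof -
  have "star_system E {} {}" by (simp add: star_system_def)
  then have "configs AC AL V k (n + k) (n + k) 1 \<noteq> {}" using configs_root by blast
  then obtain C L where "(C, L) \<in> configs AC AL V k (n + k) (n + k) 1"
    "val (configs AC AL V k (n + k) (n + k) 1) = Suc (card L)"
    using val_attained[of "configs AC AL V k (n + k) (n + k) 1"] finite_configs[of V] by auto
  then show ?thesis using that[of C L] configs_root by (simp add: opt_def)
qed

lemma opt_mono:
  assumes "AC \<subseteq> AC'" "AL \<subseteq> AL'"
  shows "opt AC AL \<le> opt AC' AL'"
proof -
  obtain C L where "star_system E C L" "C \<subseteq> V \<inter> AC" "L \<subseteq> V \<inter> AL" "card L = opt AC AL"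
    using opt_attained .
  moreover from this assms have "C \<subseteq> V \<inter> AC'" "L \<subseteq> V \<inter> AL'" by auto
  ultimately show ?thesis by (metis opt_ge)
qed

lemma opt_le: "opt AC AL \<le> n"
proof -
  obtain C L where "star_system E C L" "C \<subseteq> V \<inter> AC" "L \<subseteq> V \<inter> AL" "card L = opt AC AL"
    using opt_attained .
  then show ?thesis using card_mono[of V L] by simp
qed

lemma eop_number_eq_opt: "eop_number E = opt V V"
proof -
  obtain C L where "star_system E C L" "C \<subseteq> V" "L \<subseteq> V" "card L = opt V V"
    using opt_attained[of V V] by auto
  then show ?thesis using opt_ge by (intro eop_number_eqI[OF simple]) auto
qed

text \<open>Once no vertex can be dropped from \<open>AL\<close> and then from \<open>AC\<close>, every optimal star system uses all of them.\<close>

lemma minimal_is_optimal: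
  assumes "AC \<subseteq> V" "AL \<subseteq> V" "opt AC AL = eop_number E"
    and AL: "\<And>v. v \<in> AL \<Longrightarrow> opt AC (AL - {v}) < opt AC AL"
    and AC: "\<And>v. v \<in> AC \<Longrightarrow> opt (AC - {v}) AL < opt AC AL"
  shows "max_edge_open_packing E (star_edges E AC AL)"
proof -
  obtain C L where CL: "star_system E C L" "C \<subseteq> V \<inter> AC" "L \<subseteq> V \<inter> AL" "card L = opt AC AL"
    using opt_attained .
  have "L = AL"
  proof (rule ccontr)
    assume "L \<noteq> AL"
    then obtain v where "v \<in> AL" "v \<notin> L" using CL by blast
    then have "card L \<le> opt AC (AL - {v})" using CL by (intro opt_ge) auto
    then show False using AL[OF \<open>v \<in> AL\<close>] CL by simp
  qed
  moreover have "C = AC"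
  proof (rule ccontr)
    assume "C \<noteq> AC"
    then obtain v where "v \<in> AC" "v \<notin> C" using CL by blast
    then have "card L \<le> opt (AC - {v}) AL" using CL by (intro opt_ge) auto
    then show False using AC[OF \<open>v \<in> AC\<close>] CL by simp
  qed
  ultimately show ?thesis
    using CL assms(3) star_edges_packing[OF simple] card_star_edges
    unfolding max_edge_open_packing_def by metis
qed

end

section \<open>The program\<close>

abbreviation "R \<equiv> Reg"

abbreviation Idx :: aexp where
  "Idx \<equiv> Add (Mul (R ''c'') (R ''N'')) (R ''l'')"

text \<open>\<open>dp0\<close> and \<open>dp1\<close> hold the values for \<open>b = 0\<close> and
  \<open>b = 1\<close>, row by row in the centre. Under the shift, 2 means one leaf, 1 means none,
  and 0 means infeasible.\<close>

definition init_entry :: com where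
  "init_entry = Seq (Store ''dp0'' Idx (Const 0)) (Seq (Store ''dp1'' Idx (Const 0))
    (Cond (Conj (Conj (Equal (Arr ''ac'' (R ''c'')) (Const 1)) (Equal (Arr ''al'' (R ''l'')) (Const 1)))
        (Neg (Conj (Equal (R ''c'') (R ''l'')) (Less (R ''c'') (R ''n'')))))
      (Cond (Less (R ''l'') (R ''n''))
        (Cond (Less (R ''c'') (R ''n'')) (Store ''dp1'' Idx (Const 2)) (Store ''dp0'' Idx (Const 2)))
        (Store ''dp1'' Idx (Const 1)))
      Skip))"

definition init_tables :: com where
  "init_tables = For2 ''c'' ''l'' (R ''N'') init_entry"

text \<open>\<open>nb = k\<close> means that no remaining neighbour has been met. As
  \<open>k\<close> is the number of the root, this default is already the right parent for an
  isolated bag.\<close>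

definition scan_neighbour :: com where
  "scan_neighbour = Cond (Conj (Equal (Arr ''done'' (R ''j'')) (Const 0))
      (Equal (Arr ''forest'' (Add (Mul (R ''i'') (R ''k'')) (R ''j''))) (Const 1)))
    (Cond (Equal (R ''nb'') (R ''k'')) (Assign ''nb'' (R ''j'')) (Assign ''bad'' (Const 1)))
    Skip"

text \<open>The search does not stop at a hit: every later leaf overwrites \<open>y\<close> and
  \<open>x\<close>, so the number of rounds is fixed and the last leaf wins.\<close>

definition test_leaf :: com where
  "test_leaf = Cond (Equal (Arr ''done'' (R ''i'')) (Const 0))
    (Seq (Assign ''nb'' (R ''k'')) (Seq (Assign ''bad'' (Const 0))
      (Seq (For ''j'' (R ''k'') scan_neighbour)
        (Cond (Equal (R ''bad'') (Const 0))
          (Seq (Assign ''y'' (R ''i'')) (Assign ''x'' (R ''nb'')))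
          Skip))))
    Skip"

definition find_leaf :: com where
  "find_leaf = For ''i'' (R ''k'') test_leaf"

definition mark_edge :: com where
  "mark_edge = Cond (Conj (Equal (Arr ''graph'' (Add (Mul (R ''u'') (R ''n'')) (R ''v''))) (Const 1))
      (Conj (Equal (Arr ''bag'' (R ''u'')) (R ''y'')) (Equal (Arr ''bag'' (R ''v'')) (R ''x''))))
    (Seq (Store ''mark'' (R ''u'') (Const 1)) (Store ''mark'' (R ''v'') (Const 1)))
    Skip"

definition set_marks :: com where
  "set_marks = Seq (For ''v'' (R ''N'') (Store ''mark'' (R ''v'') (Const 0)))
    (For2 ''u'' ''v'' (R ''n'') mark_edge)"

text \<open>The addition of a truncated difference computes a maximum.\<close>

definition update_message :: "nat \<Rightarrow> nat \<Rightarrow> com" where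
  "update_message a b =
    Cond (Conj (Equal (Mul (Const a) (Arr ''mark'' (R ''c''))) (Const 0))
        (Equal (Mul (Const b) (Arr ''mark'' (R ''l''))) (Const 0)))
      (Seq (Assign ''q'' (Add (Const (4 * a + 2 * b)) (Mul (Const b) (Arr ''mark'' (R ''c'')))))
        (Seq (Cond (Equal (Mul (Const a) (Arr ''mark'' (R ''l''))) (Const 0))
            (Assign ''w'' (Arr ''dp1'' Idx)) (Assign ''w'' (Arr ''dp0'' Idx)))
          (Store ''m'' (R ''q'') (Add (Arr ''m'' (R ''q'')) (Sub (R ''w'') (Arr ''m'' (R ''q'')))))))
      Skip"

definition update_messages :: com where
  "update_messages =
    Cond (Conj (Equal (Arr ''bag'' (R ''c'')) (R ''y'')) (Equal (Arr ''bag'' (R ''l'')) (R ''y'')))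
      (Seq (update_message 0 0) (Seq (update_message 0 1)
        (Seq (update_message 1 0) (update_message 1 1))))
      Skip"

definition compute_messages :: com where
  "compute_messages = Seq (For ''i'' (Const 8) (Store ''m'' (R ''i'') (Const 0)))
    (For2 ''c'' ''l'' (R ''N'') update_messages)"

text \<open>Branch-free form of \<open>comb\<close>: under truncated subtraction,
  \<open>1 - (1 - e)\<close> is 0 for \<open>e = 0\<close> and 1 otherwise.\<close>

definition Comb :: "aexp \<Rightarrow> aexp \<Rightarrow> aexp" where
  "Comb e f = Mul (Sub (Add e f) (Const 1))
     (Mul (Sub (Const 1) (Sub (Const 1) e)) (Sub (Const 1) (Sub (Const 1) f)))"

text \<open>The table is updated in place. Both candidates for the new \<open>dp1\<close> are saved
  in \<open>e\<close> and \<open>f\<close> first, because \<open>f\<close> needs the old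
  \<open>dp0\<close>.\<close>

definition update_entry :: com where
  "update_entry =
    Cond (Conj (Equal (Arr ''bag'' (R ''c'')) (R ''x'')) (Equal (Arr ''bag'' (R ''l'')) (R ''x'')))
      (Seq (Assign ''q'' (Add (Mul (Const 4) (Arr ''mark'' (R ''c''))) (Mul (Const 2) (Arr ''mark'' (R ''l'')))))
        (Seq (Assign ''e'' (Comb (Arr ''dp1'' Idx) (Arr ''m'' (R ''q''))))
          (Seq (Assign ''f'' (Comb (Arr ''dp0'' Idx) (Arr ''m'' (Add (R ''q'') (Const 1)))))
            (Seq (Store ''dp0'' Idx (Comb (Arr ''dp0'' Idx) (Arr ''m'' (R ''q''))))
              (Store ''dp1'' Idx (Add (R ''e'') (Sub (R ''f'') (R ''e''))))))))
      Skip"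

definition update_tables :: com where
  "update_tables = For2 ''c'' ''l'' (R ''N'') update_entry"

definition eliminate_leaf :: com where
  "eliminate_leaf = Seq find_leaf (Seq set_marks (Seq compute_messages (Seq update_tables
    (Store ''done'' (R ''y'') (Const 1)))))"

definition solve :: com where
  "solve = Seq (For ''i'' (R ''k'') (Store ''done'' (R ''i'') (Const 0)))
    (Seq init_tables (Seq (For ''it'' (R ''k'') eliminate_leaf)
      (Assign ''val'' (Sub (Arr ''dp1'' (Add (Mul (Add (R ''n'') (R ''k'')) (R ''N'')) (Add (R ''n'') (R ''k''))))
        (Const 1)))))"

text \<open>The register \<open>result\<close> keeps the unrestricted optimum throughout, so a drop
  of \<open>val\<close> below it shows that the vertex is still needed.\<close>

definition prune_vertex :: "string \<Rightarrow> com" where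
  "prune_vertex a = Seq (Store a (R ''p'') (Const 0)) (Seq solve
    (Cond (Less (R ''val'') (R ''result'')) (Store a (R ''p'') (Const 1)) Skip))"

definition prune :: "string \<Rightarrow> com" where
  "prune a = For ''p'' (R ''n'') (prune_vertex a)"

text \<open>The doubly negated conjunction is a disjunction by De Morgan: either end may be the
  centre.\<close>

definition output_edge :: com where
  "output_edge =
    Cond (Conj (Equal (Arr ''graph'' (Add (Mul (R ''u'') (R ''n'')) (R ''v''))) (Const 1))
        (Neg (Conj
          (Neg (Conj (Equal (Arr ''ac'' (R ''u'')) (Const 1)) (Equal (Arr ''al'' (R ''v'')) (Const 1))))
          (Neg (Conj (Equal (Arr ''ac'' (R ''v'')) (Const 1)) (Equal (Arr ''al'' (R ''u'')) (Const 1)))))))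
      (Store ''result'' (Add (Mul (R ''u'') (R ''n'')) (R ''v'')) (Const 1))
      Skip"

definition output_edges :: com where
  "output_edges = For2 ''u'' ''v'' (R ''n'') output_edge"

definition eop_program :: com where
  "eop_program = Seq (Assign ''N'' (Add (Add (R ''n'') (R ''k'')) (Const 1)))
    (Seq (For ''i'' (Add (R ''k'') (Const 1)) (Store ''bag'' (Add (R ''n'') (R ''i'')) (R ''i'')))
      (Seq (For ''v'' (R ''N'') (Seq (Store ''ac'' (R ''v'') (Const 1)) (Store ''al'' (R ''v'') (Const 1))))
        (Seq solve (Seq (Assign ''result'' (R ''val''))
          (Seq (prune ''al'') (Seq (prune ''ac'') output_edges))))))"

section \<open>Registers and arrays that each subprogram may change\<close>

lemma mods_init_entry [simp]:
  "set (mr init_entry) = {}"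
  "set (ma init_entry) = {''dp0'', ''dp1''}"
  unfolding init_entry_def by (simp_all add: insert_commute)

lemma mods_init_tables [simp]:
  "set (mr init_tables) = {''c'', ''l''}"
  "set (ma init_tables) = {''dp0'', ''dp1''}"
  unfolding init_tables_def by (simp_all add: insert_commute)

lemma mods_scan_neighbour [simp]:
  "set (mr scan_neighbour) = {''nb'', ''bad''}"
  "set (ma scan_neighbour) = {}"
  unfolding scan_neighbour_def by (simp_all add: insert_commute)

lemma mods_test_leaf [simp]:
  "set (mr test_leaf) = {''j'', ''nb'', ''bad'', ''x'', ''y''}"
  "set (ma test_leaf) = {}"
  unfolding test_leaf_def by (simp_all add: insert_commute)

lemma mods_find_leaf [simp]:
  "set (mr find_leaf) = {''i'', ''j'', ''nb'', ''bad'', ''x'', ''y''}"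
  "set (ma find_leaf) = {}"
  unfolding find_leaf_def by (simp_all add: insert_commute)

lemma mods_mark_edge [simp]:
  "set (mr mark_edge) = {}"
  "set (ma mark_edge) = {''mark''}"
  unfolding mark_edge_def by (simp_all add: insert_commute)

lemma mods_set_marks [simp]:
  "set (mr set_marks) = {''u'', ''v''}"
  "set (ma set_marks) = {''mark''}"
  unfolding set_marks_def by (simp_all add: insert_commute)

lemma mods_update_message [simp]:
  "set (mr (update_message a b)) = {''q'', ''w''}"
  "set (ma (update_message a b)) = {''m''}"
  unfolding update_message_def by (simp_all add: insert_commute)

lemma mods_update_messages [simp]:
  "set (mr update_messages) = {''q'', ''w''}"
  "set (ma update_messages) = {''m''}"
  unfolding update_messages_def by (simp_all add: insert_commute)

lemma mods_compute_messages [simp]: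
  "set (mr compute_messages) = {''i'', ''c'', ''l'', ''q'', ''w''}"
  "set (ma compute_messages) = {''m''}"
  unfolding compute_messages_def by (simp_all add: insert_commute)

lemma mods_update_entry [simp]:
  "set (mr update_entry) = {''q'', ''e'', ''f''}"
  "set (ma update_entry) = {''dp0'', ''dp1''}"
  unfolding update_entry_def by (simp_all add: insert_commute)

lemma mods_update_tables [simp]:
  "set (mr update_tables) = {''c'', ''l'', ''q'', ''e'', ''f''}"
  "set (ma update_tables) = {''dp0'', ''dp1''}"
  unfolding update_tables_def by (simp_all add: insert_commute)

lemma mods_eliminate_leaf [simp]:
  "set (mr eliminate_leaf) = {''i'', ''j'', ''nb'', ''bad'', ''x'', ''y'', ''u'', ''v'', ''c'', ''l'', ''q'', ''w'', ''e'', ''f''}"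
  "set (ma eliminate_leaf) = {''done'', ''dp0'', ''dp1'', ''mark'', ''m''}"
  unfolding eliminate_leaf_def by (simp_all add: insert_commute)

lemma mods_solve [simp]:
  "set (mr solve) = {''i'', ''j'', ''nb'', ''bad'', ''x'', ''y'', ''u'', ''v'', ''c'', ''l'', ''q'', ''w'', ''e'', ''f'', ''it'', ''val''}"
  "set (ma solve) = {''done'', ''dp0'', ''dp1'', ''mark'', ''m''}"
  unfolding solve_def by (simp_all add: insert_commute)

lemma mods_prune_vertex [simp]:
  "set (mr (prune_vertex a)) = {''i'', ''j'', ''nb'', ''bad'', ''x'', ''y'', ''u'', ''v'', ''c'', ''l'', ''q'', ''w'', ''e'', ''f'', ''it'', ''val''}"
  "set (ma (prune_vertex a)) = {a, ''done'', ''dp0'', ''dp1'', ''mark'', ''m''}"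
  unfolding prune_vertex_def by (simp_all add: insert_commute)

lemma mods_prune [simp]:
  "set (mr (prune a)) = {''p'', ''i'', ''j'', ''nb'', ''bad'', ''x'', ''y'', ''u'', ''v'', ''c'', ''l'', ''q'', ''w'', ''e'', ''f'', ''it'', ''val''}"
  "set (ma (prune a)) = {a, ''done'', ''dp0'', ''dp1'', ''mark'', ''m''}"
  unfolding prune_def by (simp_all add: insert_commute)

lemma mods_output_edge [simp]:
  "set (mr output_edge) = {}"
  "set (ma output_edge) = {''result''}"
  unfolding output_edge_def by (simp_all add: insert_commute)

lemma mods_output_edges [simp]:
  "set (mr output_edges) = {''u'', ''v''}"
  "set (ma output_edges) = {''result''}"
  unfolding output_edges_def by (simp_all add: insert_commute)

section \<open>Arithmetic of the encodings\<close>

lemma aval_Comb [simp]: "aval (Comb e f) s = comb (aval e s) (aval f s)"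
  by (auto simp: Comb_def comb_def)

lemma of_bool_eq_Suc_0_iff [simp]: "of_bool P = Suc 0 \<longleftrightarrow> P"
  by simp

lemma comb_le: "comb a b \<le> a + b"
  by (simp add: comb_def)

lemma row_index_eq_iff:
  assumes "l < m" "l' < m"
  shows "c * m + l = c' * m + l' \<longleftrightarrow> c = c' \<and> l = (l'::nat)"
proof
  assume e: "c * m + l = c' * m + l'"
  have "(c * m + l) div m = c" "(c' * m + l') div m = c'" using assms by simp_all
  with e show "c = c' \<and> l = l'" by simp
qed simp

text \<open>The three bits are recovered as the binary digits of the index.\<close>

lemma message_index_eq_iff:
  fixes a b z :: nat
  assumes "a < 2" "b < 2" "z < 2" "a' < 2" "b' < 2" "z' < 2"
  shows "4 * a + 2 * b + z = 4 * a' + 2 * b' + z' \<longleftrightarrow> a = a' \<and> b = b' \<and> z = z'"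
proof -
  have digits: "z = (4 * a + 2 * b + z) mod 2 \<and> b = (4 * a + 2 * b + z) div 2 mod 2 \<and> a = (4 * a + 2 * b + z) div 4"
    if "a < 2" "b < 2" "z < 2" for a b z :: nat
    using that by (auto simp: less_2_cases_iff)
  show ?thesis
    using digits[OF assms(1-3)] digits[OF assms(4-6)] by metis
qed

text \<open>\<open>2 * n + 8\<close> rounds cover both \<open>N \<le> 2 * n + 1\<close> and the
  eight message cells. Table and message values are at most \<open>n + 1\<close>, their combinations
  at most \<open>2 * n + 2\<close>, and message indices at most 7, so \<open>4 * n + 10\<close>
  leaves room for every stored number.\<close>

locale algo = bag_graph n k E bag fadj + ram W "2 * n + 8" "4 * n + 10"
  for n k :: nat and E :: "nat set set" and bag :: "nat \<Rightarrow> nat" and fadj :: "nat \<Rightarrow> nat \<Rightarrow> bool" and W :: nat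
begin

lemma N_bounds: "N \<le> 2 * n + 1" "n \<le> N" "k \<le> N" "n + k < N"
  using k_le by (simp_all add: N_def)

definition base :: "state \<Rightarrow> bool" where
  "base s \<longleftrightarrow> regs s ''n'' = n \<and> regs s ''k'' = k \<and> regs s ''N'' = N \<and>
     (\<forall>u<n. \<forall>v<n. arrs s ''graph'' (u * n + v) = of_bool ({u, v} \<in> E)) \<and>
     (\<forall>v<N. arrs s ''bag'' v = bag v) \<and>
     (\<forall>i<k. \<forall>j<k. arrs s ''forest'' (i * k + j) = of_bool (fadj i j))"

lemma baseD:
  assumes "base s"
  shows "regs s ''n'' = n" "regs s ''k'' = k" "regs s ''N'' = N"
    "u < n \<Longrightarrow> v < n \<Longrightarrow> arrs s ''graph'' (u * n + v) = of_bool ({u, v} \<in> E)"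
    "w < N \<Longrightarrow> arrs s ''bag'' w = bag w"
    "i < k \<Longrightarrow> j < k \<Longrightarrow> arrs s ''forest'' (i * k + j) = of_bool (fadj i j)"
  using assms by (auto simp: base_def)

lemma base_frame:
  assumes "base s" "frame c s s'"
    and "{''n'', ''k'', ''N''} \<inter> set (mr c) = {}" "{''graph'', ''bag'', ''forest''} \<inter> set (ma c) = {}"
  shows "base s'"
  using assms unfolding base_def by (simp add: frame_regs[OF assms(2)] frame_arrs[OF assms(2)])

lemma base_setr [simp]: "x \<notin> {''n'', ''k'', ''N''} \<Longrightarrow> base (setr x v s) = base s"
  by (auto simp: base_def)

text \<open>Dummies are always allowed, so choosing no vertex never needs a test of its own.\<close>

definition allowed :: "string \<Rightarrow> nat set \<Rightarrow> state \<Rightarrow> bool" where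
  "allowed a A s \<longleftrightarrow> (\<forall>v<N. arrs s a v = of_bool (v < n \<longrightarrow> v \<in> A))"

text \<open>\<open>D\<close> selects the entries that carry meaning; entries of merged bags, or with
  choices from different bags, may be stale.\<close>

definition tables :: "(nat \<Rightarrow> nat \<Rightarrow> bool) \<Rightarrow> (nat \<Rightarrow> nat \<Rightarrow> nat \<Rightarrow> nat) \<Rightarrow> state \<Rightarrow> bool" where
  "tables D G s \<longleftrightarrow> (\<forall>c<N. \<forall>l<N. D c l \<longrightarrow>
     arrs s ''dp0'' (c * N + l) = G c l 0 \<and> arrs s ''dp1'' (c * N + l) = G c l 1)"

lemma tables_update:
  assumes t: "tables D G s" and ij: "i < N" "j < N"
    and new: "D' i j \<Longrightarrow> arrs s' ''dp0'' (i * N + j) = G' i j 0 \<and> arrs s' ''dp1'' (i * N + j) = G' i j 1"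
    and old: "\<And>q. q \<noteq> i * N + j \<Longrightarrow> arrs s' ''dp0'' q = arrs s ''dp0'' q \<and> arrs s' ''dp1'' q = arrs s ''dp1'' q"
    and D: "\<And>c l. (c, l) \<noteq> (i, j) \<Longrightarrow> D' c l \<Longrightarrow> D c l \<and> G' c l = G c l"
  shows "tables D' G' s'"
  unfolding tables_def
proof (intro allI impI)
  fix c l assume cl: "c < N" "l < N" "D' c l"
  show "arrs s' ''dp0'' (c * N + l) = G' c l 0 \<and> arrs s' ''dp1'' (c * N + l) = G' c l 1"
  proof (cases "(c, l) = (i, j)")
    case True
    then show ?thesis using new cl by simp
  next
    case False
    then have "c * N + l \<noteq> i * N + j" using row_index_eq_iff cl ij by auto
    then show ?thesis using old D[OF False cl(3)] t cl by (simp add: tables_def)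
  qed
qed

lemma wp_init_tables:
  assumes b: "base s" and ac: "allowed ''ac'' AC s" and al: "allowed ''al'' AL s"
  shows "wp init_tables s (tables (\<lambda>c l. True) (base_val AC AL))"
  unfolding init_tables_def
proof (rule wp_For2[where m = N and I = "\<lambda>S. tables (\<lambda>c l. (c, l) \<in> S) (base_val AC AL)"])
  fix s' assume "frame (For2 ''c'' ''l'' (R ''N'') init_entry) s s'"
  then have "base s'" by (rule base_frame[OF b]) simp_all
  then show "aval (R ''N'') s' = N" by (simp add: baseD)
next
  fix i j S s'
  assume ij: "i < N" "j < N" and r: "regs s' ''c'' = i" "regs s' ''l'' = j"
    and fr: "frame (For2 ''c'' ''l'' (R ''N'') init_entry) s s'"
    and I: "tables (\<lambda>c l. (c, l) \<in> S) (base_val AC AL) s'"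
  have b': "base s'" by (rule base_frame[OF b fr]) simp_all
  have acal: "arrs s' ''ac'' i = of_bool (i < n \<longrightarrow> i \<in> AC)" "arrs s' ''al'' j = of_bool (j < n \<longrightarrow> j \<in> AL)"
    using ac al ij frame_arrs[OF fr, of "''ac''"] frame_arrs[OF fr, of "''al''"]
    by (simp_all add: allowed_def)
  show "wp init_entry s' (tables (\<lambda>c l. (c, l) \<in> insert (i, j) S) (base_val AC AL))"
    unfolding init_entry_def
    by (intro wp_Seq wp_Cond wp_Store wp_Skip tables_update[OF I ij];
      simp add: r baseD(1-3)[OF b'] acal; (auto simp: base_val_def)?)
qed (use N_bounds in \<open>simp_all add: tables_def\<close>)

section \<open>Search for a leaf of the remaining forest\<close>

definition remaining :: "state \<Rightarrow> nat set" where
  "remaining s = {j. j < k \<and> arrs s ''done'' j = 0}"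

definition leafy :: "nat set \<Rightarrow> nat \<Rightarrow> bool" where
  "leafy A i \<longleftrightarrow> (\<forall>z1\<in>A. \<forall>z2\<in>A. fadj i z1 \<longrightarrow> fadj i z2 \<longrightarrow> z1 = z2)"

text \<open>Sets \<open>A\<close> of remaining bags do not contain \<open>k\<close>, so
  \<open>x = k\<close> says that \<open>y\<close> has no neighbour in \<open>A\<close>.\<close>

definition leaf_with_parent :: "nat set \<Rightarrow> nat \<Rightarrow> nat \<Rightarrow> bool" where
  "leaf_with_parent A y x \<longleftrightarrow> y \<in> A \<and> (x = k \<or> x \<in> A \<and> fadj y x) \<and> (\<forall>z\<in>A. fadj y z \<longrightarrow> z = x)"

lemma wp_test_leaf:
  assumes b: "base s" and i: "regs s ''i'' = i" "i < k" and A: "A = remaining s"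
    and post: "\<And>s'. frame test_leaf s s' \<Longrightarrow>
      (i \<in> A \<longrightarrow> leafy A i \<longrightarrow> leaf_with_parent A (regs s' ''y'') (regs s' ''x'')) \<Longrightarrow>
      (leaf_with_parent A (regs s ''y'') (regs s ''x'') \<longrightarrow> leaf_with_parent A (regs s' ''y'') (regs s' ''x'')) \<Longrightarrow> Q s'"
  shows "wp test_leaf s Q"
proof (rule wp_mono[OF _ post])
  let ?P = "\<lambda>s' :: state. (i \<in> A \<longrightarrow> leafy A i \<longrightarrow> leaf_with_parent A (regs s' ''y'') (regs s' ''x'')) \<and>
    (leaf_with_parent A (regs s ''y'') (regs s ''x'') \<longrightarrow> leaf_with_parent A (regs s' ''y'') (regs s' ''x''))"
  \<comment> \<open>As long as \<open>bad\<close> is 0, \<open>nb\<close> is the only remaining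
    neighbour scanned, or \<open>k\<close> if there was none; a second neighbour refutes
    \<open>leafy\<close> for good.\<close>
  define J where "J j s' \<longleftrightarrow>
    regs s' ''bad'' = 0 \<and> (\<forall>z<j. z \<in> A \<longrightarrow> fadj i z \<longrightarrow> z = regs s' ''nb'') \<and>
      (regs s' ''nb'' = k \<or> regs s' ''nb'' < j \<and> regs s' ''nb'' \<in> A \<and> fadj i (regs s' ''nb'')) \<or>
    regs s' ''bad'' = 1 \<and> \<not> leafy A i" for j and s' :: state
  let ?s0 = "setr ''bad'' 0 (setr ''nb'' k s)"
  have loop: "wp (For ''j'' (R ''k'') scan_neighbour) ?s0 (J k)"
  proof (rule wp_For[where m = k and I = J])
    fix s' :: state assume "frame (For ''j'' (R ''k'') scan_neighbour) ?s0 s'"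
    from frame_regs[OF this, of "''k''"] show "aval (R ''k'') s' = k" by (simp add: baseD[OF b])
  next
    fix j and s' :: state assume j: "j < k" "regs s' ''j'' = j" and fr: "frame (For ''j'' (R ''k'') scan_neighbour) ?s0 s'"
      and I: "J j s'"
    have r: "regs s' ''i'' = i" "regs s' ''k'' = k"
      using frame_regs[OF fr, of "''i''"] frame_regs[OF fr, of "''k''"] i by (simp_all add: baseD[OF b])
    have a: "arrs s' ''done'' j = 0 \<longleftrightarrow> j \<in> A" "arrs s' ''forest'' (i * k + j) = of_bool (fadj i j)"
      using frame_arrs[OF fr, of "''done''"] frame_arrs[OF fr, of "''forest''"] i j
      by (simp_all add: baseD[OF b] A remaining_def)
    show "wp scan_neighbour s' (J (Suc j))"
    proof (cases "j \<in> A \<and> fadj i j")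
      case nbr: True
      show ?thesis
      proof (cases "regs s' ''nb'' = k")
        case True
        then have "J (Suc j) (setr ''nb'' j s')"
          using I nbr j unfolding J_def by (auto simp: less_Suc_eq)
        then show ?thesis unfolding scan_neighbour_def using j
          by (intro wp_Cond wp_Assign) (use k_le in \<open>simp_all add: r a nbr True\<close>)
      next
        case False
        have "\<not> leafy A i" using I False nbr unfolding J_def leafy_def by blast
        then have "J (Suc j) (setr ''bad'' 1 s')" unfolding J_def by simp
        then show ?thesis unfolding scan_neighbour_def
          by (intro wp_Cond wp_Assign) (simp_all add: r a nbr False j)
      qed
    next
      case False
      then have "J (Suc j) s'" using I unfolding J_def by (auto simp: less_Suc_eq)
      then show ?thesis unfolding scan_neighbour_def using False
        by (intro wp_Cond wp_Assign wp_Skip) (simp_all add: r a j)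
    qed
  qed (use k_le in \<open>simp_all add: J_def\<close>)
  have fin: "wp (Cond (Equal (R ''bad'') (Const 0)) (Seq (Assign ''y'' (R ''i'')) (Assign ''x'' (R ''nb''))) Skip) s' ?P"
    if fr: "frame (For ''j'' (R ''k'') scan_neighbour) ?s0 s'" and I: "J k s'" and iA: "i \<in> A" for s'
  proof -
    have r: "regs s' ''i'' = i" "regs s' ''y'' = regs s ''y''" "regs s' ''x'' = regs s ''x''"
      using frame_regs[OF fr] i by simp_all
    show ?thesis
    proof (cases "regs s' ''bad'' = 0")
      case True
      then have nb: "\<And>z. z < k \<Longrightarrow> z \<in> A \<Longrightarrow> fadj i z \<Longrightarrow> z = regs s' ''nb''"
        "regs s' ''nb'' = k \<or> regs s' ''nb'' \<in> A \<and> fadj i (regs s' ''nb'')" using I by (auto simp: J_def)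
      moreover have "\<And>z. z \<in> A \<Longrightarrow> z < k" by (simp add: A remaining_def)
      ultimately have "leaf_with_parent A i (regs s' ''nb'')" using iA unfolding leaf_with_parent_def by blast
      moreover have "regs s' ''nb'' \<le> k" using nb(2) by (auto simp: A remaining_def)
      ultimately show ?thesis using True i k_le
        by (intro wp_Cond wp_Seq wp_Assign wp_Skip) (simp_all add: r)
    next
      case False
      then have "\<not> leafy A i" using I by (simp add: J_def)
      then show ?thesis using False
        by (intro wp_Cond wp_Seq wp_Assign wp_Skip) (simp_all add: r)
    qed
  qed
  show "wp test_leaf s ?P"
    unfolding test_leaf_def
  proof (rule wp_Cond)
    assume "bval (Equal (Arr ''done'' (R ''i'')) (Const 0)) s"
    then have iA: "i \<in> A" using i by (simp add: A remaining_def)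
    show "wp (Seq (Assign ''nb'' (R ''k'')) (Seq (Assign ''bad'' (Const 0)) (Seq (For ''j'' (R ''k'') scan_neighbour)
        (Cond (Equal (R ''bad'') (Const 0)) (Seq (Assign ''y'' (R ''i'')) (Assign ''x'' (R ''nb''))) Skip)))) s ?P"
    proof (rule wp_Seq, rule wp_Assign, goal_cases)
      case 2
      show ?case
        by (rule wp_Seq, rule wp_Assign, simp, rule wp_Seq, rule wp_mono[OF _ fin])
          (use loop iA in \<open>simp_all add: baseD[OF b]\<close>)
    qed (use k_le in \<open>simp add: baseD[OF b]\<close>)
  next
    assume "\<not> bval (Equal (Arr ''done'' (R ''i'')) (Const 0)) s"
    then have "i \<notin> A" using i by (simp add: A remaining_def)
    then show "wp Skip s ?P" by (intro wp_Skip) simp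
  qed
qed blast+

text \<open>The invariant promises a result only once a leaf has been scanned; acyclicity, in the
  form of \<open>leaf_exists\<close>, discharges this condition at the end.\<close>

lemma wp_find_leaf:
  assumes b: "base s" and A: "A = remaining s" "A \<noteq> {}"
  shows "wp find_leaf s (\<lambda>s'. leaf_with_parent A (regs s' ''y'') (regs s' ''x''))"
  unfolding find_leaf_def
proof (rule wp_For[where m = k and
      I = "\<lambda>i s'. (\<exists>j<i. j \<in> A \<and> leafy A j) \<longrightarrow> leaf_with_parent A (regs s' ''y'') (regs s' ''x'')"])
  fix s' :: state assume "frame (For ''i'' (R ''k'') test_leaf) s s'"
  from frame_regs[OF this, of "''k''"] show "aval (R ''k'') s' = k" by (simp add: baseD[OF b])
next
  fix i and s' :: state assume i: "i < k" "regs s' ''i'' = i" and fr: "frame (For ''i'' (R ''k'') test_leaf) s s'"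
    and I: "(\<exists>j<i. j \<in> A \<and> leafy A j) \<longrightarrow> leaf_with_parent A (regs s' ''y'') (regs s' ''x'')"
  have b': "base s'" by (rule base_frame[OF b fr]) simp_all
  have A': "A = remaining s'" using frame_arrs[OF fr, of "''done''"] A by (simp add: remaining_def)
  show "wp test_leaf s' (\<lambda>s'. (\<exists>j<Suc i. j \<in> A \<and> leafy A j) \<longrightarrow> leaf_with_parent A (regs s' ''y'') (regs s' ''x''))"
    by (rule wp_test_leaf[OF b' i(2,1) A']) (use I in \<open>auto simp: less_Suc_eq\<close>)
next
  fix s' :: state assume I: "(\<exists>j<k. j \<in> A \<and> leafy A j) \<longrightarrow> leaf_with_parent A (regs s' ''y'') (regs s' ''x'')"
  have "A \<subseteq> {..<k}" by (auto simp: A remaining_def)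
  then obtain y where "y \<in> A" "leafy A y" using leaf_exists[of A] A(2) unfolding leafy_def by blast
  then show "leaf_with_parent A (regs s' ''y'') (regs s' ''x'')" using I \<open>A \<subseteq> {..<k}\<close> by blast
qed (use k_le in simp_all)

section \<open>Marks and messages along the current tree edge\<close>

lemma wp_set_marks:
  assumes b: "base s" and xy: "regs s ''x'' = x" "regs s ''y'' = y"
  shows "wp set_marks s (\<lambda>s'. \<forall>v<N. arrs s' ''mark'' v = mark x y v)"
  unfolding set_marks_def
proof (rule wp_Seq, rule wp_For[where m = N and I = "\<lambda>i s'. \<forall>v<i. arrs s' ''mark'' v = 0"])
  let ?clear = "For ''v'' (R ''N'') (Store ''mark'' (R ''v'') (Const 0))"
  fix s' :: state assume "frame ?clear s s'"
  from frame_regs[OF this, of "''N''"] show "aval (R ''N'') s' = N" by (simp add: baseD[OF b])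
next
  fix i and s' :: state assume "regs s' ''v'' = i" "\<forall>v<i. arrs s' ''mark'' v = 0"
  then show "wp (Store ''mark'' (R ''v'') (Const 0)) s' (\<lambda>s'. \<forall>v<Suc i. arrs s' ''mark'' v = 0)"
    by (intro wp_Store) (auto simp: less_Suc_eq)
next
  let ?clear = "For ''v'' (R ''N'') (Store ''mark'' (R ''v'') (Const 0))"
  fix s1 :: state assume 0: "\<forall>v<N. arrs s1 ''mark'' v = 0" and fr1: "frame ?clear s s1"
  have b1: "base s1" by (rule base_frame[OF b fr1]) simp_all
  have xy1: "regs s1 ''x'' = x" "regs s1 ''y'' = y" using frame_regs[OF fr1] xy by simp_all
  define hit where "hit u v \<longleftrightarrow> {u, v} \<in> E \<and> bag u = y \<and> bag v = x" for u v
  define I where "I S s' \<longleftrightarrow> (\<forall>w<N. arrs s' ''mark'' w = of_bool (\<exists>u v. (u, v) \<in> S \<and> hit u v \<and> (w = u \<or> w = v)))"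
    for S :: "(nat \<times> nat) set" and s' :: state
  show "wp (For2 ''u'' ''v'' (R ''n'') mark_edge) s1 (\<lambda>s'. \<forall>v<N. arrs s' ''mark'' v = mark x y v)"
  proof (rule wp_For2[where m = n and I = I])
    fix s' :: state assume "frame (For2 ''u'' ''v'' (R ''n'') mark_edge) s1 s'"
    from frame_regs[OF this, of "''n''"] show "aval (R ''n'') s' = n" by (simp add: baseD[OF b1])
  next
    fix i j S and s' :: state assume ij: "i < n" "j < n" and r: "regs s' ''u'' = i" "regs s' ''v'' = j"
      and fr: "frame (For2 ''u'' ''v'' (R ''n'') mark_edge) s1 s'" and I: "I S s'"
    have b': "base s'" by (rule base_frame[OF b1 fr]) simp_all
    have xy': "regs s' ''x'' = x" "regs s' ''y'' = y" using frame_regs[OF fr] xy1 by simp_all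
    have ijN: "i < N" "j < N" using ij N_bounds by simp_all
    show "wp mark_edge s' (I (insert (i, j) S))"
    proof (cases "hit i j")
      case True
      then have "I (insert (i, j) S) (seta ''mark'' j 1 (seta ''mark'' i 1 s'))"
      proof -
        have "(\<exists>u v. (u, v) \<in> insert (i, j) S \<and> hit u v \<and> (w = u \<or> w = v)) \<longleftrightarrow>
          w = i \<or> w = j \<or> (\<exists>u v. (u, v) \<in> S \<and> hit u v \<and> (w = u \<or> w = v))" for w
          using True by blast
        then show ?thesis using I unfolding I_def by simp
      qed
      then show ?thesis unfolding mark_edge_def using True ij ijN
        by (intro wp_Cond wp_Seq wp_Store wp_Skip) (simp_all add: r xy' baseD[OF b'] hit_def)
    next
      case False
      then have "(\<exists>u v. (u, v) \<in> insert (i, j) S \<and> hit u v \<and> (w = u \<or> w = v)) \<longleftrightarrow>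
          (\<exists>u v. (u, v) \<in> S \<and> hit u v \<and> (w = u \<or> w = v))" for w
        by blast
      then have "I (insert (i, j) S) s'" using I unfolding I_def by simp
      then show ?thesis unfolding mark_edge_def using False ij ijN
        by (intro wp_Cond wp_Seq wp_Store wp_Skip) (simp_all add: r xy' baseD[OF b'] hit_def)
    qed
  next
    fix s' :: state assume I: "I ({..<n} \<times> {..<n}) s'"
    \<comment> \<open>Both orders of every pair are visited, so it is enough that a hit is
      recognised with \<open>u\<close> in bag \<open>y\<close>.\<close>
    have "(\<exists>u v. (u, v) \<in> {..<n} \<times> {..<n} \<and> hit u v \<and> (w = u \<or> w = v)) \<longleftrightarrow>
      (\<exists>v. {w, v} \<in> E \<and> (bag w = x \<and> bag v = y \<or> bag w = y \<and> bag v = x))" for w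
    proof
      assume "\<exists>u v. (u, v) \<in> {..<n} \<times> {..<n} \<and> hit u v \<and> (w = u \<or> w = v)"
      then obtain u v where h: "{u, v} \<in> E" "bag u = y" "bag v = x" "w = u \<or> w = v"
        unfolding hit_def by blast
      moreover have "{v, u} \<in> E" using h(1) by (simp add: insert_commute)
      ultimately show "\<exists>v. {w, v} \<in> E \<and> (bag w = x \<and> bag v = y \<or> bag w = y \<and> bag v = x)" by blast
    next
      assume "\<exists>v. {w, v} \<in> E \<and> (bag w = x \<and> bag v = y \<or> bag w = y \<and> bag v = x)"
      then obtain v where h: "{w, v} \<in> E" "bag w = x \<and> bag v = y \<or> bag w = y \<and> bag v = x" by blast
      moreover have "{v, w} \<in> E" using h(1) by (simp add: insert_commute)
      moreover have "w < n" "v < n" using edgeD[OF h(1)] by simp_all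
      ultimately show "\<exists>u v. (u, v) \<in> {..<n} \<times> {..<n} \<and> hit u v \<and> (w = u \<or> w = v)"
        unfolding hit_def by blast
    qed
    then show "\<forall>v<N. arrs s' ''mark'' v = mark x y v" using I unfolding I_def mark_def by simp
  qed (use N_bounds 0 in \<open>simp_all add: I_def\<close>)
qed (use N_bounds in simp_all)

lemma remaining_setr [simp]: "remaining (setr x v s) = remaining s"
  by (simp add: remaining_def)

lemma tables_setr [simp]: "tables D G (setr x v s) = tables D G s"
  by (simp add: tables_def)

lemma allowed_setr [simp]: "allowed a A (setr x v s) = allowed a A s"
  by (simp add: allowed_def)

definition message_table :: "(nat \<Rightarrow> nat \<Rightarrow> nat \<Rightarrow> nat) \<Rightarrow> state \<Rightarrow> bool" where
  "message_table M s \<longleftrightarrow> (\<forall>a<2. \<forall>b<2. \<forall>z<2. arrs s ''m'' (4 * a + 2 * b + z) = M a b z)"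

lemma message_table_setr [simp]: "message_table M (setr x v s) = message_table M s"
  by (simp add: message_table_def)

lemma message_tableD:
  "message_table M s \<Longrightarrow> a < 2 \<Longrightarrow> b < 2 \<Longrightarrow> z < 2 \<Longrightarrow> arrs s ''m'' (4 * a + 2 * b + z) = M a b z"
  by (simp add: message_table_def)

lemma message_table_seta:
  assumes "message_table M s" "a < 2" "b < 2" "z < 2" "M' a b z = v"
    and "\<And>a' b' z'. (a', b', z') \<noteq> (a, b, z) \<Longrightarrow> M' a' b' z' = M a' b' z'"
  shows "message_table M' (seta ''m'' (4 * a + 2 * b + z) v s)"
  unfolding message_table_def
proof (intro allI impI)
  fix a' b' z' :: nat assume l: "a' < 2" "b' < 2" "z' < 2"
  show "arrs (seta ''m'' (4 * a + 2 * b + z) v s) ''m'' (4 * a' + 2 * b' + z') = M' a' b' z'"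
  proof (cases "(a', b', z') = (a, b, z)")
    case False
    then have "4 * a' + 2 * b' + z' \<noteq> 4 * a + 2 * b + z"
      using message_index_eq_iff[OF l assms(2-4)] by blast
    then show ?thesis using message_tableD[OF assms(1) l] assms(6)[OF False] by simp
  qed (use assms(5) in simp)
qed

lemma mark_less_2: "mark x y v < 2"
  using mark_01[of x y v] by auto

text \<open>The family \<open>S\<close> depends on the bits because four such updates run in
  sequence for the same pair of choices: in between, some slices already include the pair and others
  do not.\<close>

lemma wp_update_message:
  assumes ab: "a < 2" "b < 2" and U: "U \<subseteq> V" "finite (S a b)" and bs: "base s"
    and r: "regs s ''c'' = c" "regs s ''l'' = l" and cl: "c < N" "l < N" "bag c = y" "bag l = y"
    and mk: "\<forall>v<N. arrs s ''mark'' v = mark x y v"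
    and t: "tables (\<lambda>c l. bag c = y \<and> bag l = y) (F AC AL U y) s"
    and M: "message_table (\<lambda>a b z. val (messages AC AL U x y (S a b) a b z)) s"
  shows "wp (update_message a b) s (message_table
    (\<lambda>a' b' z. val (messages AC AL U x y (if a' = a \<and> b' = b then insert (c, l) (S a b) else S a' b') a' b' z)))"
    (is "wp _ _ (message_table ?M')")
proof -
  have ins: "val (messages AC AL U x y (insert (c, l) (S a b)) a b z) =
    (if a * mark x y c = 0 \<and> b * mark x y l = 0 \<and> z = b * mark x y c
     then max (val (messages AC AL U x y (S a b) a b z)) (F AC AL U y c l (1 - a * mark x y l))
     else val (messages AC AL U x y (S a b) a b z))" for z
    using val_messages_insert[OF U, of AC AL x y c l a b z] cl by simp
  have reads: "arrs s ''mark'' c = mark x y c" "arrs s ''mark'' l = mark x y l"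
    "arrs s ''dp0'' (c * N + l) = F AC AL U y c l 0" "arrs s ''dp1'' (c * N + l) = F AC AL U y c l 1"
    using mk t cl by (simp_all add: tables_def)
  show ?thesis
  proof (cases "a * mark x y c = 0 \<and> b * mark x y l = 0")
    case False
    have eq: "?M' a' b' z = val (messages AC AL U x y (S a' b') a' b' z)" for a' b' z
      using ins[of z] False by auto
    have "message_table ?M' s" unfolding eq by (rule M)
    then show ?thesis unfolding update_message_def using False
      by (intro wp_Cond wp_Skip) (auto simp: r reads)
  next
    case True
    \<comment> \<open>The contribution is determined by the choices, so for fixed \<open>a\<close>
      and \<open>b\<close> a pair of choices touches exactly one message cell.\<close>
    define z where "z = b * mark x y c"
    define w where "w = F AC AL U y c l (1 - a * mark x y l)"
    define q where "q = 4 * a + 2 * b + z"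
    have z: "z < 2" using ab(2) mark_01[of x y c] by (auto simp: z_def)
    have w_le: "w \<le> n + 1" unfolding w_def by (rule val_configs_le[OF U(1)])
    have old: "arrs s ''m'' q = val (messages AC AL U x y (S a b) a b z)"
      unfolding q_def by (rule message_tableD[OF M ab z])
    have old_le: "arrs s ''m'' q \<le> n + 1"
      unfolding old by (rule val_messages_le[OF U])
    have w_eq: "w = (if a * mark x y l = 0 then F AC AL U y c l 1 else F AC AL U y c l 0)"
      using ab(1) mark_01[of x y l] by (auto simp: w_def less_2_cases_iff)
    have fin: "message_table ?M' (seta ''m'' q (arrs s ''m'' q + (w - arrs s ''m'' q)) (setr ''w'' w (setr ''q'' q s)))"
      unfolding q_def
    proof (rule message_table_seta)
      show "message_table (\<lambda>a b z. val (messages AC AL U x y (S a b) a b z)) (setr ''w'' w (setr ''q'' (4 * a + 2 * b + z) s))"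
        using M by simp
      show "?M' a b z = arrs s ''m'' (4 * a + 2 * b + z) + (w - arrs s ''m'' (4 * a + 2 * b + z))"
        using True ins[of z] old unfolding q_def z_def w_def by (simp add: max_def)
      show "?M' a' b' z' = val (messages AC AL U x y (S a' b') a' b' z')" if "(a', b', z') \<noteq> (a, b, z)" for a' b' z'
        using that ins[of z'] by (auto simp: z_def)
    qed (use ab z in auto)
    have regs_q: "4 * a + 2 * b + b * mark x y c = q" by (simp add: q_def z_def)
    have q_le: "q \<le> 4 * n + 10" using ab z by (simp add: q_def)
    let ?s1 = "setr ''q'' q s"
    have q_val: "aval (Add (Const (4 * a + 2 * b)) (Mul (Const b) (Arr ''mark'' (R ''c'')))) s = q"
      by (simp only: aval.simps r reads regs_q)
    have load: "wp (Cond (Equal (Mul (Const a) (Arr ''mark'' (R ''l''))) (Const 0))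
        (Assign ''w'' (Arr ''dp1'' Idx)) (Assign ''w'' (Arr ''dp0'' Idx))) ?s1 (\<lambda>s2. s2 = setr ''w'' w ?s1)"
      using w_eq w_le by (intro wp_Cond wp_Assign) (simp_all add: r reads baseD(3)[OF bs])
    have store: "wp (Store ''m'' (R ''q'') (Add (Arr ''m'' (R ''q'')) (Sub (R ''w'') (Arr ''m'' (R ''q'')))))
        (setr ''w'' w ?s1) (message_table ?M')"
      using fin w_le old_le by (intro wp_Store) simp_all
    show ?thesis unfolding update_message_def
    proof (rule wp_Cond, rule wp_Seq, rule wp_Assign)
      show "wp (Seq (Cond (Equal (Mul (Const a) (Arr ''mark'' (R ''l''))) (Const 0))
          (Assign ''w'' (Arr ''dp1'' Idx)) (Assign ''w'' (Arr ''dp0'' Idx)))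
        (Store ''m'' (R ''q'') (Add (Arr ''m'' (R ''q'')) (Sub (R ''w'') (Arr ''m'' (R ''q''))))))
        (setr ''q'' (aval (Add (Const (4 * a + 2 * b)) (Mul (Const b) (Arr ''mark'' (R ''c'')))) s) s) (message_table ?M')"
        unfolding q_val by (rule wp_Seq, rule wp_mono[OF load]) (use store in simp)
    qed (use True q_le q_val in \<open>simp_all add: r reads\<close>)
  qed
qed

lemma wp_compute_messages:
  assumes b: "base s" and y: "regs s ''y'' = y" and U: "U \<subseteq> V"
    and mk: "\<forall>v<N. arrs s ''mark'' v = mark x y v"
    and t: "tables (\<lambda>c l. bag c = y \<and> bag l = y) (F AC AL U y) s"
  shows "wp compute_messages s
    (message_table (\<lambda>a b z. val (messages AC AL U x y ({..<N} \<times> {..<N}) a b z)))"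
  unfolding compute_messages_def
proof (rule wp_Seq, rule wp_For[where m = 8 and I = "\<lambda>i s'. \<forall>j<i. arrs s' ''m'' j = 0"])
  fix i and s' :: state assume "regs s' ''i'' = i" "\<forall>j<i. arrs s' ''m'' j = 0"
  then show "wp (Store ''m'' (R ''i'') (Const 0)) s' (\<lambda>s'. \<forall>j<Suc i. arrs s' ''m'' j = 0)"
    by (intro wp_Store) (auto simp: less_Suc_eq)
next
  fix s1 :: state assume 0: "\<forall>j<8. arrs s1 ''m'' j = 0"
    and fr1: "frame (For ''i'' (Const 8) (Store ''m'' (R ''i'') (Const 0))) s s1"
  have b1: "base s1" by (rule base_frame[OF b fr1]) simp_all
  let ?M = "\<lambda>S a b z. val (messages AC AL U x y (S a b) a b z)"
  show "wp (For2 ''c'' ''l'' (R ''N'') update_messages) s1 (message_table (?M (\<lambda>a b. {..<N} \<times> {..<N})))"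
  proof (rule wp_For2[where m = N and I = "\<lambda>S. message_table (?M (\<lambda>a b. S))"])
    fix s' :: state assume "frame (For2 ''c'' ''l'' (R ''N'') update_messages) s1 s'"
    from frame_regs[OF this, of "''N''"] show "aval (R ''N'') s' = N" by (simp add: baseD[OF b1])
  next
    fix c l S and s' :: state assume cl: "c < N" "l < N" and S: "finite S"
      and r: "regs s' ''c'' = c" "regs s' ''l'' = l"
      and fr: "frame (For2 ''c'' ''l'' (R ''N'') update_messages) s1 s'"
      and I: "message_table (?M (\<lambda>a b. S)) s'"
    have b': "base s'" by (rule base_frame[OF b1 fr]) simp_all
    have y': "regs s' ''y'' = y" using frame_regs[OF fr, of "''y''"] frame_regs[OF fr1, of "''y''"] y by simp
    have mk': "\<forall>v<N. arrs s' ''mark'' v = mark x y v" and t': "tables (\<lambda>c l. bag c = y \<and> bag l = y) (F AC AL U y) s'"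
      using frame_arrs[OF fr] frame_arrs[OF fr1] mk t by (simp_all add: tables_def)
    show "wp update_messages s' (message_table (?M (\<lambda>a b. insert (c, l) S)))"
      unfolding update_messages_def
    proof (rule wp_Cond)
      assume "bval (Conj (Equal (Arr ''bag'' (R ''c'')) (R ''y'')) (Equal (Arr ''bag'' (R ''l'')) (R ''y''))) s'"
      then have bag: "bag c = y" "bag l = y" using cl by (simp_all add: r y' baseD[OF b'])
      define ready where "ready s2 \<longleftrightarrow> base s2 \<and> regs s2 ''c'' = c \<and> regs s2 ''l'' = l \<and>
        (\<forall>v<N. arrs s2 ''mark'' v = mark x y v) \<and> tables (\<lambda>c l. bag c = y \<and> bag l = y) (F AC AL U y) s2" for s2
      \<comment> \<open>\<open>X\<close> is the set of bit pairs whose slice already accounts for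
        the current pair of choices.\<close>
      define upd where "upd X = message_table (?M (\<lambda>a b. if (a, b) \<in> X then insert (c, l) S else S))" for X
      have step: "wp (update_message a b) s2 (\<lambda>s3. ready s3 \<and> upd (insert (a, b) X) s3)"
        if ab: "a < 2" "b < 2" "(a, b) \<notin> X" and s2: "ready s2" "upd X s2" for a b X s2
      proof (rule wp_mono[OF wp_update_message[where S = "\<lambda>a b. if (a, b) \<in> X then insert (c, l) S else S"]])
        fix s3 assume fr3: "frame (update_message a b) s2 s3"
          and M: "message_table (?M (\<lambda>a' b'. if a' = a \<and> b' = b
            then insert (c, l) (if (a, b) \<in> X then insert (c, l) S else S)
            else if (a', b') \<in> X then insert (c, l) S else S)) s3"
        have "base s3" by (rule base_frame[OF _ fr3]) (use s2 in \<open>simp_all add: ready_def\<close>)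
        then have "ready s3" using s2 frame_regs[OF fr3] frame_arrs[OF fr3]
          by (simp add: ready_def tables_def)
        moreover have "(\<lambda>a' b'. if a' = a \<and> b' = b then insert (c, l) (if (a, b) \<in> X then insert (c, l) S else S)
            else if (a', b') \<in> X then insert (c, l) S else S) =
          (\<lambda>a' b'. if (a', b') \<in> insert (a, b) X then insert (c, l) S else S)"
          using ab by (intro ext) simp
        then have "upd (insert (a, b) X) s3" using M unfolding upd_def by metis
        ultimately show "ready s3 \<and> upd (insert (a, b) X) s3" by blast
      qed (use ab s2 S U cl bag in \<open>auto simp: ready_def upd_def\<close>)
      have "ready s'" using b' r mk' t' by (simp add: ready_def)
      moreover have "upd {} s'" using I by (simp add: upd_def)
      moreover have "message_table (?M (\<lambda>a b. insert (c, l) S)) s3" if "upd {(1, 1), (1, 0), (0, 1), (0, 0)} s3" for s3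
        using that unfolding upd_def message_table_def by (auto simp: less_2_cases_iff)
      ultimately show "wp (Seq (update_message 0 0) (Seq (update_message 0 1) (Seq (update_message 1 0) (update_message 1 1)))) s'
          (message_table (?M (\<lambda>a b. insert (c, l) S)))"
        by (intro wp_Seq wp_mono[OF step[of 0 0 "{}"]] wp_mono[OF step[of 0 1 "{(0, 0)}"]]
              wp_mono[OF step[of 1 0 "{(0, 1), (0, 0)}"]] wp_mono[OF step[of 1 1 "{(1, 0), (0, 1), (0, 0)}"]])
          simp_all
    next
      assume "\<not> bval (Conj (Equal (Arr ''bag'' (R ''c'')) (R ''y'')) (Equal (Arr ''bag'' (R ''l'')) (R ''y''))) s'"
      then have "\<not> (bag c = y \<and> bag l = y)" using cl by (simp add: r y' baseD[OF b'])
      then have "val (messages AC AL U x y (insert (c, l) S) a b z) = val (messages AC AL U x y S a b z)" for a b z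
        using val_messages_insert[OF U S, of AC AL x y c l a b z] by auto
      then show "wp Skip s' (message_table (?M (\<lambda>a b. insert (c, l) S)))"
        using I by (intro wp_Skip) simp
    qed
  next
    show "message_table (?M (\<lambda>a b. {})) s1"
      using 0 by (simp add: message_table_def val_messages_empty)
  qed (use N_bounds in simp_all)
qed simp_all

section \<open>Merging a leaf, and the complete dynamic program\<close>

lemma tables_mono:
  assumes "tables D G s" "\<And>c l. D' c l \<Longrightarrow> D c l \<and> G' c l = G c l"
    "arrs s' ''dp0'' = arrs s ''dp0''" "arrs s' ''dp1'' = arrs s ''dp1''"
  shows "tables D' G' s'"
  using assms unfolding tables_def by simp

lemma wp_update_tables:
  assumes b: "base s" and x: "regs s ''x'' = x"
    and mk: "\<forall>v<N. arrs s ''mark'' v = mark x y v"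
    and M: "message_table M s" "\<And>a b z. M a b z \<le> n + 1"
    and t: "tables D G s" "\<And>c l b. G c l b \<le> n + 1" "\<And>c l. bag c = x \<Longrightarrow> bag l = x \<Longrightarrow> D c l"
    and G0: "\<And>c l. bag c = x \<Longrightarrow> bag l = x \<Longrightarrow> G' c l 0 = comb (G c l 0) (M (mark x y c) (mark x y l) 0)"
    and G1: "\<And>c l. bag c = x \<Longrightarrow> bag l = x \<Longrightarrow> G' c l 1 =
      max (comb (G c l 1) (M (mark x y c) (mark x y l) 0)) (comb (G c l 0) (M (mark x y c) (mark x y l) 1))"
    and G': "\<And>c l. \<not> (bag c = x \<and> bag l = x) \<Longrightarrow> G' c l = G c l"
  shows "wp update_tables s (tables D G')"
  unfolding update_tables_def
proof (rule wp_For2[where m = N and I = "\<lambda>S. tables D (\<lambda>c l. if (c, l) \<in> S then G' c l else G c l)"])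
  fix s' :: state assume "frame (For2 ''c'' ''l'' (R ''N'') update_entry) s s'"
  from frame_regs[OF this, of "''N''"] show "aval (R ''N'') s' = N" by (simp add: baseD[OF b])
next
  fix c l S and s' :: state assume cl: "c < N" "l < N" and new: "(c, l) \<notin> S"
    and r: "regs s' ''c'' = c" "regs s' ''l'' = l"
    and fr: "frame (For2 ''c'' ''l'' (R ''N'') update_entry) s s'"
    and I: "tables D (\<lambda>c l. if (c, l) \<in> S then G' c l else G c l) s'"
  have b': "base s'" by (rule base_frame[OF b fr]) simp_all
  have x': "regs s' ''x'' = x" using frame_regs[OF fr, of "''x''"] x by simp
  have m': "arrs s' ''mark'' c = mark x y c" "arrs s' ''mark'' l = mark x y l"
    using frame_arrs[OF fr, of "''mark''"] mk cl by simp_all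
  let ?I = "tables D (\<lambda>c' l'. if (c', l') \<in> insert (c, l) S then G' c' l' else G c' l')"
  show "wp update_entry s' ?I"
  proof (cases "bag c = x \<and> bag l = x")
    case False
    have "?I s'" by (rule tables_update[OF I cl]) (use I cl G'[OF False] new in \<open>auto simp: tables_def\<close>)
    then show ?thesis unfolding update_entry_def using False cl
      by (intro wp_Cond wp_Skip) (auto simp: r x' baseD[OF b'])
  next
    case True
    define a where "a = mark x y c"
    define a' where "a' = mark x y l"
    define q where "q = 4 * a + 2 * a'"
    have a: "a < 2" "a' < 2" unfolding a_def a'_def by (rule mark_less_2)+
    have M': "arrs s' ''m'' q = M a a' 0" "arrs s' ''m'' (q + 1) = M a a' 1"
      using message_tableD[OF M(1) a, of 0] message_tableD[OF M(1) a, of 1] frame_arrs[OF fr, of "''m''"]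
      by (simp_all add: q_def)
    have D: "D c l" using t(3) True by blast
    \<comment> \<open>The pair has not been visited before, so its cells still hold the values from
      before the merge.\<close>
    have old: "arrs s' ''dp0'' (c * N + l) = G c l 0" "arrs s' ''dp1'' (c * N + l) = G c l 1"
      using I cl D new by (simp_all add: tables_def)
    define e where "e = comb (G c l 1) (M a a' 0)"
    define f where "f = comb (G c l 0) (M a a' 1)"
    define d where "d = comb (G c l 0) (M a a' 0)"
    have le: "e \<le> 2 * n + 2" "f \<le> 2 * n + 2" "d \<le> 2 * n + 2"
      unfolding e_def f_def d_def
      by (rule order_trans[OF comb_le], use t(2) M(2) in \<open>simp add: add_mono mult_2\<close>;
        metis add_mono Suc_eq_plus1 add_Suc add_Suc_right mult_2)+
    let ?s3 = "setr ''f'' f (setr ''e'' e (setr ''q'' q s'))"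
    let ?s4 = "seta ''dp1'' (c * N + l) (e + (f - e)) (seta ''dp0'' (c * N + l) d ?s3)"
    have fin: "?I ?s4"
    proof (rule tables_update[OF I cl])
      show "arrs ?s4 ''dp0'' (c * N + l) = (if (c, l) \<in> insert (c, l) S then G' c l else G c l) 0 \<and>
          arrs ?s4 ''dp1'' (c * N + l) = (if (c, l) \<in> insert (c, l) S then G' c l else G c l) 1"
        using G0[of c l] G1[of c l] True by (simp add: a_def a'_def d_def e_def f_def max_def)
    qed auto
    have q: "4 * a + 2 * a' = q" by (simp add: q_def)
    have "wp (Seq (Assign ''q'' (Add (Mul (Const 4) (Arr ''mark'' (R ''c''))) (Mul (Const 2) (Arr ''mark'' (R ''l'')))))
        (Seq (Assign ''e'' (Comb (Arr ''dp1'' Idx) (Arr ''m'' (R ''q''))))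
          (Seq (Assign ''f'' (Comb (Arr ''dp0'' Idx) (Arr ''m'' (Add (R ''q'') (Const 1)))))
            (Seq (Store ''dp0'' Idx (Comb (Arr ''dp0'' Idx) (Arr ''m'' (R ''q''))))
              (Store ''dp1'' Idx (Add (R ''e'') (Sub (R ''f'') (R ''e'')))))))) s' ?I"
    proof (rule wp_Seq, rule wp_Assign)
      have q_val: "aval (Add (Mul (Const 4) (Arr ''mark'' (R ''c''))) (Mul (Const 2) (Arr ''mark'' (R ''l'')))) s' = q"
        by (simp add: r m' q_def a_def a'_def)
      show "aval (Add (Mul (Const 4) (Arr ''mark'' (R ''c''))) (Mul (Const 2) (Arr ''mark'' (R ''l'')))) s' \<le> 4 * n + 10"
        unfolding q_val using a by (simp add: q_def)
      show "wp (Seq (Assign ''e'' (Comb (Arr ''dp1'' Idx) (Arr ''m'' (R ''q''))))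
          (Seq (Assign ''f'' (Comb (Arr ''dp0'' Idx) (Arr ''m'' (Add (R ''q'') (Const 1)))))
            (Seq (Store ''dp0'' Idx (Comb (Arr ''dp0'' Idx) (Arr ''m'' (R ''q''))))
              (Store ''dp1'' Idx (Add (R ''e'') (Sub (R ''f'') (R ''e'')))))))
          (setr ''q'' (aval (Add (Mul (Const 4) (Arr ''mark'' (R ''c''))) (Mul (Const 2) (Arr ''mark'' (R ''l'')))) s') s') ?I"
        unfolding q_val
        by (intro wp_Seq wp_Assign wp_Store)
          (use le fin M' in \<open>simp_all add: r baseD(3)[OF b'] old e_def[unfolded One_nat_def, symmetric]
              f_def[unfolded One_nat_def, symmetric] d_def[symmetric]\<close>)
    qed
    then show ?thesis unfolding update_entry_def using True cl
      by (intro wp_Cond) (auto simp: r x' baseD[OF b'])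
  qed
next
  fix s' :: state assume "tables D (\<lambda>c l. if (c, l) \<in> {..<N} \<times> {..<N} then G' c l else G c l) s'"
  then show "tables D G' s'" by (simp add: tables_def)
qed (use N_bounds t in simp_all)

text \<open>Invariant between merges: for the root and each remaining bag, the entries with both
  choices in that bag are optimal values for the part merged into it.\<close>

definition dp_state :: "nat set \<Rightarrow> nat set \<Rightarrow> (nat \<Rightarrow> nat set) \<Rightarrow> state \<Rightarrow> bool" where
  "dp_state AC AL U s \<longleftrightarrow> elimination (remaining s) U \<and>
     tables (\<lambda>c l. bag c = bag l \<and> bag c \<in> insert k (remaining s)) (\<lambda>c l. F AC AL (U (bag c)) (bag c) c l) s"

lemma dp_state_setr [simp]: "dp_state AC AL U (setr x v s) = dp_state AC AL U s"
  by (simp add: dp_state_def)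

lemma finite_remaining: "finite (remaining s)"
  by (rule finite_subset[of _ "{..<k}"]) (auto simp: remaining_def)

lemma wp_eliminate_leaf:
  assumes b: "base s" and ne: "remaining s \<noteq> {}" and dp: "dp_state AC AL U s"
  shows "wp eliminate_leaf s (\<lambda>s'. card (remaining s) = Suc (card (remaining s')) \<and> (\<exists>U'. dp_state AC AL U' s'))"
  unfolding eliminate_leaf_def
proof (rule wp_Seq, rule wp_mono[OF wp_find_leaf[OF b refl ne]])
  let ?A = "remaining s"
  let ?D = "\<lambda>c l. bag c = bag l \<and> bag c \<in> insert k ?A"
  let ?G = "\<lambda>c l. F AC AL (U (bag c)) (bag c) c l"
  have el: "elimination ?A U" and t: "tables ?D ?G s" using dp by (simp_all add: dp_state_def)
  fix s1 assume fr1: "frame find_leaf s s1" and leaf: "leaf_with_parent ?A (regs s1 ''y'') (regs s1 ''x'')"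
  define x where "x = regs s1 ''x''"
  define y where "y = regs s1 ''y''"
  have y: "y \<in> ?A" and x: "x \<in> insert k ?A" and only: "\<And>z. z \<in> ?A \<Longrightarrow> fadj y z \<Longrightarrow> z = x"
    using leaf unfolding leaf_with_parent_def x_def y_def by blast+
  have yk: "y < k" using y by (simp add: remaining_def)
  have xy: "x \<noteq> y"
    using leaf yk fadj_irrefl unfolding leaf_with_parent_def x_def[symmetric] y_def[symmetric] by auto
  have b1: "base s1" by (rule base_frame[OF b fr1]) simp_all
  have t1: "tables ?D ?G s1" using t frame_arrs[OF fr1] by (simp add: tables_def)
  have d1: "arrs s1 ''done'' = arrs s ''done''" using frame_arrs[OF fr1] by simp
  have sep: "separated (U x) x (U y) y"
    using el x y xy unfolding elimination_def by blast
  have UV: "U z \<subseteq> V" if "z \<in> insert k ?A" for z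
  proof -
    have "(\<Union>z\<in>insert k ?A. U z) = V" using el unfolding elimination_def by (elim conjE)
    then show ?thesis using that by blast
  qed
  show "wp (Seq set_marks (Seq compute_messages (Seq update_tables (Store ''done'' (R ''y'') (Const 1))))) s1
      (\<lambda>s'. card ?A = Suc (card (remaining s')) \<and> (\<exists>U'. dp_state AC AL U' s'))"
  proof (rule wp_Seq, rule wp_mono[OF wp_set_marks[OF b1 x_def[symmetric] y_def[symmetric]]])
    fix s2 assume fr2: "frame set_marks s1 s2" and mk2: "\<forall>v<N. arrs s2 ''mark'' v = mark x y v"
    have b2: "base s2" by (rule base_frame[OF b1 fr2]) simp_all
    have xy2: "regs s2 ''x'' = x" "regs s2 ''y'' = y" using frame_regs[OF fr2] by (simp_all add: x_def y_def)
    have t2: "tables ?D ?G s2" using t1 frame_arrs[OF fr2] by (simp add: tables_def)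
    have d2: "arrs s2 ''done'' = arrs s ''done''" using frame_arrs[OF fr2] d1 by simp
    have t2': "tables (\<lambda>c l. bag c = y \<and> bag l = y) (F AC AL (U y) y) s2"
      using t2 y unfolding tables_def by auto
    show "wp (Seq compute_messages (Seq update_tables (Store ''done'' (R ''y'') (Const 1)))) s2
        (\<lambda>s'. card ?A = Suc (card (remaining s')) \<and> (\<exists>U'. dp_state AC AL U' s'))"
    proof (rule wp_Seq, rule wp_mono[OF wp_compute_messages[OF b2 xy2(2) UV mk2 t2']])
      show "y \<in> insert k ?A" using y by simp
      let ?M = "\<lambda>a b z. val (messages AC AL (U y) x y ({..<N} \<times> {..<N}) a b z)"
      fix s3 assume fr3: "frame compute_messages s2 s3" and M3: "message_table ?M s3"
      have b3: "base s3" by (rule base_frame[OF b2 fr3]) simp_all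
      have xy3: "regs s3 ''x'' = x" "regs s3 ''y'' = y" using frame_regs[OF fr3] xy2 by simp_all
      have mk3: "\<forall>v<N. arrs s3 ''mark'' v = mark x y v" using frame_arrs[OF fr3] mk2 by simp
      have t3: "tables ?D ?G s3" using t2 frame_arrs[OF fr3] by (simp add: tables_def)
      have d3: "arrs s3 ''done'' = arrs s ''done''" using frame_arrs[OF fr3] d2 by simp
      let ?U' = "U(x := U x \<union> U y)"
      \<comment> \<open>The update rule wants a bound on all values of its table function, but parts
        are known to lie in \<open>V\<close> only for the root and remaining bags; elsewhere the
        function is cut off to 0, where \<open>?D\<close> claims nothing.\<close>
      let ?G2 = "\<lambda>c l b. if bag c \<in> insert k ?A then ?G c l b else 0"
      let ?G' = "\<lambda>c l b. if bag c = x \<and> bag l = x then F AC AL (U x \<union> U y) x c l b else ?G2 c l b"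
      have t3': "tables ?D ?G2 s3" by (rule tables_mono[OF t3]) (auto intro!: ext)
      have upd: "wp update_tables s3 (tables ?D ?G')"
      proof (rule wp_update_tables[OF b3 xy3(1) mk3 M3 _ t3'])
        show "?M a b z \<le> n + 1" for a b z by (rule val_messages_le) (use UV y in auto)
        show "?G2 c l b \<le> n + 1" for c l b using val_configs_le UV by simp
        show "?D c l" if "bag c = x" "bag l = x" for c l using that x by simp
        fix c l assume cl: "bag c = x" "bag l = x"
        note F = F_Un[OF sep xy less_imp_le[OF yk], where AC = AC and AL = AL and c = c and l = l]
        show "?G' c l 0 = comb (?G2 c l 0) (?M (mark x y c) (mark x y l) 0)"
          using F(1) cl x by simp
        show "?G' c l 1 = max (comb (?G2 c l 1) (?M (mark x y c) (mark x y l) 0))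
            (comb (?G2 c l 0) (?M (mark x y c) (mark x y l) 1))"
          using F(2) cl x by simp
      qed (auto intro!: ext)
      show "wp (Seq update_tables (Store ''done'' (R ''y'') (Const 1))) s3
          (\<lambda>s'. card ?A = Suc (card (remaining s')) \<and> (\<exists>U'. dp_state AC AL U' s'))"
      proof (rule wp_Seq, rule wp_mono[OF upd])
        fix s4 assume fr4: "frame update_tables s3 s4" and t4: "tables ?D ?G' s4"
        have y4: "regs s4 ''y'' = y" using frame_regs[OF fr4] xy3 by simp
        have "arrs s4 ''done'' = arrs s ''done''" using frame_arrs[OF fr4] d3 by simp
        then have rem: "remaining (seta ''done'' y 1 s4) = ?A - {y}" by (auto simp: remaining_def)
        have "elimination (?A - {y}) ?U'" by (rule elimination_step[OF el y x xy only])
        moreover have "tables (\<lambda>c l. bag c = bag l \<and> bag c \<in> insert k (?A - {y}))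
            (\<lambda>c l. F AC AL (?U' (bag c)) (bag c) c l) (seta ''done'' y 1 s4)"
          by (rule tables_mono[OF t4]) (auto intro!: ext)
        ultimately have "dp_state AC AL ?U' (seta ''done'' y 1 s4)" unfolding dp_state_def rem by blast
        moreover have "card ?A = Suc (card (?A - {y}))"
          using y finite_remaining by (metis card_Suc_Diff1)
        ultimately show "wp (Store ''done'' (R ''y'') (Const 1)) s4
            (\<lambda>s'. card ?A = Suc (card (remaining s')) \<and> (\<exists>U'. dp_state AC AL U' s'))"
          by (intro wp_Store) (auto simp: y4 rem[unfolded One_nat_def])
      qed
    qed
  qed
qed

lemma wp_solve:
  assumes b: "base s" and ac: "allowed ''ac'' AC s" and al: "allowed ''al'' AL s"
  shows "wp solve s (\<lambda>s'. regs s' ''val'' = opt AC AL)"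
  unfolding solve_def
proof (rule wp_Seq, rule wp_For[where m = k and I = "\<lambda>i s'. \<forall>j<i. arrs s' ''done'' j = 0"])
  fix s' :: state assume "frame (For ''i'' (R ''k'') (Store ''done'' (R ''i'') (Const 0))) s s'"
  from frame_regs[OF this, of "''k''"] show "aval (R ''k'') s' = k" by (simp add: baseD[OF b])
next
  fix i and s' :: state assume "regs s' ''i'' = i" "\<forall>j<i. arrs s' ''done'' j = 0"
  then show "wp (Store ''done'' (R ''i'') (Const 0)) s' (\<lambda>s'. \<forall>j<Suc i. arrs s' ''done'' j = 0)"
    by (intro wp_Store) (auto simp: less_Suc_eq)
next
  let ?loop = "For ''it'' (R ''k'') eliminate_leaf"
  let ?out = "Assign ''val'' (Sub (Arr ''dp1'' (Add (Mul (Add (R ''n'') (R ''k'')) (R ''N'')) (Add (R ''n'') (R ''k''))))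
    (Const 1))"
  fix s1 :: state assume d1: "\<forall>j<k. arrs s1 ''done'' j = 0"
    and fr1: "frame (For ''i'' (R ''k'') (Store ''done'' (R ''i'') (Const 0))) s s1"
  have b1: "base s1" by (rule base_frame[OF b fr1]) simp_all
  have allowed1: "allowed ''ac'' AC s1" "allowed ''al'' AL s1"
    using ac al frame_arrs[OF fr1] by (simp_all add: allowed_def)
  show "wp (Seq init_tables (Seq ?loop ?out)) s1 (\<lambda>s'. regs s' ''val'' = opt AC AL)"
  proof (rule wp_Seq, rule wp_mono[OF wp_init_tables[OF b1 allowed1]])
    fix s2 assume fr2: "frame init_tables s1 s2" and t2: "tables (\<lambda>c l. True) (base_val AC AL) s2"
    have b2: "base s2" by (rule base_frame[OF b1 fr2]) simp_all
    have rem2: "remaining s2 = {..<k}" using d1 frame_arrs[OF fr2] by (auto simp: remaining_def)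
    have dp2: "dp_state AC AL verts s2"
      unfolding dp_state_def rem2
    proof
      show "tables (\<lambda>c l. bag c = bag l \<and> bag c \<in> insert k {..<k}) (\<lambda>c l. F AC AL (verts (bag c)) (bag c) c l) s2"
        by (rule tables_mono[OF t2]) (auto intro!: ext F_verts)
    qed (rule elimination_init)
    show "wp (Seq ?loop ?out) s2 (\<lambda>s'. regs s' ''val'' = opt AC AL)"
    \<comment> \<open>Each round removes exactly one bag, so after \<open>k\<close> rounds only the
      root is left.\<close>
    proof (rule wp_Seq, rule wp_For[where m = k and
          I = "\<lambda>i s'. card (remaining s') + i = k \<and> (\<exists>U. dp_state AC AL U s')"])
      fix s' :: state assume "frame ?loop s2 s'"
      from frame_regs[OF this, of "''k''"] show "aval (R ''k'') s' = k" by (simp add: baseD[OF b2])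
    next
      fix i and s' :: state assume i: "i < k" and fr: "frame ?loop s2 s'"
        and I: "card (remaining s') + i = k \<and> (\<exists>U. dp_state AC AL U s')"
      then obtain U where dp: "dp_state AC AL U s'" by blast
      have b': "base s'" by (rule base_frame[OF b2 fr]) simp_all
      have "remaining s' \<noteq> {}" using I i by auto
      then show "wp eliminate_leaf s' (\<lambda>s'. card (remaining s') + Suc i = k \<and> (\<exists>U. dp_state AC AL U s'))"
        by (rule wp_mono[OF wp_eliminate_leaf[OF b' _ dp]]) (use I in auto)
    next
      fix s3 :: state assume fr3: "frame ?loop s2 s3"
        and I: "card (remaining s3) + k = k \<and> (\<exists>U. dp_state AC AL U s3)"
      have b3: "base s3" by (rule base_frame[OF b2 fr3]) simp_all
      obtain U where dp: "dp_state AC AL U s3" using I by blast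
      have "card (remaining s3) = 0" using I by simp
      then have rem: "remaining s3 = {}" by (simp only: card_eq_0_iff finite_remaining simp_thms not_True_eq_False)
      have "U k = V" using dp unfolding dp_state_def rem by (intro elimination_final) simp
      moreover have "bag (n + k) = k" by (rule bag_dummy) simp
      ultimately have dp1: "arrs s3 ''dp1'' ((n + k) * N + (n + k)) = F AC AL V k (n + k) (n + k) 1"
        using dp N_bounds(4) unfolding dp_state_def tables_def by simp
      have "F AC AL V k (n + k) (n + k) 1 \<le> n + 1" by (rule val_configs_le) simp
      then show "wp ?out s3 (\<lambda>s'. regs s' ''val'' = opt AC AL)"
        using dp1 by (intro wp_Assign) (simp_all add: baseD[OF b3] opt_def)
    qed (use k_le rem2 dp2 in auto)
  qed
qed (use k_le in simp_all)

section \<open>Pruning and output\<close>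

lemma allowed_seta:
  assumes "allowed a A s" "p < n" "v = of_bool (p \<in> B)" "A - {p} = B - {p}"
  shows "allowed a B (seta a p v s)"
  unfolding allowed_def
proof (intro allI impI)
  fix q assume q: "q < N"
  have "q \<in> A \<longleftrightarrow> q \<in> B" if "q \<noteq> p" using that assms(4) by blast
  then show "arrs (seta a p v s) a q = of_bool (q < n \<longrightarrow> q \<in> B)"
    using assms q unfolding allowed_def by simp
qed

text \<open>\<open>f\<close> is the optimal value as a function of the one set that is pruned.\<close>

lemma wp_prune:
  assumes a: "a \<in> {''ac'', ''al''}" and mono: "\<And>A A'. A \<subseteq> A' \<Longrightarrow> f A \<le> (f A' :: nat)"
    and solve: "\<And>A s'. frame (prune a) s s' \<Longrightarrow> base s' \<Longrightarrow> allowed a A s' \<Longrightarrow>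
      wp solve s' (\<lambda>s''. regs s'' ''val'' = f A)"
    and b: "base s" and all: "allowed a V s" and res: "regs s ''result'' = f V"
  shows "wp (prune a) s (\<lambda>s'. \<exists>A\<subseteq>V. allowed a A s' \<and> f A = f V \<and> (\<forall>v\<in>A. f (A - {v}) < f A))"
  unfolding prune_def
\<comment> \<open>Vertices from \<open>i\<close> on have not been tried and are all present; each
  earlier vertex that was kept is indispensable.\<close>
proof (rule wp_For[where m = n and
      I = "\<lambda>i s'. \<exists>A\<subseteq>V. {i..<n} \<subseteq> A \<and> allowed a A s' \<and> f A = f V \<and> (\<forall>v\<in>A. v < i \<longrightarrow> f (A - {v}) < f V)"])
  fix s' :: state assume "frame (For ''p'' (R ''n'') (prune_vertex a)) s s'"
  from frame_regs[OF this, of "''n''"] show "aval (R ''n'') s' = n" by (simp add: baseD[OF b])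
next
  fix i and s' :: state
  assume i: "i < n" "regs s' ''p'' = i" and fr: "frame (For ''p'' (R ''n'') (prune_vertex a)) s s'"
    and I: "\<exists>A\<subseteq>V. {i..<n} \<subseteq> A \<and> allowed a A s' \<and> f A = f V \<and> (\<forall>v\<in>A. v < i \<longrightarrow> f (A - {v}) < f V)"
  then obtain A where A: "A \<subseteq> V" "{i..<n} \<subseteq> A" "allowed a A s'" "f A = f V"
    "\<And>v. v \<in> A \<Longrightarrow> v < i \<Longrightarrow> f (A - {v}) < f V" by blast
  have b': "base s'" by (rule base_frame[OF b fr]) (use a in auto)
  let ?s1 = "seta a i 0 s'"
  have fr1: "frame (prune a) s ?s1"
    using fr unfolding frame_def prune_def by auto
  have b1: "base ?s1" using b' a unfolding base_def by auto
  have al1: "allowed a (A - {i}) ?s1" by (rule allowed_seta[OF A(3) i(1)]) auto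
  let ?I = "\<lambda>s'. \<exists>A\<subseteq>V. {Suc i..<n} \<subseteq> A \<and> allowed a A s' \<and> f A = f V \<and> (\<forall>v\<in>A. v < Suc i \<longrightarrow> f (A - {v}) < f V)"
  have "wp solve ?s1 (\<lambda>s2. wp (Cond (Less (R ''val'') (R ''result'')) (Store a (R ''p'') (Const 1)) Skip) s2 ?I)"
  proof (rule wp_mono[OF solve[OF fr1 b1 al1]])
    fix s2 assume fr2: "frame solve ?s1 s2" and v: "regs s2 ''val'' = f (A - {i})"
    have r2: "regs s2 ''p'' = i" using frame_regs[OF fr2] i by simp
    have res2: "regs s2 ''result'' = f V" using frame_regs[OF fr2] frame_regs[OF fr] res by simp
    have al2: "allowed a (A - {i}) s2" using al1 frame_arrs[OF fr2, of a] a unfolding allowed_def by auto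
    have le: "f (A - {i}) \<le> f V" by (rule mono) (use A(1) in blast)
    show "wp (Cond (Less (R ''val'') (R ''result'')) (Store a (R ''p'') (Const 1)) Skip) s2 ?I"
    proof (cases "f (A - {i}) < f V")
      case True
      have "i \<in> A" using A(2) i by auto
      then have "allowed a A (seta a i 1 s2)" by (intro allowed_seta[OF al2 i(1)]) auto
      moreover have "f (A - {v}) < f V" if "v \<in> A" "v < Suc i" for v
        using that A(5)[of v] True by (cases "v = i") auto
      moreover have "{Suc i..<n} \<subseteq> A" using A(2) by auto
      ultimately have "?I (seta a i 1 s2)" using A(1,4) by blast
      then show ?thesis using True by (intro wp_Cond wp_Store wp_Skip) (simp_all add: v res2 r2)
    next
      case False
      \<comment> \<open>Dropping \<open>i\<close> keeps earlier vertices indispensable: by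
        monotonicity a smaller set cannot restore the optimum.\<close>
      have "f (A - {i} - {v}) < f V" if "v \<in> A - {i}" "v < Suc i" for v
      proof -
        have "f (A - {i} - {v}) \<le> f (A - {v})" by (rule mono) blast
        also have "\<dots> < f V" using that by (intro A(5)) auto
        finally show ?thesis .
      qed
      moreover have "{Suc i..<n} \<subseteq> A - {i}" using A(2) by auto
      moreover have "f (A - {i}) = f V" using False le by simp
      moreover have "A - {i} \<subseteq> V" using A(1) by blast
      ultimately have "?I s2" using al2 by blast
      then show ?thesis using False by (intro wp_Cond wp_Store wp_Skip) (simp_all add: v res2)
    qed
  qed
  then show "wp (prune_vertex a) s' ?I"
    unfolding prune_vertex_def by (intro wp_Seq wp_Store) (simp_all add: i)
next
  fix s' :: state
  assume "\<exists>A\<subseteq>V. {n..<n} \<subseteq> A \<and> allowed a A s' \<and> f A = f V \<and> (\<forall>v\<in>A. v < n \<longrightarrow> f (A - {v}) < f V)"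
  then show "\<exists>A\<subseteq>V. allowed a A s' \<and> f A = f V \<and> (\<forall>v\<in>A. f (A - {v}) < f A)" by fastforce
next
  show "\<exists>A\<subseteq>V. {0..<n} \<subseteq> A \<and> allowed a A s \<and> f A = f V \<and> (\<forall>v\<in>A. v < 0 \<longrightarrow> f (A - {v}) < f V)"
    using all by (intro exI[of _ V]) auto
qed (use a in \<open>auto simp: allowed_def\<close>)

text \<open>The program writes only ones; the zeros of the matrix are the initial contents of the
  array.\<close>

lemma wp_output_edges:
  assumes b: "base s" and ac: "allowed ''ac'' AC s" and al: "allowed ''al'' AL s"
    and zero: "\<forall>i. arrs s ''result'' i = 0"
  shows "wp output_edges s (outputs_edge_set n (star_edges E AC AL))"
  unfolding output_edges_def
proof (rule wp_For2[where m = n and I = "\<lambda>S s'. \<forall>u<n. \<forall>v<n. arrs s' ''result'' (u * n + v) =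
    of_bool ((u, v) \<in> S \<and> {u, v} \<in> star_edges E AC AL)"])
  fix s' :: state assume "frame (For2 ''u'' ''v'' (R ''n'') output_edge) s s'"
  from frame_regs[OF this, of "''n''"] show "aval (R ''n'') s' = n" by (simp add: baseD[OF b])
next
  fix i j S and s' :: state assume ij: "i < n" "j < n" "(i, j) \<notin> S" and r: "regs s' ''u'' = i" "regs s' ''v'' = j"
    and fr: "frame (For2 ''u'' ''v'' (R ''n'') output_edge) s s'"
    and I: "\<forall>u<n. \<forall>v<n. arrs s' ''result'' (u * n + v) = of_bool ((u, v) \<in> S \<and> {u, v} \<in> star_edges E AC AL)"
  have b': "base s'" by (rule base_frame[OF b fr]) simp_all
  have cells: "arrs s' ''ac'' v = of_bool (v \<in> AC)" "arrs s' ''al'' v = of_bool (v \<in> AL)" if "v < n" for v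
    using ac al frame_arrs[OF fr] that N_bounds(2) by (simp_all add: allowed_def)
  let ?I = "\<lambda>s'. \<forall>u<n. \<forall>v<n. arrs s' ''result'' (u * n + v) =
    of_bool ((u, v) \<in> insert (i, j) S \<and> {u, v} \<in> star_edges E AC AL)"
  have star: "{i, j} \<in> star_edges E AC AL \<longleftrightarrow> {i, j} \<in> E \<and> (i \<in> AC \<and> j \<in> AL \<or> j \<in> AC \<and> i \<in> AL)"
  proof -
    have "{j, i} \<in> E \<longleftrightarrow> {i, j} \<in> E" by (simp add: insert_commute)
    then show ?thesis unfolding star_edges_def mem_Collect_eq doubleton_eq_iff by metis
  qed
  show "wp output_edge s' ?I"
  proof (cases "{i, j} \<in> star_edges E AC AL")
    case True
    have "?I (seta ''result'' (i * n + j) 1 s')"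
      using I True ij by (auto simp: row_index_eq_iff)
    then show ?thesis unfolding output_edge_def using True ij unfolding star
      by (intro wp_Cond wp_Store wp_Skip) (auto simp: r baseD[OF b'] cells)
  next
    case False
    have "?I s'" using I False by auto
    then show ?thesis unfolding output_edge_def using False ij unfolding star
      by (intro wp_Cond wp_Store wp_Skip) (auto simp: r baseD[OF b'] cells)
  qed
next
  fix s' :: state
  assume I: "\<forall>u<n. \<forall>v<n. arrs s' ''result'' (u * n + v) =
    of_bool ((u, v) \<in> {..<n} \<times> {..<n} \<and> {u, v} \<in> star_edges E AC AL)"
  show "outputs_edge_set n (star_edges E AC AL) s'"
    unfolding outputs_edge_set_def
  proof (intro allI impI)
    fix i assume i: "i < n * n"
    then have "0 < n" by (cases n) auto
    then have "i div n < n" "i mod n < n" using i by (simp_all add: less_mult_imp_div_less)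
    then show "arrs s' ''result'' i = edge_matrix n (star_edges E AC AL) i"
      using I[rule_format, of "i div n" "i mod n"] i by (simp add: edge_matrix_def)
  qed
qed (use zero k_le in auto)

lemma wp_eop_program:
  assumes nk: "regs s ''n'' = n" "regs s ''k'' = k"
    and graph: "\<And>u v. u < n \<Longrightarrow> v < n \<Longrightarrow> arrs s ''graph'' (u * n + v) = of_bool ({u, v} \<in> E)"
    and forest: "\<And>i j. i < k \<Longrightarrow> j < k \<Longrightarrow> arrs s ''forest'' (i * k + j) = of_bool (fadj i j)"
    and bag: "\<And>v. v < n \<Longrightarrow> arrs s ''bag'' v = bag v"
    and zero: "\<And>i. arrs s ''result'' i = 0"
  shows "wp eop_program s (\<lambda>s'. regs s' ''result'' = eop_number E \<and>
    (\<exists>D. max_edge_open_packing E D \<and> outputs_edge_set n D s'))" (is "wp _ _ ?Q")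
  unfolding eop_program_def
proof (rule wp_Seq, rule wp_Assign)
  let ?bags = "For ''i'' (Add (R ''k'') (Const 1)) (Store ''bag'' (Add (R ''n'') (R ''i'')) (R ''i''))"
  let ?allow = "For ''v'' (R ''N'') (Seq (Store ''ac'' (R ''v'') (Const 1)) (Store ''al'' (R ''v'') (Const 1)))"
  let ?rest = "Seq solve (Seq (Assign ''result'' (R ''val'')) (Seq (prune ''al'') (Seq (prune ''ac'') output_edges)))"
  let ?s0 = "setr ''N'' (aval (Add (Add (R ''n'') (R ''k'')) (Const 1)) s) s"
  have s0: "?s0 = setr ''N'' N s" by (simp add: nk N_def)
  show "aval (Add (Add (R ''n'') (R ''k'')) (Const 1)) s \<le> 4 * n + 10" using k_le by (simp add: nk)
  show "wp (Seq ?bags (Seq ?allow ?rest)) ?s0 ?Q"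
    unfolding s0
  proof (rule wp_Seq, rule wp_For[where m = "k + 1" and
        I = "\<lambda>i s'. (\<forall>v<n. arrs s' ''bag'' v = bag v) \<and> (\<forall>j<i. arrs s' ''bag'' (n + j) = j)"])
    fix s' :: state assume "frame ?bags (setr ''N'' N s) s'"
    from frame_regs[OF this, of "''k''"] show "aval (Add (R ''k'') (Const 1)) s' = k + 1" by (simp add: nk)
  next
    fix i and s' :: state assume i: "i < k + 1" "regs s' ''i'' = i" and fr: "frame ?bags (setr ''N'' N s) s'"
      and I: "(\<forall>v<n. arrs s' ''bag'' v = bag v) \<and> (\<forall>j<i. arrs s' ''bag'' (n + j) = j)"
    have "regs s' ''n'' = n" using frame_regs[OF fr, of "''n''"] nk by simp
    then show "wp (Store ''bag'' (Add (R ''n'') (R ''i'')) (R ''i'')) s'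
        (\<lambda>s'. (\<forall>v<n. arrs s' ''bag'' v = bag v) \<and> (\<forall>j<Suc i. arrs s' ''bag'' (n + j) = j))"
      using i I k_le by (intro wp_Store) (auto simp: less_Suc_eq)
  next
    fix s1 :: state assume fr1: "frame ?bags (setr ''N'' N s) s1"
      and I: "(\<forall>v<n. arrs s1 ''bag'' v = bag v) \<and> (\<forall>j<k + 1. arrs s1 ''bag'' (n + j) = j)"
    have bag1: "arrs s1 ''bag'' v = bag v" if "v < N" for v
    proof (cases "v < n")
      case False
      then obtain j where j: "v = n + j" by (metis le_add_diff_inverse not_less)
      then show ?thesis using I that bag_dummy[of j] by (simp add: N_def)
    qed (use I in simp)
    have b1: "base s1"
      using frame_regs[OF fr1] frame_arrs[OF fr1] bag1 nk graph forest unfolding base_def by simp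
    have zero1: "\<forall>i. arrs s1 ''result'' i = 0" using frame_arrs[OF fr1] zero by simp
    show "wp (Seq ?allow ?rest) s1 ?Q"
    proof (rule wp_Seq, rule wp_For[where m = N and
          I = "\<lambda>i s'. \<forall>j<i. arrs s' ''ac'' j = 1 \<and> arrs s' ''al'' j = 1"])
      fix s' :: state assume "frame ?allow s1 s'"
      from frame_regs[OF this, of "''N''"] show "aval (R ''N'') s' = N" by (simp add: baseD[OF b1])
    next
      fix i and s' :: state
      assume "regs s' ''v'' = i" "\<forall>j<i. arrs s' ''ac'' j = 1 \<and> arrs s' ''al'' j = 1"
      then show "wp (Seq (Store ''ac'' (R ''v'') (Const 1)) (Store ''al'' (R ''v'') (Const 1))) s'
          (\<lambda>s'. \<forall>j<Suc i. arrs s' ''ac'' j = 1 \<and> arrs s' ''al'' j = 1)"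
        by (intro wp_Seq wp_Store) (auto simp: less_Suc_eq)
    next
      fix s2 :: state assume fr2: "frame ?allow s1 s2"
        and "\<forall>j<N. arrs s2 ''ac'' j = 1 \<and> arrs s2 ''al'' j = 1"
      then have allowed2: "allowed ''ac'' V s2" "allowed ''al'' V s2" by (simp_all add: allowed_def)
      have b2: "base s2" by (rule base_frame[OF b1 fr2]) simp_all
      have zero2: "\<forall>i. arrs s2 ''result'' i = 0" using frame_arrs[OF fr2] zero1 by simp
      show "wp ?rest s2 ?Q"
      proof (rule wp_Seq, rule wp_mono[OF wp_solve[OF b2 allowed2]])
        fix s3 assume fr3: "frame solve s2 s3" and v3: "regs s3 ''val'' = opt V V"
        let ?s4 = "setr ''result'' (opt V V) s3"
        have "base s3" by (rule base_frame[OF b2 fr3]) simp_all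
        then have b4: "base ?s4" by simp
        have allowed4: "allowed ''ac'' V ?s4" "allowed ''al'' V ?s4"
          using allowed2 frame_arrs[OF fr3] by (simp_all add: allowed_def)
        have zero4: "\<forall>i. arrs ?s4 ''result'' i = 0" using zero2 frame_arrs[OF fr3] by simp
        have "wp (Seq (prune ''al'') (Seq (prune ''ac'') output_edges)) ?s4 ?Q"
        proof (rule wp_Seq, rule wp_mono[OF wp_prune[where f = "opt V"]])
          fix AL s' assume "frame (prune ''al'') ?s4 s'" "base s'" "allowed ''al'' AL s'"
          then show "wp solve s' (\<lambda>s''. regs s'' ''val'' = opt V AL)"
            using allowed4(1) frame_arrs[of "prune ''al''" ?s4 s'] by (intro wp_solve) (simp_all add: allowed_def)
        next
          fix s5 assume fr5: "frame (prune ''al'') ?s4 s5"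
            and "\<exists>AL\<subseteq>V. allowed ''al'' AL s5 \<and> opt V AL = opt V V \<and> (\<forall>v\<in>AL. opt V (AL - {v}) < opt V AL)"
          then obtain AL where AL: "AL \<subseteq> V" "allowed ''al'' AL s5" "opt V AL = opt V V"
            "\<And>v. v \<in> AL \<Longrightarrow> opt V (AL - {v}) < opt V AL" by blast
          have b5: "base s5" by (rule base_frame[OF b4 fr5]) simp_all
          have ac5: "allowed ''ac'' V s5" using allowed4 frame_arrs[OF fr5] by (simp add: allowed_def)
          have res5: "regs s5 ''result'' = opt V AL" using frame_regs[OF fr5] AL(3) by simp
          have zero5: "\<forall>i. arrs s5 ''result'' i = 0" using zero4 frame_arrs[OF fr5] by simp
          show "wp (Seq (prune ''ac'') output_edges) s5 ?Q"
          proof (rule wp_Seq, rule wp_mono[OF wp_prune[where f = "\<lambda>A. opt A AL"]])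
            fix AC s' assume "frame (prune ''ac'') s5 s'" "base s'" "allowed ''ac'' AC s'"
            then show "wp solve s' (\<lambda>s''. regs s'' ''val'' = opt AC AL)"
              using AL(2) frame_arrs[of "prune ''ac''" s5 s'] by (intro wp_solve) (simp_all add: allowed_def)
          next
            fix s6 assume fr6: "frame (prune ''ac'') s5 s6"
              and "\<exists>AC\<subseteq>V. allowed ''ac'' AC s6 \<and> opt AC AL = opt V AL \<and>
                (\<forall>v\<in>AC. opt (AC - {v}) AL < opt AC AL)"
            then obtain AC where AC: "AC \<subseteq> V" "allowed ''ac'' AC s6" "opt AC AL = opt V AL"
              "\<And>v. v \<in> AC \<Longrightarrow> opt (AC - {v}) AL < opt AC AL" by blast
            have b6: "base s6" by (rule base_frame[OF b5 fr6]) simp_all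
            have al6: "allowed ''al'' AL s6" using AL(2) frame_arrs[OF fr6] by (simp add: allowed_def)
            have res6: "regs s6 ''result'' = eop_number E"
              using frame_regs[OF fr6] res5 AL(3) eop_number_eq_opt by simp
            have zero6: "\<forall>i. arrs s6 ''result'' i = 0" using zero5 frame_arrs[OF fr6] by simp
            have max: "max_edge_open_packing E (star_edges E AC AL)"
            proof (rule minimal_is_optimal[OF AC(1) AL(1)])
              show "opt AC AL = eop_number E" using AC(3) AL(3) eop_number_eq_opt by simp
              \<comment> \<open>Leaves were found indispensable while all centres were allowed.
                Restricting the centres only lowers the left side, whereas the optimum on the right
                has been preserved.\<close>
              show "opt AC (AL - {v}) < opt AC AL" if "v \<in> AL" for v
                using opt_mono[OF AC(1), of "AL - {v}" "AL - {v}"] AL(4)[OF that] AC(3) by simp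
            qed (rule AC(4))
            show "wp output_edges s6 ?Q"
            proof (rule wp_mono[OF wp_output_edges[OF b6 AC(2) al6 zero6]])
              fix s7 assume "frame output_edges s6 s7" "outputs_edge_set n (star_edges E AC AL) s7"
              then show "?Q s7" using max res6 frame_regs[of output_edges s6 s7] by auto
            qed
          qed (use b5 ac5 res5 opt_mono in simp_all)
        qed (use b4 allowed4 opt_mono in simp_all)
        then show "wp (Seq (Assign ''result'' (R ''val'')) (Seq (prune ''al'') (Seq (prune ''ac'') output_edges))) s3 ?Q"
          using opt_le[of V V] by - (rule wp_Seq, rule wp_Assign, simp_all add: v3)
      qed
    qed (use N_bounds in simp_all)
  qed (use k_le bag in simp_all)
qed

end

section \<open>Degrees of the subprograms\<close>

lemma poly_time_eliminate_leaf: "poly_time (Suc (Suc d)) eliminate_leaf"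
  unfolding eliminate_leaf_def find_leaf_def test_leaf_def scan_neighbour_def set_marks_def mark_edge_def
    compute_messages_def update_messages_def update_message_def update_tables_def update_entry_def
  by (intro poly_time_intros)

lemma poly_time_solve: "poly_time (Suc (Suc (Suc d))) solve"
  unfolding solve_def init_tables_def init_entry_def
  by (intro poly_time_intros poly_time_eliminate_leaf)

text \<open>The pruning loops add one level around \<open>solve\<close>, which has degree three; all
  other parts are less deeply nested.\<close>

lemma poly_time_eop_program: "poly_time 4 eop_program"
proof -
  have "poly_time (Suc (Suc (Suc (Suc 0)))) eop_program"
    unfolding eop_program_def prune_def prune_vertex_def output_edges_def output_edge_def
    by (intro poly_time_intros poly_time_solve)
  then show ?thesis by (simp add: eval_nat_numeral)
qed

section \<open>From partition trees to the program input\<close>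

lemma adj_rel_sym: "sym (adj_rel E)"
  by (auto simp: sym_def adj_rel_def insert_commute)

lemma component_unique:
  assumes "C \<in> graph_components V E" "C' \<in> graph_components V E" "v \<in> C" "v \<in> C'"
  shows "C = C'"
proof -
  have sym: "(a, b) \<in> (adj_rel E)\<^sup>* \<Longrightarrow> (b, a) \<in> (adj_rel E)\<^sup>*" for a b
    using sym_rtrancl[OF adj_rel_sym[of E]] by (rule symD)
  obtain u u' where u: "C = {v \<in> V. (u, v) \<in> (adj_rel E)\<^sup>*}" "C' = {v \<in> V. (u', v) \<in> (adj_rel E)\<^sup>*}"
    using assms(1,2) by (auto simp: graph_components_def)
  have "(u, v) \<in> (adj_rel E)\<^sup>*" "(u', v) \<in> (adj_rel E)\<^sup>*" using assms(3,4) u by auto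
  then have "(u, u') \<in> (adj_rel E)\<^sup>*" "(u', u) \<in> (adj_rel E)\<^sup>*"
    using sym by (meson rtrancl_trans)+
  then show ?thesis unfolding u by (meson Collect_cong rtrancl_trans)
qed

lemma component_exists: "v \<in> V \<Longrightarrow> \<exists>C\<in>graph_components V E. v \<in> C"
  unfolding graph_components_def by blast

lemma component_edge:
  assumes "C \<in> graph_components V E" "u \<in> C" "{u, v} \<in> E" "v \<in> V"
  shows "v \<in> C"
proof -
  obtain w where w: "C = {v \<in> V. (w, v) \<in> (adj_rel E)\<^sup>*}"
    using assms(1) by (auto simp: graph_components_def)
  have "(u, v) \<in> adj_rel E" using assms(3) by (simp add: adj_rel_def)
  then show ?thesis using assms(2,4) unfolding w by (auto intro: rtrancl_into_rtrancl)
qed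

lemma component_subset: "C \<in> graph_components V E \<Longrightarrow> C \<subseteq> V"
  by (auto simp: graph_components_def)

locale partition_forest =
  fixes n :: nat and E :: "nat set set" and P :: "nat set \<Rightarrow> nat set set"
    and T :: "nat set \<Rightarrow> nat set set set" and bs :: "nat set list"
  assumes simple: "simple_graph {..<n} E"
    and family: "partition_tree_family n E P T"
    and numbering: "numbering_of bs (\<Union>C \<in> graph_components {..<n} E. P C)"
begin

abbreviation comps :: "nat set set" where "comps \<equiv> graph_components {..<n} E"

abbreviation k :: nat where "k \<equiv> length bs"

text \<open>From \<open>n\<close> on, \<open>v - n\<close> makes \<open>n + i\<close> the dummy of
  bag \<open>i\<close>; the program writes these cells itself, as the input array is 0
  there.\<close>

definition bag_index :: "nat \<Rightarrow> nat" where
  "bag_index v = (if v < n then THE i. i < k \<and> v \<in> bs ! i else v - n)"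

definition bag_adj :: "nat \<Rightarrow> nat \<Rightarrow> bool" where
  "bag_adj i j \<longleftrightarrow> i < k \<and> j < k \<and> {bs ! i, bs ! j} \<in> (\<Union>C\<in>comps. T C)"

lemma tree: "C \<in> comps \<Longrightarrow> partition_tree C (induced_edges E C) (P C) (T C)"
  using family by (simp add: partition_tree_family_def)

lemma partition: "C \<in> comps \<Longrightarrow> partition_on C (P C)"
  using tree by (simp add: partition_tree_def)

lemma bag_subset: "C \<in> comps \<Longrightarrow> X \<in> P C \<Longrightarrow> X \<subseteq> C"
  using partition_onD1[OF partition, of C] by blast

lemma bag_nonempty: "C \<in> comps \<Longrightarrow> X \<in> P C \<Longrightarrow> X \<noteq> {}"
  using partition_onD3[OF partition, of C] by blast

lemma tree_graph: "C \<in> comps \<Longrightarrow> simple_graph (P C) (T C)"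
  using tree by (simp add: partition_tree_def is_tree_def connected_graph_def)

lemma same_component:
  assumes "C \<in> comps" "C' \<in> comps" "X \<in> P C" "Y \<in> P C'" "v \<in> X" "v \<in> Y"
  shows "C = C'"
proof (rule component_unique[OF assms(1,2)])
  show "v \<in> C" using bag_subset[OF assms(1,3)] assms(5) by blast
  show "v \<in> C'" using bag_subset[OF assms(2,4)] assms(6) by blast
qed

lemma same_bag:
  assumes "C \<in> comps" "C' \<in> comps" "X \<in> P C" "Y \<in> P C'" "v \<in> X" "v \<in> Y"
  shows "X = Y"
proof -
  have "C' = C" using same_component[OF assms] by simp
  then show ?thesis
    using partition_onD2[OF partition[OF assms(1)]] assms(3-6) by (auto simp: disjoint_def)
qed

lemma bag_in_component: "i < k \<Longrightarrow> \<exists>C\<in>comps. bs ! i \<in> P C"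
  using numbering nth_mem[of i bs] by (auto simp: numbering_of_def)

lemma bag_index_props:
  assumes "v < n"
  shows "bag_index v < k" "v \<in> bs ! bag_index v"
proof -
  have "\<exists>!i. i < k \<and> v \<in> bs ! i"
  proof (rule ex_ex1I)
    obtain C where C: "C \<in> comps" "v \<in> C" using component_exists[of v "{..<n}" E] assms by auto
    then obtain X where X: "X \<in> P C" "v \<in> X" using partition_onD1[OF partition[OF C(1)]] by blast
    then have "X \<in> set bs" using C numbering by (auto simp: numbering_of_def)
    then show "\<exists>i. i < k \<and> v \<in> bs ! i" using X by (auto simp: in_set_conv_nth)
  next
    fix i j assume ij: "i < k \<and> v \<in> bs ! i" "j < k \<and> v \<in> bs ! j"
    obtain C where C: "C \<in> comps" "bs ! i \<in> P C" using bag_in_component ij by blast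
    obtain C' where C': "C' \<in> comps" "bs ! j \<in> P C'" using bag_in_component ij by blast
    have "bs ! i = bs ! j" using same_bag[OF C(1) C'(1) C(2) C'(2)] ij by blast
    then show "i = j" using ij numbering by (simp add: numbering_of_def nth_eq_iff_index_eq)
  qed
  from theI'[OF this] show "bag_index v < k" "v \<in> bs ! bag_index v"
    using assms by (simp_all add: bag_index_def)
qed

text \<open>The ends of an edge lie in one component, hence their bags belong to one partition tree,
  and an edge between the bags rules out that they are nonadjacent there. The relation
  \<open>bd\<close> is the product of the two boundary sets, of which only the rectangle property is
  kept.\<close>

lemma edge_bag:
  assumes "{u, v} \<in> E" "bag_index u \<noteq> bag_index v"
  obtains C bd where "C \<in> comps" "bs ! bag_index u \<in> P C" "bs ! bag_index v \<in> P C"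
    "{bs ! bag_index u, bs ! bag_index v} \<in> T C"
    "bd \<subseteq> bs ! bag_index u \<times> bs ! bag_index v"
    "\<forall>a \<in> bs ! bag_index u. \<forall>b \<in> bs ! bag_index v. {a, b} \<in> E \<longleftrightarrow> (a, b) \<in> bd"
    "\<forall>a b a' b'. (a, b) \<in> bd \<longrightarrow> (a', b') \<in> bd \<longrightarrow> (a, b') \<in> bd"
proof -
  let ?X = "bs ! bag_index u" and ?Y = "bs ! bag_index v"
  have uv: "u < n" "v < n" using simple_graph_edgeD[OF simple assms(1)] by auto
  note u = bag_index_props[OF uv(1)] and v = bag_index_props[OF uv(2)]
  obtain C where C: "C \<in> comps" "?X \<in> P C" using bag_in_component[OF u(1)] by blast
  obtain C' where C': "C' \<in> comps" "?Y \<in> P C'" using bag_in_component[OF v(1)] by blast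
  have "u \<in> C" using bag_subset C u by blast
  then have "v \<in> C" using component_edge[OF C(1) _ assms(1)] uv by simp
  moreover have "v \<in> C'" using bag_subset C' v by blast
  ultimately have "C' = C" using component_unique[OF C'(1) C(1)] by blast
  with C' have Y: "?Y \<in> P C" by simp
  have neq: "?X \<noteq> ?Y"
    using assms(2) u(1) v(1) numbering by (simp add: numbering_of_def nth_eq_iff_index_eq)
  have disj: "?X \<inter> ?Y = {}"
    using same_bag[OF C(1) C(1) C(2) Y] neq by blast
  have XYC: "?X \<subseteq> C" "?Y \<subseteq> C" using bag_subset C Y by blast+
  have "\<exists>bd. \<forall>X\<in>P C. \<forall>Y\<in>P C. X \<noteq> Y \<longrightarrow>
      (if {X, Y} \<in> T C then bd X Y \<subseteq> X \<and> bd Y X \<subseteq> Y \<and>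
          edges_between (induced_edges E C) X Y = {{u, v} | u v. u \<in> bd X Y \<and> v \<in> bd Y X}
       else edges_between (induced_edges E C) X Y = {})"
    using tree[OF C(1)] unfolding partition_tree_def by (elim conjE)
  then obtain bd where bd: "\<forall>X\<in>P C. \<forall>Y\<in>P C. X \<noteq> Y \<longrightarrow>
      (if {X, Y} \<in> T C then bd X Y \<subseteq> X \<and> bd Y X \<subseteq> Y \<and>
          edges_between (induced_edges E C) X Y = {{u, v} | u v. u \<in> bd X Y \<and> v \<in> bd Y X}
       else edges_between (induced_edges E C) X Y = {})" ..
  note bdXY = bd[rule_format, OF C(2) Y neq]
  have between: "{a, b} \<in> edges_between (induced_edges E C) ?X ?Y \<longleftrightarrow> {a, b} \<in> E" if "a \<in> ?X" "b \<in> ?Y" for a b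
    using that XYC unfolding edges_between_def induced_edges_def by auto
  have XY: "{?X, ?Y} \<in> T C"
    using bdXY between[OF u(2) v(2)] assms(1) by (auto split: if_splits)
  then have b: "bd ?X ?Y \<subseteq> ?X" "bd ?Y ?X \<subseteq> ?Y"
    "edges_between (induced_edges E C) ?X ?Y = {{u, v} | u v. u \<in> bd ?X ?Y \<and> v \<in> bd ?Y ?X}"
    using bdXY by simp_all
  have iff: "{a, b} \<in> E \<longleftrightarrow> (a, b) \<in> bd ?X ?Y \<times> bd ?Y ?X" if ab: "a \<in> ?X" "b \<in> ?Y" for a b
  proof -
    have "{a, b} \<in> E \<longleftrightarrow> (\<exists>u v. {a, b} = {u, v} \<and> u \<in> bd ?X ?Y \<and> v \<in> bd ?Y ?X)"
      unfolding between[OF ab, symmetric] b(3) by simp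
    also have "\<dots> \<longleftrightarrow> (a, b) \<in> bd ?X ?Y \<times> bd ?Y ?X"
      using ab disj b(1,2) unfolding doubleton_eq_iff mem_Times_iff fst_conv snd_conv by blast
    finally show ?thesis .
  qed
  show ?thesis
    by (rule that[OF C Y XY, of "bd ?X ?Y \<times> bd ?Y ?X"]) (use b(1,2) iff in blast)+
qed

text \<open>Bags are nonempty and disjoint, so \<open>bag_index\<close> maps the vertices onto all
  bag numbers.\<close>

lemma k_le_n: "k \<le> n"
proof -
  have "{..<k} \<subseteq> bag_index ` {..<n}"
  proof
    fix i assume i: "i \<in> {..<k}"
    then obtain C where C: "C \<in> comps" "bs ! i \<in> P C" using bag_in_component by auto
    then obtain v where v: "v \<in> bs ! i" using bag_nonempty by blast
    then have vn: "v < n" using C bag_subset component_subset by blast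
    obtain C' where C': "C' \<in> comps" "bs ! bag_index v \<in> P C'"
      using bag_in_component[OF bag_index_props(1)[OF vn]] by blast
    have "bs ! bag_index v = bs ! i"
      using same_bag[OF C'(1) C(1) C'(2) C(2)] bag_index_props(2)[OF vn] v by blast
    then have "bag_index v = i"
      using bag_index_props(1)[OF vn] i numbering by (simp add: numbering_of_def nth_eq_iff_index_eq)
    then show "i \<in> bag_index ` {..<n}" using vn by blast
  qed
  then have "card {..<k} \<le> card (bag_index ` {..<n})" by (intro card_mono) auto
  also have "\<dots> \<le> card {..<n}" by (rule card_image_le) simp
  finally show ?thesis by simp
qed

lemma bag_adj_sym: "bag_adj i j \<Longrightarrow> bag_adj j i"
  by (simp add: bag_adj_def insert_commute)

text \<open>The forest is searched within a single component that meets \<open>A\<close>: there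
  acyclicity of its tree yields a leaf, and bags of other components are never adjacent to
  it.\<close>

lemma bag_adj_leaf:
  assumes A: "A \<subseteq> {..<k}" "A \<noteq> {}"
  shows "\<exists>y\<in>A. \<forall>z1\<in>A. \<forall>z2\<in>A. bag_adj y z1 \<longrightarrow> bag_adj y z2 \<longrightarrow> z1 = z2"
proof -
  obtain r where r: "r \<in> A" using A by auto
  then obtain C where C: "C \<in> comps" "bs ! r \<in> P C" using A bag_in_component by blast
  let ?S = "{X \<in> P C. \<exists>i\<in>A. bs ! i = X}"
  have "\<nexists>xs. is_cycle (T C) xs" using tree[OF C(1)] by (simp add: partition_tree_def is_tree_def)
  then have ex: "\<exists>Y\<in>?S. \<forall>Z1\<in>?S. \<forall>Z2\<in>?S. {Y, Z1} \<in> T C \<longrightarrow> {Y, Z2} \<in> T C \<longrightarrow> Z1 = Z2"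
    by (rule acyclic_has_leaf[OF tree_graph[OF C(1)]]) (use C r in auto)
  obtain Y where Y: "Y \<in> ?S" and leaf_Y: "\<forall>Z1\<in>?S. \<forall>Z2\<in>?S. {Y, Z1} \<in> T C \<longrightarrow> {Y, Z2} \<in> T C \<longrightarrow> Z1 = Z2"
    using ex by (rule bexE)
  obtain y where y: "y \<in> A" "bs ! y \<in> P C" "bs ! y = Y" using Y by blast
  note leaf = leaf_Y[folded y(3)]
  have nb: "bs ! z \<in> ?S \<and> {bs ! y, bs ! z} \<in> T C" if z: "z \<in> A" "bag_adj y z" for z
  proof -
    obtain C' where C': "C' \<in> comps" "{bs ! y, bs ! z} \<in> T C'" using z(2) by (auto simp: bag_adj_def)
    then have yz: "bs ! y \<in> P C'" "bs ! z \<in> P C'"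
      using simple_graph_edgeD(2,3)[OF tree_graph[OF C'(1)] C'(2)] by simp_all
    have "C = C'" using same_component[OF C(1) C'(1) y(2) yz(1)] bag_nonempty[OF C(1) y(2)] by blast
    then show ?thesis using C' yz z by auto
  qed
  have "z1 = z2" if z: "z1 \<in> A" "z2 \<in> A" "bag_adj y z1" "bag_adj y z2" for z1 z2
  proof -
    have "bs ! z1 = bs ! z2" using leaf nb z by blast
    then show ?thesis using z(3,4) numbering unfolding bag_adj_def numbering_of_def
      by (simp add: nth_eq_iff_index_eq)
  qed
  then show ?thesis using y by blast
qed

text \<open>What survives of the partition trees: bags are cliques, edges between two bags form a
  full rectangle along a forest edge, and every nonempty set of bags contains one with at most one
  neighbour in the set. The boundary sets are recovered through marks.\<close>

lemma bag_graph: "bag_graph n k E bag_index bag_adj"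
proof
  show "simple_graph {..<n} E" by (rule simple)
  show "k \<le> n" by (rule k_le_n)
  show "bag_index v < k" if "v < n" for v using bag_index_props that by blast
  show "bag_index (n + i) = i" if "i \<le> k" for i by (simp add: bag_index_def)
  show "{u, v} \<in> E" if uv: "u < n" "v < n" "u \<noteq> v" "bag_index u = bag_index v" for u v
  proof -
    note u = bag_index_props[OF uv(1)] and v = bag_index_props[OF uv(2)]
    obtain C where C: "C \<in> comps" "bs ! bag_index u \<in> P C" using bag_in_component[OF u(1)] by blast
    then have "is_clique (induced_edges E C) (bs ! bag_index u)"
      using tree[OF C(1)] by (auto simp: partition_tree_def)
    then show ?thesis using u v uv by (auto simp: is_clique_def induced_edges_def)
  qed
  show "bag_adj (bag_index u) (bag_index v)" if e: "{u, v} \<in> E" "bag_index u \<noteq> bag_index v" for u v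
  proof -
    have "u < n" "v < n" using simple_graph_edgeD[OF simple e(1)] by auto
    moreover obtain C where "C \<in> comps" "{bs ! bag_index u, bs ! bag_index v} \<in> T C"
      by (rule edge_bag[OF e]) (rule that)
    ultimately show ?thesis using bag_index_props(1) unfolding bag_adj_def by blast
  qed
  show "{u, v'} \<in> E" if e: "{u, v} \<in> E" "{u', v'} \<in> E" and b: "bag_index u = bag_index u'" "bag_index v = bag_index v'"
    "bag_index u \<noteq> bag_index v" for u v u' v'
  proof -
    have n: "u < n" "v < n" "u' < n" "v' < n"
      using simple_graph_edgeD[OF simple e(1)] simple_graph_edgeD[OF simple e(2)] by auto
    note m = bag_index_props(2)[OF n(1)] bag_index_props(2)[OF n(2)]
      bag_index_props(2)[OF n(3), folded b(1)] bag_index_props(2)[OF n(4), folded b(2)]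
    obtain bd where
      iff: "\<forall>a \<in> bs ! bag_index u. \<forall>b \<in> bs ! bag_index v. {a, b} \<in> E \<longleftrightarrow> (a, b) \<in> bd" and
      rect: "\<forall>a b a' b'. (a, b) \<in> bd \<longrightarrow> (a', b') \<in> bd \<longrightarrow> (a, b') \<in> bd"
      by (rule edge_bag[OF e(1) b(3)]) (rule that)
    have "(u, v) \<in> bd" "(u', v') \<in> bd" using iff e m by blast+
    then show ?thesis using rect iff m by blast
  qed
  show "bag_adj j i" if "bag_adj i j" for i j using that by (rule bag_adj_sym)
  show "\<not> bag_adj i i" for i
  proof
    assume "bag_adj i i"
    then obtain C where "C \<in> comps" "{bs ! i, bs ! i} \<in> T C" by (auto simp: bag_adj_def)
    then show False using simple_graph_edgeD(1)[OF tree_graph] by blast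
  qed
  show "\<exists>y\<in>A. \<forall>z1\<in>A. \<forall>z2\<in>A. bag_adj y z1 \<longrightarrow> bag_adj y z2 \<longrightarrow> z1 = z2" if "A \<subseteq> {..<k}" "A \<noteq> {}" for A
    using bag_adj_leaf that .
qed

section \<open>The encoded input and the word bound\<close>

abbreviation input :: state where
  "input \<equiv> input_state n E bs (\<Union>C\<in>comps. T C)"

lemma edge_matrix_index:
  "u < m \<Longrightarrow> v < m \<Longrightarrow> edge_matrix m A (u * m + v) = of_bool ({u, v} \<in> A)"
proof -
  assume uv: "u < m" "v < m"
  have "u * m + v < m * m"
  proof -
    have "u * m + v < Suc u * m" using uv by simp
    also have "\<dots> \<le> m * m" using uv by (intro mult_right_mono) simp_all
    finally show ?thesis .
  qed
  then show ?thesis using uv by (simp add: edge_matrix_def)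
qed

text \<open>The encoded edges are unordered pairs, so the pair may be matched in either order;
  symmetry of \<open>bag_adj\<close> makes this harmless.\<close>

lemma forest_iff:
  "{i, j} \<in> {{i, j} | i j. i < k \<and> j < k \<and> {bs ! i, bs ! j} \<in> (\<Union>C\<in>comps. T C)} \<longleftrightarrow> bag_adj i j"
proof
  assume "{i, j} \<in> {{i, j} | i j. i < k \<and> j < k \<and> {bs ! i, bs ! j} \<in> (\<Union>C\<in>comps. T C)}"
  then obtain i' j' where "{i, j} = {i', j'}" "bag_adj i' j'" unfolding bag_adj_def by blast
  then show "bag_adj i j" using bag_adj_sym by (auto simp: doubleton_eq_iff)
qed (auto simp: bag_adj_def)

abbreviation forest_matrix :: "nat \<Rightarrow> nat" where
  "forest_matrix \<equiv> edge_matrix k {{i, j} | i j. i < k \<and> j < k \<and> {bs ! i, bs ! j} \<in> (\<Union>C\<in>comps. T C)}"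

lemma input_eq: "input = \<lparr>regs = (\<lambda>_. 0)(''n'' := n, ''k'' := k),
    arrs = (\<lambda>_ _. 0)(''graph'' := edge_matrix n E,
      ''bag'' := \<lambda>v. if v < n then bag_index v else 0, ''forest'' := forest_matrix)\<rparr>"
proof -
  have "(\<lambda>v. if v < n then THE i. i < k \<and> v \<in> bs ! i else 0) = (\<lambda>v. if v < n then bag_index v else 0)"
    unfolding bag_index_def by (intro ext) simp
  then show ?thesis unfolding input_state_def by (simp only:)
qed

lemma small_input: "small (4 * n + 10) input"
proof -
  have s: "small b \<lparr>regs = (\<lambda>_. 0)(''n'' := n, ''k'' := k), arrs = (\<lambda>_ _. 0)(''graph'' := g, ''bag'' := h, ''forest'' := f)\<rparr>"
    if "n \<le> b" "k \<le> b" "\<And>i. g i \<le> b" "\<And>i. h i \<le> b" "\<And>i. f i \<le> b" for g h f and b :: nat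
    using that by (simp add: small_def)
  show ?thesis unfolding input_eq
  proof (rule s)
    show "(if v < n then bag_index v else 0) \<le> 4 * n + 10" for v
      using bag_index_props(1)[of v] k_le_n by (cases "v < n") simp_all
  qed (use k_le_n in \<open>simp_all add: edge_matrix_def\<close>)
qed

lemma eop_program_correct:
  "halts_within ((n + 2) ^ (4 * csz eop_program + 1)) eop_program input (tm (2 * n + 8) eop_program)
    (\<lambda>s. regs s ''result'' = eop_number E \<and> (\<exists>D. max_edge_open_packing E D \<and> outputs_edge_set n D s))"
proof -
  let ?W = "(n + 2) ^ (4 * csz eop_program + 1)"
  have ram: "ram (4 * n + 10)" by (rule ram.intro) simp
  have algo: "algo n k E bag_index bag_adj" using bag_graph ram by (rule algo.intro)
  show ?thesis
  proof (rule ram.wp_halts_within[OF ram algo.wp_eop_program[OF algo] small_input])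
    \<comment> \<open>As \<open>n + 2 \<ge> 2\<close>, the factor 8 is at most
      \<open>(n + 2) ^ 3\<close>; this is the 4 in the exponent of the word bound, and the extra 1
      there makes the inequality strict.\<close>
    have "4 * n + 10 \<le> 8 * (n + 2)" by simp
    also have "\<dots> \<le> (n + 2) ^ 3 * (n + 2)"
      by (intro mult_right_mono order_trans[OF _ power_mono[of 2 "n + 2" 3]]) simp_all
    also have "\<dots> = (n + 2) ^ 4" by (simp add: eval_nat_numeral)
    finally have "(4 * n + 10) ^ csz eop_program \<le> ((n + 2) ^ 4) ^ csz eop_program"
      by (rule power_mono) simp
    also have "\<dots> = (n + 2) ^ (4 * csz eop_program)" by (simp only: power_mult)
    also have "\<dots> < ?W" by (rule power_strict_increasing) simp_all
    finally show "(4 * n + 10) ^ csz eop_program < ?W" .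
  next
    show "arrs input ''graph'' (u * n + v) = of_bool ({u, v} \<in> E)" if "u < n" "v < n" for u v
    proof -
      have "arrs input ''graph'' = edge_matrix n E" unfolding input_eq by simp
      then show ?thesis using edge_matrix_index[OF that] by (simp only:)
    qed
    show "arrs input ''forest'' (i * k + j) = of_bool (bag_adj i j)" if "i < k" "j < k" for i j
    proof -
      have "arrs input ''forest'' = forest_matrix" unfolding input_eq by simp
      then show ?thesis using edge_matrix_index[OF that] by (simp only: forest_iff)
    qed
  qed (simp_all add: input_eq)
qed

end

theorem theorem16:
  shows
   "(\<exists>(c::com) (d::nat) (time :: nat \<Rightarrow> nat).
       (\<lambda>n. real (time n)) \<in> O(\<lambda>n. real n ^ 4) \<and>
       (\<forall>(n::nat) (E :: nat set set) P T bs.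
          well_partitioned_chordal {..<n} E \<and>
          partition_tree_family n E P T \<and>
          numbering_of bs (\<Union>C \<in> graph_components {..<n} E. P C) \<longrightarrow>
          halts_within ((n + 2) ^ d) c
            (input_state n E bs (\<Union>C \<in> graph_components {..<n} E. T C)) (time n)
            (outputs_number (eop_number E)))) \<and>
    (\<exists>(c::com) (d::nat) (time :: nat \<Rightarrow> nat).
       (\<lambda>n. real (time n)) \<in> O(\<lambda>n. real n ^ 4) \<and>
       (\<forall>(n::nat) (E :: nat set set) P T bs.
          well_partitioned_chordal {..<n} E \<and>
          partition_tree_family n E P T \<and>
          numbering_of bs (\<Union>C \<in> graph_components {..<n} E. P C) \<longrightarrow>
          halts_within ((n + 2) ^ d) c
            (input_state n E bs (\<Union>C \<in> graph_components {..<n} E. T C)) (time n)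
            (\<lambda>s. \<exists>D. max_edge_open_packing E D \<and> outputs_edge_set n D s)))"
proof -
  let ?d = "4 * csz eop_program + 1"
  let ?time = "\<lambda>n. tm (2 * n + 8) eop_program"
  have bigo: "(\<lambda>n. real (?time n)) \<in> O(\<lambda>n. real n ^ 4)"
    by (rule poly_time_bigo[OF poly_time_eop_program])
  \<comment> \<open>One program serves both claims: the register \<open>result\<close> receives the
    number and the array of the same name the packing.\<close>
  have correct: "halts_within ((n + 2) ^ ?d) eop_program
      (input_state n E bs (\<Union>C \<in> graph_components {..<n} E. T C)) (?time n)
      (\<lambda>s. regs s ''result'' = eop_number E \<and> (\<exists>D. max_edge_open_packing E D \<and> outputs_edge_set n D s))"
    if "well_partitioned_chordal {..<n} E \<and> partition_tree_family n E P T \<and>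
      numbering_of bs (\<Union>C \<in> graph_components {..<n} E. P C)" for n E P T bs
  proof -
    interpret partition_forest n E P T bs
      by unfold_locales (use that in \<open>simp_all add: well_partitioned_chordal_def\<close>)
    show ?thesis by (rule eop_program_correct)
  qed
  have mono: "halts_within W c s t Q \<Longrightarrow> (\<And>s. Q s \<Longrightarrow> Q' s) \<Longrightarrow> halts_within W c s t Q'" for W c s t Q Q'
    unfolding halts_within_def by blast
  show ?thesis
  proof (intro conjI exI allI impI)
    fix n E P T bs
    assume "well_partitioned_chordal {..<n} E \<and> partition_tree_family n E P T \<and>
      numbering_of bs (\<Union>C \<in> graph_components {..<n} E. P C)"
    from correct[OF this] show "halts_within ((n + 2) ^ ?d) eop_program
        (input_state n E bs (\<Union>C \<in> graph_components {..<n} E. T C)) (?time n) (outputs_number (eop_number E))"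
      by (rule mono) (simp add: outputs_number_def)
  next
    fix n E P T bs
    assume "well_partitioned_chordal {..<n} E \<and> partition_tree_family n E P T \<and>
      numbering_of bs (\<Union>C \<in> graph_components {..<n} E. P C)"
    from correct[OF this] show "halts_within ((n + 2) ^ ?d) eop_program
        (input_state n E bs (\<Union>C \<in> graph_components {..<n} E. T C)) (?time n)
        (\<lambda>s. \<exists>D. max_edge_open_packing E D \<and> outputs_edge_set n D s)"
      by (rule mono) simp
  qed (rule bigo)+
qed

end
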